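(* Let $X$ and $Y$ be compact geodesic spaces, and let $f: X \to \mathbb{R}$ and $g: Y \to \mathbb{R}$ be $1$-Lipschitz functions. Let $M_f, M_g$ be the number of local minima of $f, g$ respectively. Then $$ d_{\mathrm{GH}}(R_f,R_g) \leq \bigl(8\,b_1(X)+8\,b_1(Y)+8M_f+8M_g-4\bigr)\, d_{\mathrm{GH}}((X,f),(Y,g)). $$
   Context: Geodesic space: a metric space in which any two points are joined by a path whose length equals their distance. $b_1$ denotes the first Betti number, i.e. the dimension of first singular homology with real coefficients. The quantities $b_1(X),b_1(Y),M_f,M_g$ may be infinite; $M_f$ counts the points of $X$ that are local minima of $f$; the convention $\infty\cdot 0=0$ is used. Reeb metric graph: for a compact geodesic space $X$ and $1$-Lipschitz $f:X\to\mathbb{R}$, $R_f$ is the topological quotient of $X$ identifying points that lie in the same connected component of a fiber $f^{-1}(c)$, $c\in\mathbb{R}$; the class of $x$ is $[x]$, and $\bar f: R_f\to\mathbb{R}$, $\bar f([x])=f(x)$. $R_f$ is endowed with the Reeb metric $d_f([x],[y]) := \inf_\beta \mathrm{length}_{\mathbb{R}}(\bar f\circ\beta)$, where $\beta$ ranges over all continuous paths in $R_f$ (quotient topology) from $[x]$ to $[y]$, and $\mathrm{length}_{\mathbb{R}}$ is the length (total variation) of a path in $\mathbb{R}$. A correspondence $R$ between sets $X$ and $Y$ is a subset of $X\times Y$ projecting onto both $X$ and $Y$. For metric spaces, $\mathrm{dis}(R):=\sup_{(x,y),(x',y')\in R}|d_X(x,x')-d_Y(y,y')|$, and $d_{\mathrm{GH}}(X,Y):=\frac12\inf_R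 \mathrm{dis}(R)$ over all correspondences. With functions $f:X\to\mathbb{R}$, $g:Y\to\mathbb{R}$, put $\mathrm{dis}_{f,g}(R):=\max\bigl(\mathrm{dis}(R),\sup_{(x,y)\in R}|f(x)-g(y)|\bigr)$ and $d_{\mathrm{GH}}((X,f),(Y,g)):=\frac12\inf_R\mathrm{dis}_{f,g}(R)$ over all correspondences $R$ between $X$ and $Y$. *)

theory Defs
  imports "HOL-Analysis.Analysis" "HOL-Homology.Homology" "HOL-Library.Extended_Nat"
begin

section \<open>Betti numbers with real coefficients\<close>

text \<open>
  The library's singular chains have integer coefficients. Chains with real coefficients are
  built from the same singular simplices and faces; the boundary operator copies
  \<^const>\<open>chain_boundary\<close> with real instead of integer weights.
\<close>

instantiation poly_mapping :: (type, real_vector) real_vector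
begin

lift_definition scaleR_poly_mapping :: "real \<Rightarrow> ('a \<Rightarrow>\<^sub>0 'b) \<Rightarrow> ('a \<Rightarrow>\<^sub>0 'b)"
  is "\<lambda>r c k. r *\<^sub>R c k"
proof -
  fix r :: real and c :: "'a \<Rightarrow> 'b"
  assume "finite {k. c k \<noteq> 0}"
  then show "finite {k. r *\<^sub>R c k \<noteq> 0}"
    by (rule rev_finite_subset) auto
qed

instance
  by standard (transfer; simp add: fun_eq_iff algebra_simps)+

end

type_synonym 'a real_chain = "((nat \<Rightarrow> real) \<Rightarrow> 'a) \<Rightarrow>\<^sub>0 real"

definition real_chain_set :: "nat \<Rightarrow> 'a topology \<Rightarrow> 'a real_chain set" where
  "real_chain_set p X = {c. Poly_Mapping.keys c \<subseteq> singular_simplex_set p X}"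

definition real_chain_boundary :: "nat \<Rightarrow> 'a real_chain \<Rightarrow> 'a real_chain" where
  "real_chain_boundary p c =
     (if p = 0 then 0
      else \<Sum>s\<in>Poly_Mapping.keys c. \<Sum>k\<le>p.
        Poly_Mapping.single (singular_face p k s) ((-1) ^ k * Poly_Mapping.lookup c s))"

definition real_cycles :: "nat \<Rightarrow> 'a topology \<Rightarrow> 'a real_chain set" where
  "real_cycles p X = {c \<in> real_chain_set p X. real_chain_boundary p c = 0}"

definition real_boundaries :: "nat \<Rightarrow> 'a topology \<Rightarrow> 'a real_chain set" where
  "real_boundaries p X = real_chain_boundary (Suc p) ` real_chain_set (Suc p) X"

text \<open>
  Dimension of the quotient vector space \<open>V / W\<close> of two subspaces \<open>W \<subseteq> V\<close>: the supremum of the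
  sizes of finite linearly independent families in \<open>V / W\<close>, given by representatives in \<open>V\<close>.
  It is \<open>\<infinity>\<close> iff the quotient is infinite-dimensional.
\<close>

definition quotient_dim :: "'v::real_vector set \<Rightarrow> 'v set \<Rightarrow> enat" where
  "quotient_dim V W =
     (SUP S \<in> {S. finite S \<and> S \<subseteq> V \<and>
                  (\<forall>a. (\<Sum>v\<in>S. a v *\<^sub>R v) \<in> W \<longrightarrow> (\<forall>v\<in>S. a v = 0))}. enat (card S))"

definition betti_number :: "nat \<Rightarrow> 'a topology \<Rightarrow> enat" where
  "betti_number p X = quotient_dim (real_cycles p X) (real_boundaries p X)"


section \<open>Geodesic spaces and local minima\<close>

text \<open>Length of a path parametrised by \<open>[0,1]\<close>; for real-valued paths it is the total variation.\<close>

definition curve_length :: "(real \<Rightarrow> 'a::metric_space) \<Rightarrow> ereal" where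
  "curve_length \<gamma> =
     (SUP ts \<in> {ts. sorted ts \<and> set ts \<subseteq> {0..1}}.
        ereal (\<Sum>i<length ts - 1. dist (\<gamma> (ts ! i)) (\<gamma> (ts ! Suc i))))"

definition geodesic_space :: "'a::metric_space set \<Rightarrow> bool" where
  "geodesic_space X \<longleftrightarrow>
     (\<forall>x\<in>X. \<forall>y\<in>X. \<exists>\<gamma>. path \<gamma> \<and> path_image \<gamma> \<subseteq> X \<and> pathstart \<gamma> = x \<and> pathfinish \<gamma> = y \<and>
        curve_length \<gamma> = ereal (dist x y))"

definition local_minima :: "'a::topological_space set \<Rightarrow> ('a \<Rightarrow> real) \<Rightarrow> 'a set" where
  "local_minima X f = {x \<in> X. \<forall>\<^sub>F y in at x within X. f x \<le> f y}"

definition num_local_minima :: "'a::topological_space set \<Rightarrow> ('a \<Rightarrow> real) \<Rightarrow> enat" where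
  "num_local_minima X f =
     (if finite (local_minima X f) then enat (card (local_minima X f)) else \<infinity>)"


section \<open>Reeb metric graphs\<close>

definition reeb_class :: "'a::topological_space set \<Rightarrow> ('a \<Rightarrow> real) \<Rightarrow> 'a \<Rightarrow> 'a set" where
  "reeb_class X f x = connected_component_set {y \<in> X. f y = f x} x"

definition reeb_graph :: "'a::topological_space set \<Rightarrow> ('a \<Rightarrow> real) \<Rightarrow> 'a set set" where
  "reeb_graph X f = reeb_class X f ` X"

definition reeb_topology :: "'a::topological_space set \<Rightarrow> ('a \<Rightarrow> real) \<Rightarrow> 'a set topology" where
  "reeb_topology X f =
     topology (\<lambda>U. U \<subseteq> reeb_graph X f \<and> openin (top_of_set X) {x \<in> X. reeb_class X f x \<in> U})"

text \<open>The induced function on the quotient: \<open>f\<close> is constant on every class.\<close>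

definition reeb_fun :: "('a \<Rightarrow> real) \<Rightarrow> 'a set \<Rightarrow> real" where
  "reeb_fun f P = the_elem (f ` P)"

text \<open>
  The conversion to \<^typ>\<open>real\<close> loses nothing on compact geodesic spaces with a 1-Lipschitz
  function: the infimum is then finite, see \<open>reeb_dist_finite\<close> below.
\<close>

definition reeb_dist :: "'a::topological_space set \<Rightarrow> ('a \<Rightarrow> real) \<Rightarrow> 'a set \<Rightarrow> 'a set \<Rightarrow> real" where
  "reeb_dist X f P Q =
     real_of_ereal
       (INF \<beta> \<in> {\<beta>. pathin (reeb_topology X f) \<beta> \<and> \<beta> 0 = P \<and> \<beta> 1 = Q}.
          curve_length (reeb_fun f \<circ> \<beta>))"

lemma istopology_reeb:
  "istopology (\<lambda>U. U \<subseteq> reeb_graph X f \<and> openin (top_of_set X) {x \<in> X. reeb_class X f x \<in> U})"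
proof -
  have I: "{x \<in> X. reeb_class X f x \<in> S \<inter> T} =
      {x \<in> X. reeb_class X f x \<in> S} \<inter> {x \<in> X. reeb_class X f x \<in> T}" for S T
    by auto
  have U: "{x \<in> X. reeb_class X f x \<in> \<Union>\<K>} = (\<Union>K\<in>\<K>. {x \<in> X. reeb_class X f x \<in> K})" for \<K>
    by auto
  show ?thesis
    unfolding istopology_def I U by (auto intro!: openin_Int openin_Union)
qed

lemma openin_reeb_topology:
  "openin (reeb_topology X f) U \<longleftrightarrow>
     U \<subseteq> reeb_graph X f \<and> openin (top_of_set X) {x \<in> X. reeb_class X f x \<in> U}"
  by (simp add: reeb_topology_def topology_inverse' [OF istopology_reeb])

lemma topspace_reeb_topology [simp]: "topspace (reeb_topology X f) = reeb_graph X f"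
proof -
  have "{x \<in> X. reeb_class X f x \<in> reeb_graph X f} = X"
    by (auto simp: reeb_graph_def)
  then have "openin (reeb_topology X f) (reeb_graph X f)"
    by (simp add: openin_reeb_topology)
  then show ?thesis
    by (metis openin_reeb_topology openin_subset openin_topspace subset_antisym)
qed

lemma quotient_map_reeb_class:
  "quotient_map (top_of_set X) (reeb_topology X f) (reeb_class X f)"
  by (auto simp: quotient_map_def openin_reeb_topology reeb_graph_def)

lemma reeb_fun_reeb_class:
  assumes "x \<in> X"
  shows "reeb_fun f (reeb_class X f x) = f x"
proof -
  have "x \<in> reeb_class X f x"
    using assms by (simp add: reeb_class_def)
  moreover have "reeb_class X f x \<subseteq> {y \<in> X. f y = f x}"
    unfolding reeb_class_def by (rule connected_component_subset)
  ultimately have "f ` reeb_class X f x = {f x}"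
    by auto
  then show ?thesis
    by (simp add: reeb_fun_def)
qed

lemma reeb_dist_finite:
  assumes "geodesic_space X" and lip: "1-lipschitz_on X f"
    and P: "P \<in> reeb_graph X f" and Q: "Q \<in> reeb_graph X f"
  shows "ereal (reeb_dist X f P Q) =
    (INF \<beta> \<in> {\<beta>. pathin (reeb_topology X f) \<beta> \<and> \<beta> 0 = P \<and> \<beta> 1 = Q}.
       curve_length (reeb_fun f \<circ> \<beta>))" (is "_ = ?I")
proof -
  obtain x y where x: "x \<in> X" "P = reeb_class X f x" and y: "y \<in> X" "Q = reeb_class X f y"
    using P Q by (auto simp: reeb_graph_def)
  then obtain \<gamma> where \<gamma>: "path \<gamma>" "path_image \<gamma> \<subseteq> X" "pathstart \<gamma> = x" "pathfinish \<gamma> = y"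
      "curve_length \<gamma> = ereal (dist x y)"
    using assms(1) unfolding geodesic_space_def by blast
  have inX: "\<gamma> t \<in> X" if "t \<in> {0..1}" for t
    using \<gamma>(2) that by (auto simp: path_image_def)
  define \<beta> where "\<beta> = reeb_class X f \<circ> \<gamma>"
  have "pathin (top_of_set X) \<gamma>"
    using \<gamma>(1) inX by (auto simp: pathin_def path_def continuous_map_in_subtopology)
  then have path: "pathin (reeb_topology X f) \<beta>"
    unfolding \<beta>_def
    by (rule pathin_compose) (rule quotient_imp_continuous_map [OF quotient_map_reeb_class])
  have "curve_length (reeb_fun f \<circ> \<beta>) \<le> curve_length \<gamma>"
    unfolding curve_length_def
  proof (intro SUP_subset_mono order_refl iffD2 [OF ereal_less_eq(3)])
    fix ts :: "real list"
    assume ts: "ts \<in> {ts. sorted ts \<and> set ts \<subseteq> {0..1}}"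
    show "(\<Sum>i<length ts - 1. dist ((reeb_fun f \<circ> \<beta>) (ts ! i)) ((reeb_fun f \<circ> \<beta>) (ts ! Suc i)))
       \<le> (\<Sum>i<length ts - 1. dist (\<gamma> (ts ! i)) (\<gamma> (ts ! Suc i)))"
    proof (rule sum_mono)
      fix i assume "i \<in> {..<length ts - 1}"
      then have "ts ! i \<in> {0..1}" "ts ! Suc i \<in> {0..1}"
        using ts by (auto simp: subset_iff)
      then show "dist ((reeb_fun f \<circ> \<beta>) (ts ! i)) ((reeb_fun f \<circ> \<beta>) (ts ! Suc i))
          \<le> dist (\<gamma> (ts ! i)) (\<gamma> (ts ! Suc i))"
        using lipschitz_onD [OF lip] by (simp add: \<beta>_def reeb_fun_reeb_class inX)
    qed
  qed
  then have "?I \<le> ereal (dist x y)"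
    using path x y \<gamma>(3-5)
    by (intro INF_lower2 [of \<beta>]) (auto simp: \<beta>_def pathstart_def pathfinish_def)
  moreover have "0 \<le> ?I"
    by (intro INF_greatest) (auto simp: curve_length_def intro!: SUP_upper2 [of "[]"])
  ultimately show ?thesis
    unfolding reeb_dist_def by (intro ereal_real') auto
qed


section \<open>Gromov--Hausdorff distances\<close>

text \<open>
  A metric space is given by a carrier set and a distance function, so that Reeb graphs are
  covered as well.
\<close>

definition correspondence :: "'a set \<Rightarrow> 'b set \<Rightarrow> ('a \<times> 'b) set \<Rightarrow> bool" where
  "correspondence A B R \<longleftrightarrow> R \<subseteq> A \<times> B \<and> fst ` R = A \<and> snd ` R = B"

definition distortion ::
  "('a \<Rightarrow> 'a \<Rightarrow> real) \<Rightarrow> ('b \<Rightarrow> 'b \<Rightarrow> real) \<Rightarrow> ('a \<times> 'b) set \<Rightarrow> ereal" where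
  "distortion dA dB R = (SUP (x, y) \<in> R. SUP (x', y') \<in> R. ereal \<bar>dA x x' - dB y y'\<bar>)"

definition distortion_fun ::
  "('a \<Rightarrow> 'a \<Rightarrow> real) \<Rightarrow> ('a \<Rightarrow> real) \<Rightarrow> ('b \<Rightarrow> 'b \<Rightarrow> real) \<Rightarrow> ('b \<Rightarrow> real) \<Rightarrow> ('a \<times> 'b) set \<Rightarrow> ereal"
  where
  "distortion_fun dA f dB g R = max (distortion dA dB R) (SUP (x, y) \<in> R. ereal \<bar>f x - g y\<bar>)"

definition GH_dist ::
  "'a set \<Rightarrow> ('a \<Rightarrow> 'a \<Rightarrow> real) \<Rightarrow> 'b set \<Rightarrow> ('b \<Rightarrow> 'b \<Rightarrow> real) \<Rightarrow> ereal" where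
  "GH_dist A dA B dB = (INF R \<in> {R. correspondence A B R}. distortion dA dB R) / 2"

definition GH_dist_fun ::
  "'a set \<Rightarrow> ('a \<Rightarrow> 'a \<Rightarrow> real) \<Rightarrow> ('a \<Rightarrow> real) \<Rightarrow> 'b set \<Rightarrow> ('b \<Rightarrow> 'b \<Rightarrow> real) \<Rightarrow> ('b \<Rightarrow> real) \<Rightarrow> ereal"
  where
  "GH_dist_fun A dA f B dB g = (INF R \<in> {R. correspondence A B R}. distortion_fun dA f dB g R) / 2"

end

theory Submission
  imports Defs
begin

text \<open>
  Let \<open>R\<close> be a correspondence between \<open>X\<close> and \<open>Y\<close> that distorts distances and heights by at most
  \<open>r\<close>, and let \<open>B\<close> be at least \<open>b\<^sub>1(Y) + M\<^sub>g\<close>. For \<open>(x, y)\<close> and \<open>(x', y')\<close> in \<open>R\<close> the distance of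
  \<open>[y]\<close> and \<open>[y']\<close> in \<open>R\<^sub>g\<close> exceeds the distance of \<open>[x]\<close> and \<open>[x']\<close> in \<open>R\<^sub>f\<close> by at most
  \<open>6 (B + 1) r\<close> (lemma \<open>reeb_dist_le\<close>); the rest is symmetry, and \<open>M\<^sub>f, M\<^sub>g \<ge> 1\<close> turns the two
  constants into the one of the theorem.

  Consider an almost shortest path in \<open>R\<^sub>f\<close>. The correspondence carries it to a path in \<open>Y\<close> whose
  height stays within \<open>3 r / 2\<close> of the height along the original path. Erasing loops of the image
  path in \<open>R\<^sub>g\<close> leaves a simple path whose points are still visited in the original order. Its length
  is the sum of the height differences between consecutive turns, so it is at most the length of the
  original path plus an error of \<open>3 r\<close> for every turn and \<open>3 r / 2\<close> for each end
  (\<open>zigzag_length_le\<close>): what matters is the number of turns alone, no matter how much the image path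
  oscillates.

  A simple path has few turns. From each of its lower turns descend to a local minimum of \<open>g\<close>. Two
  descents that reach the same local minimum, together with the piece of the path between them, form a
  loop, and the loops obtained in this way are independent in homology: the map from \<open>Y\<close> to the circle
  that wraps a thin slab of heights just above a lower turn, on the component that belongs to this
  turn, detects the descent from this turn but none from the other turns at the same height or
  below. Hence there are at most \<open>b\<^sub>1(Y) + M\<^sub>g\<close> lower turns (\<open>card_lower_turns_le\<close>).

  Loops are erased at a positive scale \<open>\<delta>\<close>, which avoids proving that \<open>R\<^sub>g\<close> is a finite graph: the
  points of \<open>R\<^sub>g\<close> are replaced by the path components of the slabs \<open>(k - 1) \<delta> < g < (k + 1) \<delta>\<close>, and
  two components of neighbouring slabs are adjacent if they meet. A compactness argument on functions
  \<open>[0, 1] \<rightarrow> Y\<close> lets \<open>\<delta>\<close> tend to \<open>0\<close> (\<open>reeb_dist_le_of_approximate_paths\<close>).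

  If the coefficient in the theorem is infinite, only \<open>d\<^sub>G\<^sub>H((X, f), (Y, g)) = 0\<close> is of interest. The
  same compactness argument then gives an isometry between \<open>X\<close> and \<open>Y\<close> that preserves heights, and
  the Reeb graphs are isometric.
\<close>

section \<open>Real chains and a lower bound for Betti numbers\<close>

definition linear_ext :: "('k \<Rightarrow> 'v::real_vector) \<Rightarrow> ('k \<Rightarrow>\<^sub>0 real) \<Rightarrow> 'v" where
  "linear_ext \<phi> c = (\<Sum>k\<in>Poly_Mapping.keys c. Poly_Mapping.lookup c k *\<^sub>R \<phi> k)"

lemma linear_ext_superset:
  assumes "finite A" "Poly_Mapping.keys c \<subseteq> A"
  shows "linear_ext \<phi> c = (\<Sum>k\<in>A. Poly_Mapping.lookup c k *\<^sub>R \<phi> k)"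
  unfolding linear_ext_def
  by (rule sum.mono_neutral_left) (use assms in \<open>auto simp: in_keys_iff\<close>)

lemma linear_linear_ext: "linear (linear_ext \<phi>)"
proof (rule linearI)
  fix c d :: "'a \<Rightarrow>\<^sub>0 real" and r :: real
  let ?A = "Poly_Mapping.keys c \<union> Poly_Mapping.keys d"
  have *: "linear_ext \<phi> e = (\<Sum>k\<in>?A. Poly_Mapping.lookup e k *\<^sub>R \<phi> k)"
    if "e \<in> {c, d, c + d}" for e
    by (rule linear_ext_superset) (use that Poly_Mapping.keys_add[of c d] in auto)
  show "linear_ext \<phi> (c + d) = linear_ext \<phi> c + linear_ext \<phi> d"
    by (simp add: * lookup_add scaleR_add_left sum.distrib)
  have "linear_ext \<phi> (r *\<^sub>R c) = (\<Sum>k\<in>Poly_Mapping.keys c. Poly_Mapping.lookup (r *\<^sub>R c) k *\<^sub>R \<phi> k)"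
    by (rule linear_ext_superset) (auto simp: in_keys_iff scaleR_poly_mapping.rep_eq)
  then show "linear_ext \<phi> (r *\<^sub>R c) = r *\<^sub>R linear_ext \<phi> c"
    by (simp add: linear_ext_def scaleR_poly_mapping.rep_eq scaleR_sum_right)
qed

lemma linear_ext_single [simp]: "linear_ext \<phi> (Poly_Mapping.single k a) = a *\<^sub>R \<phi> k"
  by (cases "a = 0") (auto simp: linear_ext_def)

lemma scaleR_single: "r *\<^sub>R Poly_Mapping.single k a = Poly_Mapping.single k (r * a :: real)"
  by (rule poly_mapping_eqI) (simp add: scaleR_poly_mapping.rep_eq lookup_single when_def)

lemma real_chain_boundary_eq_linear_ext:
  assumes "p \<noteq> 0"
  shows "real_chain_boundary p =
    linear_ext (\<lambda>s. \<Sum>k\<le>p. Poly_Mapping.single (singular_face p k s) ((-1) ^ k))"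
  using assms
  by (auto simp: fun_eq_iff real_chain_boundary_def linear_ext_def scaleR_sum_right scaleR_single
      mult.commute)

lemma linear_real_chain_boundary: "p \<noteq> 0 \<Longrightarrow> linear (real_chain_boundary p)"
  by (simp add: real_chain_boundary_eq_linear_ext linear_linear_ext)

lemma real_chain_set_add: "c \<in> real_chain_set p X \<Longrightarrow> d \<in> real_chain_set p X \<Longrightarrow> c + d \<in> real_chain_set p X"
  using Poly_Mapping.keys_add[of c d] by (fastforce simp: real_chain_set_def)

lemma real_chain_set_diff: "c \<in> real_chain_set p X \<Longrightarrow> d \<in> real_chain_set p X \<Longrightarrow> c - d \<in> real_chain_set p X"
  using keys_diff[of c d] by (fastforce simp: real_chain_set_def)

lemma real_chain_set_sum:
  "(\<And>i. i \<in> A \<Longrightarrow> c i \<in> real_chain_set p X) \<Longrightarrow> sum c A \<in> real_chain_set p X"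
  by (induction A rule: infinite_finite_induct)
     (auto intro!: real_chain_set_add, auto simp: real_chain_set_def)

text \<open>
  Linear functionals that vanish on \<open>W\<close> and have a triangular matrix on a family of vectors of \<open>V\<close>
  show that the family is independent modulo \<open>W\<close>. In the application the functionals are cocycles and
  \<open>level\<close> is a height, which need not be injective.
\<close>
lemma card_le_quotient_dim:
  fixes level :: "'i \<Rightarrow> 'l::linorder" and \<Phi> :: "'i \<Rightarrow> 'v::real_vector \<Rightarrow> real"
  assumes "finite J" and V: "\<And>j. j \<in> J \<Longrightarrow> c j \<in> V"
    and lin: "\<And>j. j \<in> J \<Longrightarrow> linear (\<Phi> j)"
    and van: "\<And>j v. j \<in> J \<Longrightarrow> v \<in> W \<Longrightarrow> \<Phi> j v = 0"
    and diag: "\<And>j. j \<in> J \<Longrightarrow> \<Phi> j (c j) \<noteq> 0"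
    and tri: "\<And>i j. i \<in> J \<Longrightarrow> j \<in> J \<Longrightarrow> i \<noteq> j \<Longrightarrow> level i \<le> level j \<Longrightarrow> \<Phi> j (c i) = 0"
  shows "enat (card J) \<le> quotient_dim V W"
proof -
  have inj: "inj_on c J"
  proof (rule inj_onI, rule ccontr)
    fix i j assume ij: "i \<in> J" "j \<in> J" "c i = c j" "i \<noteq> j"
    then show False
      using tri[of i j] tri[of j i] diag[of i] diag[of j] by (cases "level i \<le> level j") auto
  qed
  have ind: "\<forall>v\<in>c ` J. a v = 0" if a: "(\<Sum>v\<in>c ` J. a v *\<^sub>R v) \<in> W" for a
  proof (rule ccontr)
    assume *: "\<not> (\<forall>v\<in>c ` J. a v = 0)"
    define N where "N = {j \<in> J. a (c j) \<noteq> 0}"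
    have N: "finite N" "N \<noteq> {}" "N \<subseteq> J"
      using * \<open>finite J\<close> by (auto simp: N_def)
    obtain j where j: "j \<in> N" "\<And>i. i \<in> N \<Longrightarrow> level i \<le> level j"
    proof -
      have "Max (level ` N) \<in> level ` N" using N by (intro Max_in) auto
      then obtain j where "j \<in> N" "level j = Max (level ` N)" by auto
      then show ?thesis using N by (intro that[of j]) auto
    qed
    have jJ: "j \<in> J" using j N by auto
    have "0 = \<Phi> j (\<Sum>v\<in>c ` J. a v *\<^sub>R v)" using van[OF jJ a] by simp
    also have "\<dots> = (\<Sum>i\<in>J. a (c i) * \<Phi> j (c i))"
      by (simp add: sum.reindex[OF inj] linear_sum[OF lin[OF jJ]] linear_scale[OF lin[OF jJ]])
    also have "\<dots> = (\<Sum>i\<in>{j}. a (c i) * \<Phi> j (c i))"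
    proof (rule sum.mono_neutral_right)
      show "\<forall>i\<in>J - {j}. a (c i) * \<Phi> j (c i) = 0"
        using tri[OF _ jJ] j(2) by (fastforce simp: N_def)
    qed (use jJ \<open>finite J\<close> in auto)
    finally show False using j(1) diag[OF jJ] by (auto simp: N_def)
  qed
  show ?thesis
    unfolding quotient_dim_def
    by (rule SUP_upper2[of "c ` J"]) (use V ind \<open>finite J\<close> in \<open>auto simp: card_image[OF inj]\<close>)
qed

section \<open>Winding numbers as real cocycles\<close>

definition circle_lift :: "(real \<Rightarrow> complex) \<Rightarrow> (real \<Rightarrow> real) \<Rightarrow> bool" where
  "circle_lift p L \<longleftrightarrow> continuous_on {0..1} L \<and> (\<forall>t\<in>{0..1}. p t = cis (2 * pi * L t))"

text \<open>
  The total change of angle, in full turns, of a path in the unit circle. The path need not be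
  closed, so the value is a real number.
\<close>
definition wind :: "(real \<Rightarrow> complex) \<Rightarrow> real" where
  "wind p = (SOME d. \<exists>L. circle_lift p L \<and> d = L 1 - L 0)"

lemma cis_2pi_eq_iff: "cis (2 * pi * a) = cis (2 * pi * b) \<longleftrightarrow> a - b \<in> \<int>"
proof -
  have "cis (2 * pi * a) = cis (2 * pi * b) \<longleftrightarrow> cis (2 * pi * (a - b)) = 1"
    by (simp add: right_diff_distrib cis_divide[symmetric])
  also have "\<dots> \<longleftrightarrow> a - b \<in> \<int>"
  proof
    assume "cis (2 * pi * (a - b)) = 1"
    then have "cos (2 * pi * (a - b)) = 1" by (metis cis.sel(1) one_complex.sel(1))
    then obtain n :: int where "2 * pi * (a - b) = of_int n * 2 * pi"
      using cos_one_2pi_int by blast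
    then have "a - b = of_int n" by simp
    then show "a - b \<in> \<int>" by simp
  qed (auto elim!: Ints_cases)
  finally show ?thesis .
qed

lemma wind_eq:
  assumes L: "circle_lift p L"
  shows "wind p = L 1 - L 0"
proof -
  have "M 1 - M 0 = L 1 - L 0" if M: "circle_lift p M" for M
  proof -
    have Z: "M t - L t \<in> \<int>" if "t \<in> {0..1}" for t
      using L M that unfolding circle_lift_def by (subst cis_2pi_eq_iff[symmetric]) auto
    have "(\<lambda>t. M t - L t) constant_on {0..1}"
    proof (rule continuous_discrete_range_constant)
      fix x :: real assume x: "x \<in> {0..1}"
      have "1 \<le> norm (M y - L y - (M x - L x))"
        if "y \<in> {0..1}" "M y - L y \<noteq> M x - L x" for y
      proof -
        have "M y - L y - (M x - L x) \<in> \<int>" using Ints_diff[OF Z[OF that(1)] Z[OF x]] .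
        then show ?thesis using that(2) Ints_nonzero_abs_ge1 by fastforce
      qed
      then show "\<exists>e>0. \<forall>y. y \<in> {0..1} \<and> M y - L y \<noteq> M x - L x \<longrightarrow>
          e \<le> norm (M y - L y - (M x - L x))"
        by (intro exI[of _ 1]) auto
    qed (use L M in \<open>auto simp: circle_lift_def intro!: continuous_on_diff\<close>)
    then have "M 1 - L 1 = M 0 - L 0"
      by (auto simp: constant_on_def)
    then show ?thesis by linarith
  qed
  then show ?thesis
    unfolding wind_def using L by (intro some_equality) blast+
qed

text \<open>The imaginary part of a continuous logarithm is the angle.\<close>
lemma circle_valued_lift_convex:
  fixes q :: "'v::real_normed_vector \<Rightarrow> complex"
  assumes "continuous_on T q" "convex T" "\<And>x. x \<in> T \<Longrightarrow> norm (q x) = 1"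
  obtains L where "continuous_on T L" "\<And>x. x \<in> T \<Longrightarrow> q x = cis (2 * pi * L x)"
proof -
  obtain g where g: "continuous_on T g" "\<And>x. x \<in> T \<Longrightarrow> q x = exp (g x)"
    using continuous_logarithm_on_contractible[OF assms(1) convex_imp_contractible[OF assms(2)]]
      assms(3) by (metis norm_zero zero_neq_one)
  have "q x = cis (2 * pi * (Im (g x) / (2 * pi)))" if "x \<in> T" for x
  proof -
    have "exp (Re (g x)) = 1" using g(2)[OF that] assms(3)[OF that] by simp
    then have "g x = \<i> * Im (g x)" by (simp add: complex_eq_iff)
    then show ?thesis using g(2)[OF that] by (simp add: cis_conv_exp)
  qed
  moreover have "continuous_on T (\<lambda>x. Im (g x) / (2 * pi))"
    using g(1) by (intro continuous_intros) auto
  ultimately show ?thesis by (rule that[rotated])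
qed

text \<open>The edge from vertex \<open>0\<close> to vertex \<open>1\<close>, parametrised by the barycentric coordinate of vertex \<open>1\<close>.\<close>
definition simplex_edge :: "((nat \<Rightarrow> real) \<Rightarrow> 'a) \<Rightarrow> real \<Rightarrow> 'a" where
  "simplex_edge s t = s (\<lambda>i. if i = 0 then 1 - t else if i = 1 then t else 0)"

definition path_simplex :: "(real \<Rightarrow> 'a) \<Rightarrow> (nat \<Rightarrow> real) \<Rightarrow> 'a" where
  "path_simplex \<gamma> = restrict (\<lambda>x. \<gamma> (x 1)) (standard_simplex 1)"

definition point_simplex :: "'a \<Rightarrow> (nat \<Rightarrow> real) \<Rightarrow> 'a" where
  "point_simplex y = restrict (\<lambda>_. y) (standard_simplex 0)"

lemma singular_simplex_path_simplex:
  assumes "path \<gamma>" "path_image \<gamma> \<subseteq> Y"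
  shows "singular_simplex 1 (top_of_set Y) (path_simplex \<gamma>)"
proof -
  let ?S = "subtopology (powertop_real UNIV) (standard_simplex 1)"
  have "continuous_map ?S (top_of_set {0..1}) (\<lambda>x. x 1)"
    by (auto simp: continuous_map_in_subtopology standard_simplex_def
        intro!: continuous_map_from_subtopology continuous_map_product_projection)
  moreover have "continuous_map (top_of_set {0..1}) (top_of_set Y) \<gamma>"
    using assms by (auto simp: path_def path_image_def continuous_map_in_subtopology)
  ultimately have "continuous_map ?S (top_of_set Y) (\<gamma> \<circ> (\<lambda>x. x 1))"
    by (rule continuous_map_compose)
  then have "continuous_map ?S (top_of_set Y) (path_simplex \<gamma>)"
    by (rule continuous_map_eq) (auto simp: path_simplex_def)
  then show ?thesis
    by (simp add: singular_simplex_def path_simplex_def)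
qed

lemma simplex_edge_path_simplex:
  "t \<in> {0..1} \<Longrightarrow> simplex_edge (path_simplex \<gamma>) t = \<gamma> t"
proof -
  assume "t \<in> {0..1}"
  then have "(\<lambda>i. if i = 0 then 1 - t else if i = 1 then t else 0) \<in> standard_simplex (Suc 0)"
    by (auto simp: standard_simplex_def)
  then show ?thesis by (simp add: simplex_edge_def path_simplex_def)
qed

lemma boundary_path_simplex:
  "real_chain_boundary 1 (Poly_Mapping.single (path_simplex \<gamma>) 1) =
     Poly_Mapping.single (point_simplex (\<gamma> 1)) 1 - Poly_Mapping.single (point_simplex (\<gamma> 0)) 1"
proof -
  have x0: "x 0 = 1" if "x \<in> standard_simplex 0" for x
    using that by (simp add: standard_simplex_def)
  have sf: "simplical_face k x \<in> standard_simplex (Suc 0)" if "x \<in> standard_simplex 0" "k \<le> 1" for k x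
    using simplical_face_in_standard_simplex[of 1 k x] that by simp
  have "singular_face 1 0 (path_simplex \<gamma>) = point_simplex (\<gamma> 1)"
    using x0 sf by (fastforce simp: singular_face_def path_simplex_def point_simplex_def
        simplical_face_def restrict_def)
  moreover have "singular_face 1 1 (path_simplex \<gamma>) = point_simplex (\<gamma> 0)"
    using sf[of _ 1] by (auto simp: singular_face_def path_simplex_def point_simplex_def
        simplical_face_def restrict_def fun_eq_iff)
  ultimately show ?thesis
    by (simp add: real_chain_boundary_eq_linear_ext single_uminus)
qed

definition winding_cochain :: "('a \<Rightarrow> complex) \<Rightarrow> 'a real_chain \<Rightarrow> real" where
  "winding_cochain \<psi> = linear_ext (\<lambda>s. wind (\<psi> \<circ> simplex_edge s))"

lemma linear_winding_cochain: "linear (winding_cochain \<psi>)"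
  by (simp add: winding_cochain_def linear_linear_ext)

text \<open>
  All winding numbers are evaluated by this rule: on a set where the circle-valued map has a continuous
  angle \<open>l\<close>, only the end points of the path matter.
\<close>
lemma winding_cochain_path_simplex:
  assumes "path \<gamma>" "path_image \<gamma> \<subseteq> U" "continuous_on U l"
    and "\<And>y. y \<in> U \<Longrightarrow> \<psi> y = cis (2 * pi * l y)"
  shows "winding_cochain \<psi> (Poly_Mapping.single (path_simplex \<gamma>) 1) = l (\<gamma> 1) - l (\<gamma> 0)"
proof -
  have "circle_lift (\<psi> \<circ> simplex_edge (path_simplex \<gamma>)) (l \<circ> \<gamma>)"
    using assms continuous_on_compose[of "{0..1}" \<gamma> l] continuous_on_subset[OF assms(3)]
    unfolding circle_lift_def path_def path_image_def
    by (auto simp: simplex_edge_path_simplex image_subset_iff)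
  from wind_eq[OF this] show ?thesis by (simp add: winding_cochain_def)
qed

text \<open>
  A map from the triangle to the circle has a continuous angle, so the changes of angle along the
  three edges of a 2-simplex cancel.
\<close>
lemma winding_cochain_boundary:
  assumes cont: "continuous_on Y \<psi>" and norm: "\<And>y. y \<in> Y \<Longrightarrow> norm (\<psi> y) = 1"
    and c: "c \<in> real_boundaries 1 (top_of_set Y)"
  shows "winding_cochain \<psi> c = 0"
proof -
  have face: "(\<Sum>k\<le>2. (-1) ^ k * wind (\<psi> \<circ> simplex_edge (singular_face 2 k s))) = 0"
    if s: "singular_simplex 2 (top_of_set Y) s" for s
  proof -
    \<comment> \<open>\<open>\<tau>\<close> parametrises the standard 2-simplex by a triangle in the plane, where continuous logarithms
      are available.\<close>
    define \<tau> :: "real \<times> real \<Rightarrow> nat \<Rightarrow> real" where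
      "\<tau> = (\<lambda>(a, b) i. if i = 0 then 1 - a - b else if i = 1 then a else if i = 2 then b else 0)"
    define T :: "(real \<times> real) set" where "T = {(a, b). 0 \<le> a \<and> 0 \<le> b \<and> a + b \<le> 1}"
    have T: "convex T"
    proof -
      have "T = {x. (1, 0) \<bullet> x \<ge> 0} \<inter> {x. (0, 1) \<bullet> x \<ge> 0} \<inter> {x. (1, 1) \<bullet> x \<le> 1}"
        by (auto simp: T_def)
      then show ?thesis
        by (simp add: convex_Int convex_halfspace_ge convex_halfspace_le)
    qed
    have \<tau>: "\<tau> x \<in> standard_simplex 2" if "x \<in> T" for x
    proof -
      obtain a b where x: "x = (a, b)" "0 \<le> a" "0 \<le> b" "a + b \<le> 1"
        using \<open>x \<in> T\<close> by (auto simp: T_def)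
      have "(\<Sum>i\<le>2. \<tau> x i) = 1"
        by (simp add: x(1) \<tau>_def numeral_2_eq_2)
      moreover have "0 \<le> \<tau> x i \<and> \<tau> x i \<le> 1" for i
        using x by (simp add: \<tau>_def)
      ultimately show ?thesis by (simp add: standard_simplex_def x(1) \<tau>_def)
    qed
    have "continuous_map (top_of_set T) (subtopology (powertop_real UNIV) (standard_simplex 2)) \<tau>"
    proof -
      have "continuous_on T (\<lambda>x. \<tau> x i)" for i
        unfolding \<tau>_def case_prod_unfold
        by (cases "i = 0"; cases "i = 1"; cases "i = 2") (auto intro!: continuous_intros)
      then show ?thesis
        using \<tau> by (auto simp: continuous_map_in_subtopology continuous_map_componentwise_UNIV)
    qed
    moreover have "continuous_map (subtopology (powertop_real UNIV) (standard_simplex 2)) (top_of_set Y) s"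
      using s by (simp add: singular_simplex_def)
    ultimately have "continuous_map (top_of_set T) (top_of_set Y) (s \<circ> \<tau>)"
      by (rule continuous_map_compose)
    then have sT: "continuous_on T (s \<circ> \<tau>)" "(s \<circ> \<tau>) ` T \<subseteq> Y"
      by (auto simp: continuous_map_in_subtopology)
    then have "continuous_on T (\<psi> \<circ> (s \<circ> \<tau>))"
      using continuous_on_compose[OF _ continuous_on_subset[OF cont]] by blast
    then obtain L where L: "continuous_on T L" "\<And>x. x \<in> T \<Longrightarrow> \<psi> (s (\<tau> x)) = cis (2 * pi * L x)"
      using circle_valued_lift_convex[of T "\<psi> \<circ> (s \<circ> \<tau>)"] T norm sT(2) by (auto simp: image_subset_iff)
    have edge: "wind (\<psi> \<circ> simplex_edge (singular_face 2 k s)) = L (q 1) - L (q 0)"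
      if q: "continuous_on {0..1} q" "\<And>t. t \<in> {0..1} \<Longrightarrow> q t \<in> T"
        "\<And>t. t \<in> {0..1} \<Longrightarrow> \<tau> (q t) = simplical_face k (\<lambda>i. if i = 0 then 1 - t else if i = 1 then t else 0)"
      for k q
    proof -
      have "simplex_edge (singular_face 2 k s) t = s (\<tau> (q t))" if "t \<in> {0..1}" for t
      proof -
        have "(\<lambda>i. if i = 0 then 1 - t else if i = 1 then t else 0) \<in> standard_simplex (2 - Suc 0)"
          using that by (auto simp: standard_simplex_def)
        then show ?thesis using q(3)[OF that] by (simp add: simplex_edge_def singular_face_def)
      qed
      moreover have "continuous_on {0..1} (L \<circ> q)"
        using q(2) by (intro continuous_on_compose[OF q(1)] continuous_on_subset[OF L(1)]) auto
      ultimately have "circle_lift (\<psi> \<circ> simplex_edge (singular_face 2 k s)) (L \<circ> q)"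
        using L(2)[OF q(2)] by (simp add: circle_lift_def)
      from wind_eq[OF this] show ?thesis by simp
    qed
    have "wind (\<psi> \<circ> simplex_edge (singular_face 2 0 s)) = L (0, 1) - L (1, 0)"
      by (subst edge[of "\<lambda>t. (1 - t, t)"])
         (auto simp: T_def \<tau>_def simplical_face_def fun_eq_iff intro!: continuous_intros)
    moreover have "wind (\<psi> \<circ> simplex_edge (singular_face 2 1 s)) = L (0, 1) - L (0, 0)"
      by (subst edge[of "\<lambda>t. (0, t)"])
         (auto simp: T_def \<tau>_def simplical_face_def fun_eq_iff intro!: continuous_intros)
    moreover have "wind (\<psi> \<circ> simplex_edge (singular_face 2 2 s)) = L (1, 0) - L (0, 0)"
      by (subst edge[of "\<lambda>t. (t, 0)"])
         (auto simp: T_def \<tau>_def simplical_face_def fun_eq_iff intro!: continuous_intros)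
    moreover have "{..2::nat} = {0, 1, 2}" by auto
    ultimately show ?thesis by simp
  qed
  obtain d where d: "d \<in> real_chain_set 2 (top_of_set Y)" "c = real_chain_boundary 2 d"
    using c by (auto simp: real_boundaries_def numeral_2_eq_2)
  have "winding_cochain \<psi> c =
      (\<Sum>s\<in>Poly_Mapping.keys d. Poly_Mapping.lookup d s *
        (\<Sum>k\<le>2. (-1) ^ k * wind (\<psi> \<circ> simplex_edge (singular_face 2 k s))))"
    unfolding d(2) real_chain_boundary_eq_linear_ext[of 2, simplified] linear_ext_def
      linear_sum[OF linear_winding_cochain] linear_scale[OF linear_winding_cochain]
    by (simp add: winding_cochain_def)
  also have "\<dots> = 0"
    using d(1) face by (intro sum.neutral) (auto simp: real_chain_set_def)
  finally show ?thesis .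
qed

section \<open>Geodesic spaces\<close>

lemma geodesic_path:
  assumes "geodesic_space Y" "x \<in> Y" "y \<in> Y"
  obtains \<gamma> where "path \<gamma>" "path_image \<gamma> \<subseteq> Y" "\<gamma> 0 = x" "\<gamma> 1 = y"
    "\<And>t. t \<in> {0..1} \<Longrightarrow> dist x (\<gamma> t) + dist (\<gamma> t) y = dist x y"
proof -
  obtain \<gamma> where \<gamma>: "path \<gamma>" "path_image \<gamma> \<subseteq> Y" "\<gamma> 0 = x" "\<gamma> 1 = y"
    "curve_length \<gamma> = ereal (dist x y)"
    using assms unfolding geodesic_space_def pathstart_def pathfinish_def by blast
  have "dist x (\<gamma> t) + dist (\<gamma> t) y = dist x y" if "t \<in> {0..1}" for t
  proof -
    let ?ts = "[0, t, 1]"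
    have "ereal (\<Sum>i<length ?ts - 1. dist (\<gamma> (?ts ! i)) (\<gamma> (?ts ! Suc i))) \<le> curve_length \<gamma>"
      unfolding curve_length_def by (rule SUP_upper) (use that in auto)
    then have "dist x (\<gamma> t) + dist (\<gamma> t) y \<le> dist x y"
      using \<gamma> by (simp add: numeral_2_eq_2)
    then show ?thesis
      using dist_triangle[of x y "\<gamma> t"] by linarith
  qed
  with \<gamma> show ?thesis using that by blast
qed

lemma geodesic_midpoint:
  assumes "geodesic_space Y" "x \<in> Y" "y \<in> Y"
  obtains z where "z \<in> Y" "dist x z = dist x y / 2" "dist z y = dist x y / 2"
proof -
  obtain \<gamma> where \<gamma>: "path \<gamma>" "path_image \<gamma> \<subseteq> Y" "\<gamma> 0 = x" "\<gamma> 1 = y"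
    "\<And>t. t \<in> {0..1} \<Longrightarrow> dist x (\<gamma> t) + dist (\<gamma> t) y = dist x y"
    using geodesic_path[OF assms] by blast
  have "continuous_on {0..1} (\<lambda>t. dist x (\<gamma> t))"
    using \<gamma>(1) by (auto simp: path_def intro!: continuous_intros)
  moreover have "dist x (\<gamma> 0) \<le> dist x y / 2" "dist x y / 2 \<le> dist x (\<gamma> 1)"
    using \<gamma> by auto
  ultimately obtain t where t: "0 \<le> t" "t \<le> 1" "dist x (\<gamma> t) = dist x y / 2"
    using IVT'[of "\<lambda>t. dist x (\<gamma> t)" 0 "dist x y / 2" 1] by auto
  show ?thesis
  proof (rule that)
    show "\<gamma> t \<in> Y" using t \<gamma>(2) by (auto simp: path_image_def)
    show "dist x (\<gamma> t) = dist x y / 2" "dist (\<gamma> t) y = dist x y / 2"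
      using \<gamma>(5)[of t] t by auto
  qed
qed

lemma geodesic_path_in_cball:
  assumes "geodesic_space Y" "x \<in> Y" "y \<in> Y"
  obtains \<gamma> where "path \<gamma>" "path_image \<gamma> \<subseteq> Y \<inter> cball x (dist x y)" "\<gamma> 0 = x" "\<gamma> 1 = y"
proof -
  obtain \<gamma> where \<gamma>: "path \<gamma>" "path_image \<gamma> \<subseteq> Y" "\<gamma> 0 = x" "\<gamma> 1 = y"
    "\<And>t. t \<in> {0..1} \<Longrightarrow> dist x (\<gamma> t) + dist (\<gamma> t) y = dist x y"
    using geodesic_path[OF assms] by blast
  have "dist x (\<gamma> t) \<le> dist x y" if "t \<in> {0..1}" for t
    using \<gamma>(5)[OF that] zero_le_dist[of "\<gamma> t" y] by linarith
  then have "path_image \<gamma> \<subseteq> Y \<inter> cball x (dist x y)"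
    using \<gamma>(2) by (auto simp: path_image_def)
  then show ?thesis using \<gamma> that by blast
qed

lemma geodesic_locally_path_connected:
  assumes "geodesic_space Y"
  shows "locally path_connected Y"
  unfolding locally_path_connected
proof clarify
  fix V x assume V: "openin (top_of_set Y) V" "x \<in> V"
  then obtain e where e: "e > 0" "Y \<inter> ball x e \<subseteq> V" "x \<in> Y"
    unfolding openin_contains_ball by (metis Int_commute subsetD)
  have "path_component (Y \<inter> ball x e) x y" if "y \<in> Y \<inter> ball x e" for y
  proof -
    obtain \<gamma> where "path \<gamma>" "path_image \<gamma> \<subseteq> Y \<inter> cball x (dist x y)" "\<gamma> 0 = x" "\<gamma> 1 = y"
      using geodesic_path_in_cball[OF assms e(3), of y] \<open>y \<in> Y \<inter> ball x e\<close> by blast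
    moreover have "cball x (dist x y) \<subseteq> ball x e" using that by auto
    ultimately show ?thesis
      unfolding path_component_def pathstart_def pathfinish_def by blast
  qed
  then have "path_connected (Y \<inter> ball x e)"
    by (meson path_component_sym path_component_trans path_connected_component)
  then show "\<exists>U. openin (top_of_set Y) U \<and> path_connected U \<and> x \<in> U \<and> U \<subseteq> V"
    using e by (intro exI[of _ "Y \<inter> ball x e"]) (auto intro: openin_open_Int)
qed

lemma geodesic_openin_path_component:
  assumes "geodesic_space Y" "openin (top_of_set Y) S"
  shows "openin (top_of_set Y) (path_component_set S y)"
    and "closedin (top_of_set S) (path_component_set S y)"
proof -
  have *: "locally path_connected S"
    using geodesic_locally_path_connected[OF assms(1)] assms(2) by (rule locally_open_subset)
  show "openin (top_of_set Y) (path_component_set S y)"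
    using openin_path_component_locally_path_connected[OF *] assms(2) openin_trans by blast
  show "closedin (top_of_set S) (path_component_set S y)"
    by (rule closedin_path_component_locally_path_connected[OF *])
qed

section \<open>Fibre components depend semicontinuously on the point\<close>

lemma reeb_class_eq_iff:
  assumes "x \<in> X"
  shows "reeb_class X f y = reeb_class X f x \<longleftrightarrow> x \<in> reeb_class X f y"
proof
  assume "reeb_class X f y = reeb_class X f x"
  then show "x \<in> reeb_class X f y" using assms by (simp add: reeb_class_def)
next
  assume x: "x \<in> reeb_class X f y"
  then have "f x = f y" using connected_component_in unfolding reeb_class_def by fastforce
  with x show "reeb_class X f y = reeb_class X f x"
    unfolding reeb_class_def using connected_component_eq by fastforce
qed

lemma reeb_class_subset: "reeb_class X f x \<subseteq> {y \<in> X. f y = f x}"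
  unfolding reeb_class_def by (rule connected_component_subset)

lemma mem_reeb_class: "x \<in> X \<Longrightarrow> x \<in> reeb_class X f x"
  by (simp add: reeb_class_def)

text \<open>
  Points that can be joined inside \<open>X\<close> with smaller and smaller change of height lie, in the limit,
  in one component of a fibre. Otherwise a clopen subset of the compact fibre separates the limits,
  since components and quasi-components of a compact space agree; the connecting sets must cross the
  hypersurface of points equidistant from the two parts, and so must their limit in the fibre.
\<close>
lemma reeb_class_closed_limit:
  fixes f :: "'a::metric_space \<Rightarrow> real"
  assumes X: "compact X" and f: "continuous_on X f"
    and p: "p \<longlonglongrightarrow> p'" and q: "q \<longlonglongrightarrow> q'" and e: "e \<longlonglongrightarrow> 0"
    and K: "\<And>n. \<exists>K. connected K \<and> K \<subseteq> X \<and> p n \<in> K \<and> q n \<in> K \<and> (\<forall>z\<in>K. \<bar>f z - c\<bar> \<le> e n)"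
  shows "q' \<in> reeb_class X f p'"
proof -
  have mem: "p n \<in> X" "q n \<in> X" "\<bar>f (p n) - c\<bar> \<le> e n" "\<bar>f (q n) - c\<bar> \<le> e n" for n
    using K[of n] by auto
  have pq: "p' \<in> X" "q' \<in> X"
    using X p q mem by (auto intro: closed_sequentially compact_imp_closed)
  have level: "f z = c" if "z \<in> X" "z' \<longlonglongrightarrow> z" "\<And>n. z' n \<in> X" "\<And>n. \<bar>f (z' n) - c\<bar> \<le> e' n" "e' \<longlonglongrightarrow> 0"
    for z z' and e' :: "nat \<Rightarrow> real"
  proof -
    have "(\<lambda>n. f (z' n)) \<longlonglongrightarrow> f z"
      using f that by (auto simp: continuous_on_sequentially o_def)
    moreover have "(\<lambda>n. f (z' n)) \<longlonglongrightarrow> c"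
    proof (rule LIM_zero_cancel, rule Lim_null_comparison[OF _ that(5)])
      show "\<forall>\<^sub>F n in sequentially. norm (f (z' n) - c) \<le> e' n" using that(4) by simp
    qed
    ultimately show ?thesis by (rule LIMSEQ_unique)
  qed
  have fp: "f p' = c" "f q' = c" using level pq p q mem e by blast+
  define F where "F = {y \<in> X. f y = c}"
  have cF: "compact F"
  proof -
    have "closed (X \<inter> f -` {c})"
      using continuous_closed_preimage[OF f compact_imp_closed[OF X]] by blast
    then have "compact (X \<inter> (X \<inter> f -` {c}))" using X by (rule compact_Int_closed[rotated])
    moreover have "X \<inter> (X \<inter> f -` {c}) = F" by (auto simp: F_def)
    ultimately show ?thesis by simp
  qed
  have F: "p' \<in> F" "q' \<in> F" using pq fp by (auto simp: F_def)
  have "connected_component F p' q'"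
  proof (rule ccontr)
    assume "\<not> ?thesis"
    then have "\<not> connected_component_of (top_of_set F) p' q'"
      by (simp add: connected_component_of_def connected_component_def connectedin_subtopology)
    then have "\<not> quasi_component_of (top_of_set F) p' q'"
      using quasi_eq_connected_component_of[of "top_of_set F" p'] cF
      by (simp add: Hausdorff_space_subtopology compact_space_subtopology)
    then obtain A where A: "closedin (top_of_set F) A" "openin (top_of_set F) A" "\<not> (p' \<in> A \<longleftrightarrow> q' \<in> A)"
      using F unfolding quasi_component_of_def by auto
    define B where "B = F - A"
    have "closedin (top_of_set F) B" using A(2) unfolding B_def by (metis closedin_diff closedin_topspace topspace_euclidean_subtopology)
    then have cl: "closed A" "closed B" and ne: "A \<noteq> {}" "B \<noteq> {}" and AB: "A \<inter> B = {}" "A \<union> B = F"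
      using A F cF closedin_subset[OF A(1)]
      by (auto simp: B_def closedin_closed_eq compact_imp_closed dest: closedin_closed_trans)
    define h where "h z = infdist z A - infdist z B" for z
    have ch: "continuous_on UNIV h" unfolding h_def by (intro continuous_intros)
    have hA: "h z < 0" if "z \<in> A" for z
      using that cl ne AB infdist_nonneg[of z B] in_closed_iff_infdist_zero[of B z]
      by (auto simp: h_def less_le)
    have hB: "h z > 0" if "z \<in> B" for z
      using that cl ne AB infdist_nonneg[of z A] in_closed_iff_infdist_zero[of A z]
      by (auto simp: h_def less_le)
    have "h p' * h q' < 0"
      using A(3) F hA hB AB unfolding B_def by (auto intro: mult_neg_pos mult_pos_neg)
    moreover have "(\<lambda>n. h (p n) * h (q n)) \<longlonglongrightarrow> h p' * h q'"
      using p q ch by (intro tendsto_mult) (auto simp: continuous_on_eq_continuous_at intro: isCont_tendsto_compose)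
    ultimately have "\<forall>\<^sub>F n in sequentially. h (p n) * h (q n) < 0"
      by (simp add: order_tendstoD)
    then obtain N where N: "\<And>n. n \<ge> N \<Longrightarrow> h (p n) * h (q n) < 0"
      by (auto simp: eventually_sequentially)
    have "\<exists>z\<in>X. h z = 0 \<and> \<bar>f z - c\<bar> \<le> e (n + N)" for n
    proof -
      obtain K where K: "connected K" "K \<subseteq> X" "p (n + N) \<in> K" "q (n + N) \<in> K" "\<forall>z\<in>K. \<bar>f z - c\<bar> \<le> e (n + N)"
        using K by blast
      have "connected (h ` K)"
        using K(1) continuous_on_subset[OF ch] by (intro connected_continuous_image) auto
      then have "0 \<in> h ` K"
        using N[of "n + N"] K(3,4)
          connectedD_interval[of "h ` K" "h (p (n + N))" "h (q (n + N))" 0]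
          connectedD_interval[of "h ` K" "h (q (n + N))" "h (p (n + N))" 0]
        by (auto simp: mult_less_0_iff)
      then show ?thesis using K by auto
    qed
    then obtain z where z: "\<And>n. z n \<in> X" "\<And>n. h (z n) = 0" "\<And>n. \<bar>f (z n) - c\<bar> \<le> e (n + N)"
      by metis
    then obtain z' r where r: "z' \<in> X" "strict_mono r" "(z \<circ> r) \<longlonglongrightarrow> z'"
      using X unfolding compact_def by metis
    have "f z' = c"
    proof (rule level[OF r(1,3)])
      have "(\<lambda>n. e (n + N)) \<longlonglongrightarrow> 0" using e by (rule LIMSEQ_ignore_initial_segment)
      then show "((\<lambda>n. e (n + N)) \<circ> r) \<longlonglongrightarrow> 0" using r(2) by (rule LIMSEQ_subseq_LIMSEQ)
    qed (use z in auto)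
    then have "z' \<in> A \<union> B" using r(1) AB by (simp add: F_def)
    moreover have "h z' = 0"
    proof -
      have "(\<lambda>n. h ((z \<circ> r) n)) \<longlonglongrightarrow> h z'"
        by (rule isCont_tendsto_compose[OF _ r(3)]) (use ch in \<open>simp add: continuous_on_eq_continuous_at\<close>)
      then show ?thesis using z(2) by (simp add: LIMSEQ_const_iff)
    qed
    ultimately show False using hA hB by fastforce
  qed
  then show ?thesis by (simp add: reeb_class_def F_def fp)
qed

lemma openin_diff_closed: "closed S \<Longrightarrow> openin (top_of_set X) (X - S)"
  by (metis Diff_eq open_Compl openin_open_Int)

text \<open>
  A path in the quotient need not lift to a path in \<open>X\<close>. This lemma replaces lifting: points of nearby
  classes on the path are close to points of the given class.
\<close>
lemma reeb_class_upper_semicontinuous: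
  fixes f :: "'a::metric_space \<Rightarrow> real"
  assumes X: "compact X" and f: "continuous_on X f" and "open U"
  shows "openin (reeb_topology X f) {P \<in> reeb_graph X f. P \<subseteq> U}"
proof -
  let ?S = "{x \<in> X. \<not> reeb_class X f x \<subseteq> U}"
  have "closed ?S"
    unfolding closed_sequential_limits
  proof (intro allI impI, elim conjE)
    fix p p' assume p: "\<forall>n. p n \<in> ?S" "p \<longlonglongrightarrow> p'"
    then have "\<forall>n. \<exists>z. z \<in> reeb_class X f (p n) \<and> z \<notin> U" by blast
    then obtain q where q: "\<And>n. q n \<in> reeb_class X f (p n)" "\<And>n. q n \<notin> U"
      by metis
    have "q n \<in> X" for n using q(1)[of n] reeb_class_subset[of X f "p n"] by blast
    then obtain q' r where r: "q' \<in> X" "strict_mono r" "(q \<circ> r) \<longlonglongrightarrow> q'"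
      using X unfolding compact_def by metis
    have p': "p' \<in> X"
      using p closed_sequentially[OF compact_imp_closed[OF X], of p p'] by blast
    have "(\<lambda>n. f (p n)) \<longlonglongrightarrow> f p'"
      using f p p' by (auto simp: continuous_on_sequentially o_def)
    then have "(\<lambda>n. \<bar>f (p n) - f p'\<bar>) \<longlonglongrightarrow> 0"
      by (intro tendsto_rabs_zero LIM_zero)
    then have e: "(\<lambda>n. \<bar>f (p (r n)) - f p'\<bar>) \<longlonglongrightarrow> 0"
      using LIMSEQ_subseq_LIMSEQ[OF _ r(2)] by (fastforce simp: o_def)
    have pr: "(p \<circ> r) \<longlonglongrightarrow> p'"
      using p(2) r(2) by (rule LIMSEQ_subseq_LIMSEQ)
    have "q' \<in> reeb_class X f p'"
    proof (rule reeb_class_closed_limit[OF X f pr r(3) e])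
      fix n
      have "connected (reeb_class X f (p (r n)))" unfolding reeb_class_def by simp
      moreover have "p (r n) \<in> reeb_class X f (p (r n))" using p by (auto intro: mem_reeb_class)
      ultimately show "\<exists>K. connected K \<and> K \<subseteq> X \<and> (p \<circ> r) n \<in> K \<and> (q \<circ> r) n \<in> K \<and>
          (\<forall>z\<in>K. \<bar>f z - f p'\<bar> \<le> \<bar>f (p (r n)) - f p'\<bar>)"
        using reeb_class_subset[of X f "p (r n)"] q(1)
        by (intro exI[of _ "reeb_class X f (p (r n))"]) auto
    qed
    moreover have "q' \<notin> U"
      using q(2) r(3) \<open>open U\<close> closed_sequentially[of "- U" "q \<circ> r" q'] by (auto simp: closed_Compl)
    ultimately show "p' \<in> ?S" using p' by blast
  qed
  moreover have "{x \<in> X. reeb_class X f x \<in> {P \<in> reeb_graph X f. P \<subseteq> U}} = X - ?S"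
    by (auto simp: reeb_graph_def)
  ultimately show ?thesis
    by (auto simp: openin_reeb_topology openin_diff_closed)
qed

section \<open>Limits of approximate paths\<close>

text \<open>
  Tychonoff's theorem: on every finite set of arguments, some of the functions \<open>W n\<close> are close to \<open>w\<close>.
  It stands in for a diagonal argument and works for uncountably many arguments at once.
\<close>
lemma compact_pointwise_cluster:
  fixes W :: "nat \<Rightarrow> 'i \<Rightarrow> 'c::metric_space"
  assumes "compact Y" "\<And>n t. W n t \<in> Y"
  obtains w where "\<And>t. w t \<in> Y"
    "\<And>T e n0. finite T \<Longrightarrow> e > 0 \<Longrightarrow> \<exists>n\<ge>n0. \<forall>t\<in>T. dist (W n t) (w t) < e"
proof -
  let ?P = "PiE UNIV (\<lambda>_. Y) :: ('i \<Rightarrow> 'c) set"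
  have "compactin (product_topology (\<lambda>_. euclidean) UNIV) ?P"
    using assms(1) by (simp add: compactin_PiE)
  then have "compact ?P" by (simp add: euclidean_product_topology)
  moreover have "filtermap W sequentially \<noteq> bot" "\<forall>\<^sub>F h in filtermap W sequentially. h \<in> ?P"
    using assms(2) by (simp_all add: filtermap_bot_iff eventually_filtermap PiE_UNIV_domain)
  ultimately obtain w where w: "w \<in> ?P" "inf (nhds w) (filtermap W sequentially) \<noteq> bot"
    unfolding compact_filter by blast
  show ?thesis
  proof (rule that)
    show "w t \<in> Y" for t using w(1) by auto
    fix T :: "'i set" and e :: real and n0 :: nat
    assume T: "finite T" "e > 0"
    have "open (\<Inter>t\<in>T. {h :: 'i \<Rightarrow> 'c. dist (h t) (w t) < e})"
      using T(1) by (intro open_INT ballI open_Collect_less continuous_intros) auto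
    then have "\<forall>\<^sub>F h in nhds w. \<forall>t\<in>T. dist (h t) (w t) < e"
      using T(2) by (fastforce simp: eventually_nhds)
    show "\<exists>n\<ge>n0. \<forall>t\<in>T. dist (W n t) (w t) < e"
    proof (rule ccontr)
      assume no: "\<not> ?thesis"
      have "\<forall>\<^sub>F h in filtermap W sequentially. \<not> (\<forall>t\<in>T. dist (h t) (w t) < e)"
        unfolding eventually_filtermap eventually_sequentially using no by blast
      with \<open>\<forall>\<^sub>F h in nhds w. \<forall>t\<in>T. dist (h t) (w t) < e\<close>
      have "\<forall>\<^sub>F h in inf (nhds w) (filtermap W sequentially). False"
        unfolding eventually_inf by (intro exI conjI) (assumption | blast)+
      with w(2) show False by (simp add: trivial_limit_def)
    qed
  qed
qed

lemma curve_length_le_lipschitz: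
  assumes "\<And>s t. 0 \<le> s \<Longrightarrow> s \<le> t \<Longrightarrow> t \<le> 1 \<Longrightarrow> dist (\<gamma> s) (\<gamma> t) \<le> L * (t - s)" and "0 \<le> L"
  shows "curve_length \<gamma> \<le> ereal L"
  unfolding curve_length_def
proof (rule SUP_least)
  fix ts :: "real list" assume ts: "ts \<in> {ts. sorted ts \<and> set ts \<subseteq> {0..1}}"
  have mem: "ts ! i \<in> {0..1}" if "i < length ts" for i using ts nth_mem[OF that] by blast
  have "(\<Sum>i<length ts - 1. dist (\<gamma> (ts ! i)) (\<gamma> (ts ! Suc i))) \<le>
      (\<Sum>i<length ts - 1. L * (ts ! Suc i - ts ! i))"
  proof (rule sum_mono)
    fix i assume "i \<in> {..<length ts - 1}"
    then have i: "Suc i < length ts" by auto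
    then have "ts ! i \<le> ts ! Suc i" using ts by (auto intro: sorted_nth_mono)
    then show "dist (\<gamma> (ts ! i)) (\<gamma> (ts ! Suc i)) \<le> L * (ts ! Suc i - ts ! i)"
      using assms(1) mem[of i] mem[of "Suc i"] i by auto
  qed
  also have "\<dots> = L * (\<Sum>i<length ts - 1. ts ! Suc i - ts ! i)"
    by (simp add: sum_distrib_left)
  also have "(\<Sum>i<length ts - 1. ts ! Suc i - ts ! i) = ts ! (length ts - 1) - ts ! 0"
    by (rule sum_lessThan_telescope)
  also have "L * (ts ! (length ts - 1) - ts ! 0) \<le> L * 1"
  proof (rule mult_left_mono[OF _ \<open>0 \<le> L\<close>])
    show "ts ! (length ts - 1) - ts ! 0 \<le> 1"
      using mem[of 0] mem[of "length ts - 1"] by (cases "ts = []") auto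
  qed
  finally show "ereal (\<Sum>i<length ts - 1. dist (\<gamma> (ts ! i)) (\<gamma> (ts ! Suc i))) \<le> ereal L" by simp
qed

text \<open>
  The functions \<open>w\<close> may be discontinuous; consecutive values only have to be joined by connected sets
  with small height variation. A pointwise cluster point \<open>v\<close> of such functions is in general
  discontinuous in \<open>Y\<close> as well, but its classes form a continuous path in the Reeb graph by
  \<open>reeb_class_closed_limit\<close>, and its height is \<open>L\<close>-Lipschitz.
\<close>
lemma reeb_dist_le_of_approximate_paths:
  assumes Y: "compact Y" "geodesic_space Y" and g: "1-lipschitz_on Y g"
    and y: "y \<in> Y" "y' \<in> Y" and "0 \<le> L"
    and approx: "\<And>e. e > 0 \<Longrightarrow> \<exists>w. w 0 = y \<and> w 1 = y' \<and>
      (\<forall>s t. 0 \<le> s \<and> s \<le> t \<and> t \<le> 1 \<longrightarrow> (\<exists>K. connected K \<and> K \<subseteq> Y \<and> w s \<in> K \<and> w t \<in> K \<and>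
         (\<forall>p\<in>K. \<forall>q\<in>K. \<bar>g p - g q\<bar> \<le> L * (t - s) + e)))"
  shows "reeb_dist Y g (reeb_class Y g y) (reeb_class Y g y') \<le> L"
proof -
  have cg: "continuous_on Y g" using g by (rule lipschitz_on_continuous_on)
  define e where "e n = inverse (real (Suc n))" for n
  have "\<exists>w. \<forall>n. w n 0 = y \<and> w n 1 = y' \<and>
      (\<forall>s t. 0 \<le> s \<and> s \<le> t \<and> t \<le> 1 \<longrightarrow> (\<exists>K. connected K \<and> K \<subseteq> Y \<and> w n s \<in> K \<and> w n t \<in> K \<and>
         (\<forall>p\<in>K. \<forall>q\<in>K. \<bar>g p - g q\<bar> \<le> L * (t - s) + e n)))"
    using approx by (intro choice allI) (simp add: e_def)
  then obtain w where w0: "\<And>n. w n 0 = y" and w1: "\<And>n. w n 1 = y'" and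
      w: "\<And>n s t. 0 \<le> s \<Longrightarrow> s \<le> t \<Longrightarrow> t \<le> 1 \<Longrightarrow> \<exists>K. connected K \<and> K \<subseteq> Y \<and> w n s \<in> K \<and> w n t \<in> K \<and>
         (\<forall>p\<in>K. \<forall>q\<in>K. \<bar>g p - g q\<bar> \<le> L * (t - s) + e n)"
    by blast
  have wY: "w n t \<in> Y" if "0 \<le> t" "t \<le> 1" for n t using w[of t t n] that by auto
  define W where "W n t = (if 0 \<le> t \<and> t \<le> 1 then w n t else y)" for n t
  have "W n t \<in> Y" for n t using wY y by (simp add: W_def)
  then obtain v where vY: "\<And>t. v t \<in> Y" and v:
    "\<And>T \<epsilon> n0. finite T \<Longrightarrow> \<epsilon> > 0 \<Longrightarrow> \<exists>n\<ge>n0. \<forall>t\<in>T. dist (W n t) (v t) < \<epsilon>"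
    using compact_pointwise_cluster[OF Y(1), of W] by metis
  have "dist y (v 0) < \<epsilon>" "dist y' (v 1) < \<epsilon>" if "\<epsilon> > 0" for \<epsilon>
    using v[of "{0, 1}" \<epsilon> 0] that by (auto simp: W_def w0 w1)
  then have v01: "v 0 = y" "v 1 = y'"
    by (metis dist_pos_lt less_irrefl)+
  have lip: "\<bar>g p - g q\<bar> \<le> dist p q" if "p \<in> Y" "q \<in> Y" for p q
    using lipschitz_onD[OF g that] by (simp add: dist_real_def)
  have conn: "\<exists>K. connected K \<and> K \<subseteq> Y \<and> v s \<in> K \<and> v t \<in> K \<and>
         (\<forall>p\<in>K. \<bar>g p - g (v s)\<bar> \<le> L * (t - s) + \<epsilon>) \<and> (\<forall>p\<in>K. \<bar>g p - g (v t)\<bar> \<le> L * (t - s) + \<epsilon>)"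
    if st: "0 \<le> s" "s \<le> t" "t \<le> 1" and "\<epsilon> > 0" for s t \<epsilon>
  proof -
    have "\<epsilon> / 4 > 0" using \<open>\<epsilon> > 0\<close> by simp
    then obtain n0 where "inverse (real (Suc n0)) < \<epsilon> / 4"
      using reals_Archimedean by blast
    moreover obtain n where n: "n \<ge> n0" "\<forall>r\<in>{s, t}. dist (W n r) (v r) < \<epsilon> / 4"
      using v[of "{s, t}" "\<epsilon> / 4" n0] \<open>\<epsilon> > 0\<close> by auto
    ultimately have e: "e n < \<epsilon> / 4"
      unfolding e_def by (smt (verit) inverse_le_iff_le of_nat_0_less_iff of_nat_le_iff Suc_le_mono zero_less_Suc)
    have d: "dist (v s) (w n s) < \<epsilon> / 4" "dist (v t) (w n t) < \<epsilon> / 4"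
      using n(2) st by (auto simp: W_def dist_commute)
    \<comment> \<open>The connecting set for \<open>w n\<close> is extended by short geodesics to the limit points.\<close>
    obtain K where K: "connected K" "K \<subseteq> Y" "w n s \<in> K" "w n t \<in> K"
        "\<forall>p\<in>K. \<forall>q\<in>K. \<bar>g p - g q\<bar> \<le> L * (t - s) + e n"
      using w[OF st, of n] by blast
    obtain a where a: "path a" "path_image a \<subseteq> Y \<inter> cball (v s) (dist (v s) (w n s))" "a 0 = v s" "a 1 = w n s"
      using geodesic_path_in_cball[OF Y(2) vY, of "w n s" s] K by blast
    obtain b where b: "path b" "path_image b \<subseteq> Y \<inter> cball (v t) (dist (v t) (w n t))" "b 0 = v t" "b 1 = w n t"
      using geodesic_path_in_cball[OF Y(2) vY, of "w n t" t] K by blast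
    have ab: "v s \<in> path_image a" "w n s \<in> path_image a" "v t \<in> path_image b" "w n t \<in> path_image b"
      using a(3,4) b(3,4) by (metis pathstart_def pathfinish_def pathstart_in_path_image pathfinish_in_path_image)+
    have ga: "\<bar>g p - g (w n s)\<bar> < \<epsilon> / 2" if "p \<in> path_image a" for p
    proof -
      have p: "p \<in> Y" "dist (v s) p \<le> dist (v s) (w n s)" using a(2) that by auto
      then have "\<bar>g p - g (v s)\<bar> < \<epsilon> / 4" "\<bar>g (v s) - g (w n s)\<bar> < \<epsilon> / 4"
        using lip[of p "v s"] lip[of "v s" "w n s"] vY d K by (auto simp: dist_commute)
      then show ?thesis by linarith
    qed
    have gb: "\<bar>g p - g (w n t)\<bar> < \<epsilon> / 2" if "p \<in> path_image b" for p
    proof -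
      have p: "p \<in> Y" "dist (v t) p \<le> dist (v t) (w n t)" using b(2) that by auto
      then have "\<bar>g p - g (v t)\<bar> < \<epsilon> / 4" "\<bar>g (v t) - g (w n t)\<bar> < \<epsilon> / 4"
        using lip[of p "v t"] lip[of "v t" "w n t"] vY d K by (auto simp: dist_commute)
      then show ?thesis by linarith
    qed
    have vs: "\<bar>g (v s) - g (w n s)\<bar> < \<epsilon> / 4" "\<bar>g (v t) - g (w n t)\<bar> < \<epsilon> / 4"
      using lip[of "v s" "w n s"] lip[of "v t" "w n t"] vY d K by auto
    have K2: "\<bar>g p - g (w n s)\<bar> \<le> L * (t - s) + \<epsilon> / 4" "\<bar>g p - g (w n t)\<bar> \<le> L * (t - s) + \<epsilon> / 4" if "p \<in> K" for p
      using K(5)[rule_format, OF that K(3)] K(5)[rule_format, OF that K(4)] e by linarith+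
    have "0 \<le> L * (t - s)" using \<open>0 \<le> L\<close> st by simp
    have "connected (path_image a \<union> K)"
      using connected_Un[OF connected_path_image[OF a(1)] K(1)] ab K by blast
    then have "connected (path_image a \<union> K \<union> path_image b)"
      using connected_Un[OF _ connected_path_image[OF b(1)]] ab K by blast
    moreover have "\<bar>g p - g (v s)\<bar> \<le> L * (t - s) + \<epsilon> \<and> \<bar>g p - g (v t)\<bar> \<le> L * (t - s) + \<epsilon>"
      if "p \<in> path_image a \<union> K \<union> path_image b" for p
    proof -
      consider "p \<in> path_image a" | "p \<in> K" | "p \<in> path_image b"
        using \<open>p \<in> path_image a \<union> K \<union> path_image b\<close> by blast
      then show ?thesis
      proof cases
        case 1
        have "\<bar>g p - g (v s)\<bar> \<le> L * (t - s) + \<epsilon>"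
          using ga[OF 1] vs(1) \<open>0 \<le> L * (t - s)\<close> by linarith
        moreover have "\<bar>g p - g (v t)\<bar> \<le> L * (t - s) + \<epsilon>"
          using ga[OF 1] vs(2) K2(2)[OF K(3)] by linarith
        ultimately show ?thesis ..
      next
        case 2
        have "\<bar>g p - g (v s)\<bar> \<le> L * (t - s) + \<epsilon>"
          using K2(1)[OF 2] vs(1) by linarith
        moreover have "\<bar>g p - g (v t)\<bar> \<le> L * (t - s) + \<epsilon>"
          using K2(2)[OF 2] vs(2) by linarith
        ultimately show ?thesis ..
      next
        case 3
        have "\<bar>g p - g (v s)\<bar> \<le> L * (t - s) + \<epsilon>"
          using gb[OF 3] vs(1) K2(1)[OF K(4)] by linarith
        moreover have "\<bar>g p - g (v t)\<bar> \<le> L * (t - s) + \<epsilon>"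
          using gb[OF 3] vs(2) \<open>0 \<le> L * (t - s)\<close> by linarith
        ultimately show ?thesis ..
      qed
    qed
    ultimately show ?thesis
      using ab K(2) a(2) b(2) by (intro exI[of _ "path_image a \<union> K \<union> path_image b"]) auto
  qed
  define \<beta> where "\<beta> = reeb_class Y g \<circ> v"
  have path: "pathin (reeb_topology Y g) \<beta>"
    unfolding pathin_def continuous_map_def
  proof (intro conjI allI impI)
    show "\<beta> \<in> topspace (top_of_set {0..1}) \<rightarrow> topspace (reeb_topology Y g)"
      using vY by (auto simp: \<beta>_def reeb_graph_def)
    fix U assume U: "openin (reeb_topology Y g) U"
    define A where "A = {x \<in> Y. reeb_class Y g x \<in> U}"
    have "openin (top_of_set Y) A" using U by (simp add: A_def openin_reeb_topology)
    then obtain T where T: "open T" "A = Y \<inter> T" unfolding openin_open by blast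
    then have "Y - A = Y \<inter> - T" by blast
    then have cA: "compact (Y - A)"
      using Y(1) T(1) by (simp add: compact_Int_closed closed_Compl)
    have "closed {t \<in> {0..1}. v t \<in> Y - A}"
      unfolding closed_sequential_limits
    proof (intro allI impI, elim conjE)
      fix x l assume x: "\<forall>n. x n \<in> {t \<in> {0..1}. v t \<in> Y - A}" "x \<longlonglongrightarrow> l"
      have l: "l \<in> {0..1}"
        using x closed_sequentially[of "{0..1}" x l] by auto
      obtain p r where r: "p \<in> Y - A" "strict_mono r" "((v \<circ> x) \<circ> r) \<longlonglongrightarrow> p"
        using cA x(1) unfolding compact_def by (metis (mono_tags, lifting) comp_apply mem_Collect_eq)
      have xr: "(x \<circ> r) \<longlonglongrightarrow> l" using x(2) r(2) by (rule LIMSEQ_subseq_LIMSEQ)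
      define \<epsilon> where "\<epsilon> n = L * \<bar>x (r n) - l\<bar> + inverse (real (Suc n))" for n
      have "\<epsilon> \<longlonglongrightarrow> L * 0 + 0"
        unfolding \<epsilon>_def using xr
        by (intro tendsto_add tendsto_mult tendsto_const LIMSEQ_inverse_real_of_nat tendsto_rabs_zero LIM_zero)
           (simp add: o_def)
      then have \<epsilon>: "\<epsilon> \<longlonglongrightarrow> 0" by simp
      have "p \<in> reeb_class Y g (v l)"
      proof (rule reeb_class_closed_limit[OF Y(1) cg tendsto_const r(3) \<epsilon>])
        fix n
        have "x (r n) \<in> {0..1}" using x(1) by auto
        then show "\<exists>K. connected K \<and> K \<subseteq> Y \<and> v l \<in> K \<and> ((v \<circ> x) \<circ> r) n \<in> K \<and>
            (\<forall>z\<in>K. \<bar>g z - g (v l)\<bar> \<le> \<epsilon> n)"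
          using conn[of l "x (r n)" "inverse (real (Suc n))"] conn[of "x (r n)" l "inverse (real (Suc n))"] l
          by (cases "l \<le> x (r n)") (auto simp: \<epsilon>_def)
      qed
      then have "reeb_class Y g (v l) = reeb_class Y g p"
        using r(1) by (subst reeb_class_eq_iff) auto
      then show "l \<in> {t \<in> {0..1}. v t \<in> Y - A}"
        using r(1) l vY by (auto simp: A_def)
    qed
    moreover have "{x \<in> topspace (top_of_set {0..1}). \<beta> x \<in> U} = {0..1} - {t \<in> {0..1}. v t \<in> Y - A}"
      using vY by (auto simp: \<beta>_def A_def)
    ultimately show "openin (top_of_set {0..1}) {x \<in> topspace (top_of_set {0..1}). \<beta> x \<in> U}"
      by (simp add: openin_diff_closed)
  qed
  have "curve_length (reeb_fun g \<circ> \<beta>) \<le> ereal L"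
  proof (rule curve_length_le_lipschitz[OF _ \<open>0 \<le> L\<close>])
    fix s t :: real assume st: "0 \<le> s" "s \<le> t" "t \<le> 1"
    have "\<bar>g (v t) - g (v s)\<bar> \<le> L * (t - s) + \<epsilon>" if "\<epsilon> > 0" for \<epsilon>
      using conn[OF st that] by blast
    then have "\<bar>g (v t) - g (v s)\<bar> \<le> L * (t - s)" by (rule field_le_epsilon)
    then show "dist ((reeb_fun g \<circ> \<beta>) s) ((reeb_fun g \<circ> \<beta>) t) \<le> L * (t - s)"
      using vY by (simp add: \<beta>_def reeb_fun_reeb_class dist_real_def abs_minus_commute)
  qed
  then have "ereal (reeb_dist Y g (reeb_class Y g y) (reeb_class Y g y')) \<le> ereal L"
    using path v01 y
    by (subst reeb_dist_finite[OF Y(2) g]) (auto simp: reeb_graph_def \<beta>_def intro!: INF_lower2[of \<beta>])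
  then show ?thesis by simp
qed

section \<open>Simple walks have few turns\<close>

lemma continuous_on_locally_eq:
  assumes "\<And>y. y \<in> A \<Longrightarrow> \<exists>T h. open T \<and> y \<in> T \<and> continuous_on (A \<inter> T) h \<and> (\<forall>z\<in>A \<inter> T. f z = h z)"
  shows "continuous_on A f"
  unfolding continuous_on_def
proof
  fix y assume y: "y \<in> A"
  then obtain T h where T: "open T" "y \<in> T" "continuous_on (A \<inter> T) h" "\<forall>z\<in>A \<inter> T. f z = h z"
    using assms[OF y] by blast
  then have "continuous_on (A \<inter> T) f" by (metis continuous_on_cong)
  then have "(f \<longlongrightarrow> f y) (at y within A \<inter> T)" using y T(2) by (auto simp: continuous_on_def)
  moreover have "at y within A \<inter> T = at y within A"
    by (rule at_within_nhd[OF T(2,1)]) auto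
  ultimately show "(f \<longlongrightarrow> f y) (at y within A)" by simp
qed

text \<open>
  A function of the height, restricted to a relatively clopen part \<open>C\<close> of \<open>S\<close> and extended by zero,
  stays continuous if it vanishes near the heights of points outside \<open>S\<close>.
\<close>
lemma continuous_on_restrict_clopen:
  fixes F :: "real \<Rightarrow> 'c::real_normed_vector"
  assumes C: "openin (top_of_set Y) C" "openin (top_of_set Y) (S - C)" "C \<subseteq> S"
    and g: "continuous_on Y g" and F: "continuous_on UNIV F" and A: "A \<subseteq> Y"
    and van: "\<And>y. y \<in> A - S \<Longrightarrow> \<exists>V. open V \<and> g y \<in> V \<and> (\<forall>x\<in>V. F x = 0)"
  shows "continuous_on A (\<lambda>y. if y \<in> C then F (g y) else 0)"
proof (rule continuous_on_locally_eq)
  fix y assume y: "y \<in> A"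
  consider "y \<in> C" | "y \<in> S - C" | "y \<in> A - S" using y by blast
  then show "\<exists>T h. open T \<and> y \<in> T \<and> continuous_on (A \<inter> T) h \<and>
      (\<forall>z\<in>A \<inter> T. (if z \<in> C then F (g z) else 0) = h z)"
  proof cases
    case 1
    obtain T where T: "open T" "C = Y \<inter> T" using C(1) unfolding openin_open by blast
    have "continuous_on (A \<inter> T) (\<lambda>z. F (g z))"
      using A by (intro continuous_on_compose2[OF F continuous_on_subset[OF g]]) auto
    then show ?thesis using 1 T A by (intro exI[of _ T] exI[of _ "\<lambda>z. F (g z)"]) auto
  next
    case 2
    obtain T where T: "open T" "S - C = Y \<inter> T" using C(2) unfolding openin_open by blast
    show ?thesis using 2 T A by (intro exI[of _ T] exI[of _ "\<lambda>z. 0"]) auto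
  next
    case 3
    obtain V where V: "open V" "g y \<in> V" "\<forall>x\<in>V. F x = 0" using van[OF 3] by blast
    obtain T where T: "open T" "T \<inter> Y = g -` V \<inter> Y"
      using g V(1) unfolding continuous_on_open_invariant by blast
    show ?thesis using 3 T V A by (intro exI[of _ T] exI[of _ "\<lambda>z. 0"]) auto
  qed
qed

text \<open>A path, regarded as a 1-chain on which every winding cochain with an angle on \<open>S\<close> is known.\<close>
lemma path_component_chain:
  assumes "path_component S a b" "S \<subseteq> Y"
  obtains c where "c \<in> real_chain_set 1 (top_of_set Y)"
    "real_chain_boundary 1 c =
       Poly_Mapping.single (point_simplex b) 1 - Poly_Mapping.single (point_simplex a) 1"
    "\<And>\<psi> l. continuous_on S l \<Longrightarrow> (\<And>y. y \<in> S \<Longrightarrow> \<psi> y = cis (2 * pi * l y)) \<Longrightarrow>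
       winding_cochain \<psi> c = l b - l a"
proof -
  obtain \<gamma> where \<gamma>: "path \<gamma>" "path_image \<gamma> \<subseteq> S" "\<gamma> 0 = a" "\<gamma> 1 = b"
    using assms(1) unfolding path_component_def pathstart_def pathfinish_def by blast
  show ?thesis
  proof (rule that[of "Poly_Mapping.single (path_simplex \<gamma>) 1"])
    have "singular_simplex 1 (top_of_set Y) (path_simplex \<gamma>)"
      using \<gamma> assms(2) by (intro singular_simplex_path_simplex) auto
    then show "Poly_Mapping.single (path_simplex \<gamma>) 1 \<in> real_chain_set 1 (top_of_set Y)"
      by (simp add: real_chain_set_def)
  qed (use \<gamma> boundary_path_simplex[of \<gamma>] winding_cochain_path_simplex[OF \<gamma>(1,2)] in auto)
qed

lemma exists_uniform_gap:
  fixes A :: "real set"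
  assumes "finite A" "\<delta> > 0"
  obtains \<eta> where "\<eta> > 0" "\<eta> < \<delta>" "\<And>a. a \<in> A \<Longrightarrow> a > 0 \<Longrightarrow> \<eta> \<le> a"
proof
  let ?B = "insert (\<delta> / 2) {a \<in> A. a > 0}"
  have "finite ?B" using assms by simp
  then show "Min ?B > 0" "Min ?B < \<delta>" "\<And>a. a \<in> A \<Longrightarrow> a > 0 \<Longrightarrow> Min ?B \<le> a"
    using assms by (auto simp: Min_less_iff intro!: Min_le)
qed

locale height_space =
  fixes Y :: "'b::metric_space set" and g :: "'b \<Rightarrow> real"
  assumes compact: "compact Y" and geodesic: "geodesic_space Y" and lipschitz: "1-lipschitz_on Y g"
begin

lemma continuous: "continuous_on Y g"
  using lipschitz by (rule lipschitz_on_continuous_on)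

lemma height_diff_le: "p \<in> Y \<Longrightarrow> q \<in> Y \<Longrightarrow> \<bar>g p - g q\<bar> \<le> dist p q"
  using lipschitz_onD[OF lipschitz] by (simp add: dist_real_def)

lemma openin_height: "open V \<Longrightarrow> openin (top_of_set Y) {y \<in> Y. g y \<in> V}"
  using continuous_openin_preimage_gen[OF continuous, of V] by (simp add: vimage_def Int_def)

text \<open>
  A component of an open sublevel set contains a local minimum: its part below the height of \<open>w\<close> is
  compact, and a minimum there is a minimum on the whole component, which is open in \<open>Y\<close>.
\<close>
lemma local_minimum_below:
  assumes "w \<in> Y" "g w < c"
  obtains \<mu> where "\<mu> \<in> local_minima Y g" "path_component {y \<in> Y. g y < c} w \<mu>" "g \<mu> \<le> g w"
proof -
  let ?O = "{y \<in> Y. g y < c}"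
  let ?K = "path_component_set ?O w"
  have O: "openin (top_of_set Y) ?O" using openin_height[of "{..<c}"] by simp
  obtain Z where Z: "closed Z" "?K = ?O \<inter> Z"
    using geodesic_openin_path_component(2)[OF geodesic O, of w] unfolding closedin_closed by blast
  define K' where "K' = {y \<in> ?K. g y \<le> g w}"
  have "K' = {y \<in> ?O \<inter> Z. g y \<le> g w}" unfolding K'_def Z(2) ..
  also have "\<dots> = (Y \<inter> g -` {..g w}) \<inter> Z" using assms(2) by auto
  finally have "K' = (Y \<inter> g -` {..g w}) \<inter> Z" .
  moreover have "closed (Y \<inter> g -` {..g w})"
    using continuous_closed_preimage[OF continuous compact_imp_closed[OF compact]] by blast
  ultimately have "compact (Y \<inter> K')" "K' \<subseteq> Y"
    using compact Z(1) by (auto intro!: compact_Int_closed closed_Int)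
  then have "compact K'" by (simp add: Int_absorb1)
  moreover have w: "w \<in> K'" using assms by (simp add: K'_def path_component_refl)
  ultimately obtain \<mu> where \<mu>: "\<mu> \<in> K'" "\<And>y. y \<in> K' \<Longrightarrow> g \<mu> \<le> g y"
    using continuous_attains_inf[of K' g] continuous_on_subset[OF continuous \<open>K' \<subseteq> Y\<close>] by blast
  have least: "g \<mu> \<le> g y" if "y \<in> ?K" for y
    using \<mu>(2)[of y] \<mu>(2)[OF w] that by (cases "g y \<le> g w") (auto simp: K'_def)
  obtain T where T: "open T" "?K = Y \<inter> T"
    using geodesic_openin_path_component(1)[OF geodesic O, of w] unfolding openin_open by blast
  have \<mu>K: "\<mu> \<in> ?K" using \<mu>(1) by (simp add: K'_def)
  then have "\<forall>\<^sub>F y in at \<mu> within Y. g \<mu> \<le> g y"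
    using T least by (auto simp: eventually_at_topological intro!: exI[of _ T])
  then have "\<mu> \<in> local_minima Y g"
    using \<mu>K T by (auto simp: local_minima_def)
  then show ?thesis using \<mu>K \<mu>(2)[OF w] that by simp
qed

text \<open>
  Neighbouring slabs overlap, so that a component of one slab and a component of the next can be
  adjacent by having a common point.
\<close>
definition slab :: "real \<Rightarrow> int \<Rightarrow> 'b set" where
  "slab \<delta> k = {y \<in> Y. (of_int k - 1) * \<delta> < g y \<and> g y < (of_int k + 1) * \<delta>}"

definition slab_component :: "real \<Rightarrow> int \<Rightarrow> 'b set \<Rightarrow> bool" where
  "slab_component \<delta> k C \<longleftrightarrow> (\<exists>y\<in>slab \<delta> k. C = path_component_set (slab \<delta> k) y)"

lemma openin_slab: "openin (top_of_set Y) (slab \<delta> k)"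
  using openin_height[of "{(of_int k - 1) * \<delta> <..< (of_int k + 1) * \<delta>}"] by (simp add: slab_def)

lemma slab_component_subset: "slab_component \<delta> k C \<Longrightarrow> C \<subseteq> slab \<delta> k"
  unfolding slab_component_def using path_component_subset by blast

lemma slab_component_eq:
  assumes "slab_component \<delta> k C" "y \<in> C"
  shows "C = path_component_set (slab \<delta> k) y"
  using assms path_component_eq unfolding slab_component_def by fastforce

lemma path_component_slab_component:
  assumes "slab_component \<delta> k C" "x \<in> C" "y \<in> C"
  shows "path_component C x y"
  using assms(1) unfolding slab_component_def
  by (metis assms(2,3) path_connected_component path_connected_path_component)

lemma openin_slab_component:
  assumes "slab_component \<delta> k C"
  shows "openin (top_of_set Y) C" "openin (top_of_set Y) (slab \<delta> k - C)"
proof -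
  obtain y where C: "C = path_component_set (slab \<delta> k) y"
    using assms by (auto simp: slab_component_def)
  show "openin (top_of_set Y) C" unfolding C
    by (rule geodesic_openin_path_component(1)[OF geodesic openin_slab])
  have "openin (top_of_set (slab \<delta> k)) (slab \<delta> k - C)"
    unfolding C using geodesic_openin_path_component(2)[OF geodesic openin_slab, of \<delta> k y]
    by (simp add: closedin_def)
  then show "openin (top_of_set Y) (slab \<delta> k - C)"
    using openin_slab openin_trans by blast
qed

lemma continuous_on_slab_component_extension:
  fixes H :: "real \<Rightarrow> 'd::real_normed_vector"
  assumes C: "slab_component \<delta> k C" and "\<delta> > 0" "\<eta> < \<delta>"
    and H: "continuous_on UNIV H" and AY: "A \<subseteq> Y"
    and lo: "\<And>y. y \<in> A \<Longrightarrow> g y \<le> (of_int k - 1) * \<delta> \<Longrightarrow> \<forall>x < of_int k * \<delta>. H x = 0"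
    and hi: "\<And>y. y \<in> A \<Longrightarrow> (of_int k + 1) * \<delta> \<le> g y \<Longrightarrow> \<forall>x > of_int k * \<delta> + \<eta>. H x = 0"
  shows "continuous_on A (\<lambda>y. if y \<in> C then H (g y) else 0)"
proof (rule continuous_on_restrict_clopen[OF openin_slab_component[OF C]
      slab_component_subset[OF C] continuous H AY])
  fix y assume y: "y \<in> A - slab \<delta> k"
  then consider "g y \<le> (of_int k - 1) * \<delta>" | "(of_int k + 1) * \<delta> \<le> g y"
    using AY by (force simp: slab_def)
  then show "\<exists>V. open V \<and> g y \<in> V \<and> (\<forall>x\<in>V. H x = 0)"
  proof cases
    case 1
    then show ?thesis using lo[of y] y \<open>\<delta> > 0\<close>
      by (intro exI[of _ "{..<of_int k * \<delta>}"]) (auto simp: algebra_simps)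
  next
    case 2
    then show ?thesis using hi[of y] y \<open>\<eta> < \<delta>\<close>
      by (intro exI[of _ "{of_int k * \<delta> + \<eta><..}"]) (auto simp: algebra_simps)
  qed
qed

text \<open>
  The bound on the number of lower turns of a simple walk. Let \<open>u i\<close> be a common point of the
  components \<open>C i\<close> and \<open>C (i + 1)\<close>. For a lower turn \<open>j\<close> the chain \<open>Q j\<close> runs from \<open>u 0\<close> along the walk to \<open>u j\<close>,
  from there inside \<open>C j\<close> to a point \<open>w j\<close> of height at most \<open>k j * \<delta>\<close>, and on below height
  \<open>k j * \<delta> + \<eta>\<close> to a local minimum \<open>\<mu> j\<close>. The map \<open>\<psi> j\<close> to the circle turns once while the height rises
  from \<open>k j * \<delta>\<close> to \<open>k j * \<delta> + \<eta>\<close> inside \<open>C j\<close> and is constant elsewhere. With \<open>\<eta>\<close> so small that no \<open>u i\<close> and no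
  local minimum has height strictly between these values, \<open>\<psi> j\<close> winds \<open>-1\<close> times along \<open>Q j\<close> and not at all
  along \<open>Q i\<close> for another lower turn \<open>i\<close> that is not higher than \<open>j\<close>. The cycles are the differences of \<open>Q j\<close>
  and \<open>Q i\<close>, where \<open>i\<close> is a lowest turn with the same local minimum.
\<close>
lemma card_lower_turns_le:
  fixes k :: "nat \<Rightarrow> int" and C :: "nat \<Rightarrow> 'b set"
  assumes "\<delta> > 0"
    and C: "\<And>i. i \<le> N \<Longrightarrow> slab_component \<delta> (k i) (C i)"
    and meet: "\<And>i. i < N \<Longrightarrow> C i \<inter> C (Suc i) \<noteq> {}"
    and step: "\<And>i. i < N \<Longrightarrow> \<bar>k (Suc i) - k i\<bar> = 1"
    and simple: "\<And>i j. i \<le> N \<Longrightarrow> j \<le> N \<Longrightarrow> k i = k j \<Longrightarrow> C i = C j \<Longrightarrow> i = j"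
    and fin: "finite (local_minima Y g)"
  shows "enat (card {j. 0 < j \<and> j < N \<and> k (j - 1) = k j + 1 \<and> k (Suc j) = k j + 1})
    \<le> betti_number 1 (top_of_set Y) + enat (card (local_minima Y g))"
proof -
  define J where "J = {j. 0 < j \<and> j < N \<and> k (j - 1) = k j + 1 \<and> k (Suc j) = k j + 1}"
  have finJ: "finite J" unfolding J_def by (rule finite_subset[of _ "{..<N}"]) auto
  have JN: "j \<le> N" "0 < j" "j < N" "j - 1 \<le> N" "Suc j \<le> N" "k (j - 1) = k j + 1" "k (Suc j) = k j + 1" if "j \<in> J" for j
    using that by (auto simp: J_def)
  have CY: "C i \<subseteq> Y" if "i \<le> N" for i
    using slab_component_subset[OF C[OF that]] by (auto simp: slab_def)
  have height: "(of_int (k i) - 1) * \<delta> < g y" "g y < (of_int (k i) + 1) * \<delta>" if "y \<in> C i" "i \<le> N" for i y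
    using slab_component_subset[OF C[OF that(2)]] that(1) by (auto simp: slab_def)
  have disj: "C i \<inter> C j = {}" if "i \<le> N" "j \<le> N" "k i = k j" "i \<noteq> j" for i j
    using that simple[OF that(1-3)] slab_component_eq[OF C[OF that(1)]] slab_component_eq[OF C[OF that(2)]]
    by (metis disjoint_iff)
  obtain u where u: "\<And>i. i < N \<Longrightarrow> u i \<in> C i \<inter> C (Suc i)"
  proof -
    have "\<forall>i. \<exists>u. i < N \<longrightarrow> u \<in> C i \<inter> C (Suc i)" using meet by blast
    then show ?thesis using that by metis
  qed
  \<comment> \<open>If all of \<open>C j\<close> were above height \<open>k j * \<delta>\<close>, it would lie in the next slab and hence in both of the
    components that the walk visits before and after \<open>j\<close>, which are different.\<close>
  have "\<exists>w\<in>C j. g w \<le> of_int (k j) * \<delta>" if j: "j \<in> J" for j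
  proof (rule ccontr)
    assume "\<not> (\<exists>w\<in>C j. g w \<le> of_int (k j) * \<delta>)"
    then have high: "of_int (k j) * \<delta> < g y" if "y \<in> C j" for y using that by force
    have sub: "C j \<subseteq> slab \<delta> (k j + 1)"
    proof
      fix y assume y: "y \<in> C j"
      then show "y \<in> slab \<delta> (k j + 1)"
        using high[OF y] height(2)[OF y JN(1)[OF j]] CY[OF JN(1)[OF j]] \<open>\<delta> > 0\<close>
        by (auto simp: slab_def algebra_simps)
    qed
    have pc: "path_connected (C j)"
      using path_component_slab_component[OF C[OF JN(1)[OF j]]] by (simp add: path_connected_component)
    have "C j \<subseteq> C i" if i: "i \<le> N" "k i = k j + 1" "v \<in> C i" "v \<in> C j" for i v
      using path_component_maximal[OF i(4) pc sub] slab_component_eq[OF C[OF i(1)] i(3)] i(2) by simp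
    from this[of "j - 1" "u (j - 1)"] this[of "Suc j" "u j"]
    have "C j \<subseteq> C (j - 1) \<inter> C (Suc j)"
      using u[of "j - 1"] u[of j] JN[OF j] by auto
    moreover have "C (j - 1) \<inter> C (Suc j) = {}"
      using disj[of "j - 1" "Suc j"] JN[OF j] by auto
    ultimately show False using u[of j] JN[OF j] by auto
  qed
  then obtain w where w: "\<And>j. j \<in> J \<Longrightarrow> w j \<in> C j" "\<And>j. j \<in> J \<Longrightarrow> g (w j) \<le> of_int (k j) * \<delta>"
    by metis
  \<comment> \<open>The positive elements of \<open>A\<close> are the gaps that the choice of \<open>\<eta>\<close> has to respect.\<close>
  define A where "A = (\<lambda>(i, j). g (u i) - of_int (k j) * \<delta>) ` ({..<N} \<times> {..N}) \<union>
      (\<lambda>(m, j). g m - of_int (k j) * \<delta>) ` (local_minima Y g \<times> {..N})"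
  have "finite A" using fin by (auto simp: A_def)
  then obtain \<eta> where \<eta>: "\<eta> > 0" "\<eta> < \<delta>" "\<And>a. a \<in> A \<Longrightarrow> a > 0 \<Longrightarrow> \<eta> \<le> a"
    using exists_uniform_gap \<open>\<delta> > 0\<close> by blast
  have gap_u: "of_int (k j) * \<delta> + \<eta> \<le> g (u i)" if "of_int (k j) * \<delta> < g (u i)" "i < N" "j \<le> N" for i j
  proof -
    have "g (u i) - of_int (k j) * \<delta> \<in> A" using that by (force simp: A_def)
    then show ?thesis using \<eta>(3) that(1) by fastforce
  qed
  have gap_m: "of_int (k j) * \<delta> + \<eta> \<le> g m" if "of_int (k j) * \<delta> < g m" "m \<in> local_minima Y g" "j \<le> N" for m j
  proof -
    have "g m - of_int (k j) * \<delta> \<in> A" using that by (force simp: A_def)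
    then show ?thesis using \<eta>(3) that(1) by fastforce
  qed
  define low where "low j = {y \<in> Y. g y < of_int (k j) * \<delta> + \<eta>}" for j
  have "\<exists>m. m \<in> local_minima Y g \<and> path_component (low j) (w j) m \<and> g m \<le> of_int (k j) * \<delta>"
    if j: "j \<in> J" for j
  proof -
    have "w j \<in> Y" "g (w j) < of_int (k j) * \<delta> + \<eta>"
      using w[OF j] CY[OF JN(1)[OF j]] \<eta>(1) by auto
    then obtain m where "m \<in> local_minima Y g" "path_component (low j) (w j) m" "g m \<le> g (w j)"
      unfolding low_def using local_minimum_below by blast
    then show ?thesis using w(2)[OF j] by auto
  qed
  then obtain \<mu> where \<mu>: "\<And>j. j \<in> J \<Longrightarrow> \<mu> j \<in> local_minima Y g"
    "\<And>j. j \<in> J \<Longrightarrow> path_component (low j) (w j) (\<mu> j)" "\<And>j. j \<in> J \<Longrightarrow> g (\<mu> j) \<le> of_int (k j) * \<delta>"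
    by metis

  define F where "F j x = min 1 (max 0 ((x - of_int (k j) * \<delta>) / \<eta>))" for j x
  have F0: "F j x = 0" if "x \<le> of_int (k j) * \<delta>" for j x
    using that \<eta>(1) by (simp add: F_def divide_nonpos_pos)
  have F1: "F j x = 1" if "of_int (k j) * \<delta> + \<eta> \<le> x" for j x
    using that \<eta>(1) by (simp add: F_def le_divide_eq max_def)
  have contF: "continuous_on UNIV (F j)" for j
    unfolding F_def using \<eta>(1) by (intro continuous_intros) auto
  define \<psi> where "\<psi> j y = (if y \<in> C j then cis (2 * pi * F j (g y)) else 1)" for j y
  have norm_\<psi>: "norm (\<psi> j y) = 1" for j y by (simp add: \<psi>_def)
  have restrict: "continuous_on A (\<lambda>y. if y \<in> C j then H (g y) else 0)"
    if "j \<le> N" "continuous_on UNIV H" "A \<subseteq> Y"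
      "\<And>y. y \<in> A \<Longrightarrow> g y \<le> (of_int (k j) - 1) * \<delta> \<Longrightarrow> \<forall>x < of_int (k j) * \<delta>. H x = 0"
      "\<And>y. y \<in> A \<Longrightarrow> (of_int (k j) + 1) * \<delta> \<le> g y \<Longrightarrow> \<forall>x > of_int (k j) * \<delta> + \<eta>. H x = 0"
    for A j and H :: "real \<Rightarrow> real"
    using continuous_on_slab_component_extension[OF C \<open>\<delta> > 0\<close> \<eta>(2)] that by blast
  have cont_\<psi>: "continuous_on Y (\<psi> j)" if "j \<in> J" for j
  proof -
    have "continuous_on Y (\<lambda>y. if y \<in> C j then cis (2 * pi * F j (g y)) - 1 else 0)"
      by (rule continuous_on_slab_component_extension[OF C[OF JN(1)[OF that]] \<open>\<delta> > 0\<close> \<eta>(2),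
            where H = "\<lambda>x. cis (2 * pi * F j x) - 1"])
         (auto simp: F0 F1 intro!: continuous_intros continuous_on_compose2[OF contF])
    then have "continuous_on Y (\<lambda>y. 1 + (if y \<in> C j then cis (2 * pi * F j (g y)) - 1 else 0))"
      by (intro continuous_intros)
    moreover have "(\<lambda>y. 1 + (if y \<in> C j then cis (2 * pi * F j (g y)) - 1 else 0)) = \<psi> j"
      by (auto simp: \<psi>_def)
    ultimately show ?thesis by (simp only:)
  qed

  \<comment> \<open>On another component of the walk, \<open>\<psi> j\<close> has an angle that vanishes outside the thin slab. If \<open>C i\<close>
    is one level higher than \<open>C j\<close>, it may meet the thin slab but contains nothing below it, and the angle
    is normalised to vanish at the upper end; otherwise \<open>\<psi> j\<close> is constant on \<open>C i\<close>.\<close>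
  have lift_other: "\<exists>l. continuous_on (C i) l \<and> (\<forall>y\<in>C i. \<psi> j y = cis (2 * pi * l y)) \<and>
      (\<forall>y\<in>C i. (of_int (k j) * \<delta> < g y \<longrightarrow> of_int (k j) * \<delta> + \<eta> \<le> g y) \<longrightarrow> l y = 0)"
    if i: "i \<le> N" and j: "j \<in> J" and "i \<noteq> j" for i j
  proof (cases "k i = k j + 1")
    case True
    have hi: "of_int (k j) * \<delta> < g y" if "y \<in> C i" for y
      using height(1)[OF that i] True by simp
    let ?l = "\<lambda>y. if y \<in> C j then F j (g y) - 1 else 0"
    have "continuous_on (C i) ?l"
    proof (rule restrict[OF JN(1)[OF j] _ CY[OF i], where H = "\<lambda>x. F j x - 1"])
      fix y assume "y \<in> C i" "g y \<le> (of_int (k j) - 1) * \<delta>"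
      then show "\<forall>x < of_int (k j) * \<delta>. F j x - 1 = 0"
        using hi[of y] \<open>\<delta> > 0\<close> by (simp add: algebra_simps)
    qed (auto simp: F1 intro!: continuous_intros contF)
    moreover have "\<psi> j y = cis (2 * pi * ?l y)" for y
      by (simp add: \<psi>_def right_diff_distrib cis_divide[symmetric])
    moreover have "?l y = 0"
      if "y \<in> C i" "of_int (k j) * \<delta> < g y \<longrightarrow> of_int (k j) * \<delta> + \<eta> \<le> g y" for y
      using hi[OF that(1)] that(2) F1 by simp
    ultimately show ?thesis by (intro exI[of _ ?l] conjI) blast+
  next
    case False
    have "\<psi> j y = 1" if y: "y \<in> C i" for y
    proof (cases "y \<in> C j")
      case True
      have "k i \<noteq> k j" using disj[OF i JN(1)[OF j]] \<open>i \<noteq> j\<close> True y by auto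
      moreover have "\<not> k i > k j + 1"
      proof
        assume "k i > k j + 1"
        then have "of_int (k j) + 1 \<le> (of_int (k i) - 1 :: real)" by linarith
        then have "(of_int (k j) + 1) * \<delta> \<le> (of_int (k i) - 1) * \<delta>"
          using \<open>\<delta> > 0\<close> by (intro mult_right_mono) auto
        then show False using height(1)[OF y i] height(2)[OF True JN(1)[OF j]] by linarith
      qed
      ultimately have "k i + 1 \<le> k j" using False by linarith
      then have "(of_int (k i) + 1) \<le> (of_int (k j) :: real)" by linarith
      then have "(of_int (k i) + 1) * \<delta> \<le> of_int (k j) * \<delta>"
        using \<open>\<delta> > 0\<close> by (intro mult_right_mono) auto
      then have "F j (g y) = 0" using height(2)[OF y i] by (intro F0) linarith
      then show ?thesis by (simp add: \<psi>_def)
    qed (simp add: \<psi>_def)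
    then show ?thesis by (intro exI[of _ "\<lambda>_. 0"]) auto
  qed

  \<comment> \<open>The walk itself does not wind: at the turn \<open>j\<close> it enters and leaves \<open>C j\<close> above the thin slab.\<close>
  have "\<exists>c. c \<in> real_chain_set 1 (top_of_set Y) \<and>
      real_chain_boundary 1 c = Poly_Mapping.single (point_simplex (u i)) 1 - Poly_Mapping.single (point_simplex (u (i - 1))) 1 \<and>
      (\<forall>j\<in>J. winding_cochain (\<psi> j) c = 0)" if i: "0 < i" "i < N" for i
  proof -
    have ui: "u (i - 1) \<in> C i" "u i \<in> C i" using u[of "i - 1"] u[of i] i by auto
    obtain c where c: "c \<in> real_chain_set 1 (top_of_set Y)"
      "real_chain_boundary 1 c = Poly_Mapping.single (point_simplex (u i)) 1 - Poly_Mapping.single (point_simplex (u (i - 1))) 1"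
      and lift: "\<And>\<psi> l. continuous_on (C i) l \<Longrightarrow> (\<And>y. y \<in> C i \<Longrightarrow> \<psi> y = cis (2 * pi * l y)) \<Longrightarrow>
       winding_cochain \<psi> c = l (u i) - l (u (i - 1))"
      using path_component_chain[OF path_component_slab_component[OF C ui] CY] i by auto
    have "winding_cochain (\<psi> j) c = 0" if j: "j \<in> J" for j
    proof (cases "i = j")
      case True
      have *: "winding_cochain (\<psi> j) c = F j (g (u i)) - F j (g (u (i - 1)))"
        using True i by (intro lift continuous_on_compose2[OF contF continuous_on_subset[OF continuous CY]])
          (auto simp: \<psi>_def)
      have "of_int (k j) * \<delta> < g (u i)"
        using height(1)[of "u i" "Suc i"] u[OF i(2)] JN[OF j] True by auto
      moreover have "of_int (k j) * \<delta> < g (u (i - 1))"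
        using height(1)[of "u (i - 1)" "i - 1"] u[of "i - 1"] JN[OF j] True i by auto
      ultimately show ?thesis using * F1 gap_u JN(1)[OF j] i by simp
    next
      case False
      obtain l where l: "continuous_on (C i) l" "\<And>y. y \<in> C i \<Longrightarrow> \<psi> j y = cis (2 * pi * l y)"
        "\<And>y. y \<in> C i \<Longrightarrow> (of_int (k j) * \<delta> < g y \<longrightarrow> of_int (k j) * \<delta> + \<eta> \<le> g y) \<Longrightarrow> l y = 0"
        using lift_other[OF _ j False] i by (meson less_imp_le)
      have "l (u i) = 0" "l (u (i - 1)) = 0"
        using l(3) ui gap_u[of j i] gap_u[of j "i - 1"] i JN(1)[OF j] by auto
      then show ?thesis using lift[OF l(1,2)] by simp
    qed
    then show ?thesis using c by blast
  qed
  then obtain m where m: "\<And>i. 0 < i \<Longrightarrow> i < N \<Longrightarrow> m i \<in> real_chain_set 1 (top_of_set Y)"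
    "\<And>i. 0 < i \<Longrightarrow> i < N \<Longrightarrow> real_chain_boundary 1 (m i) =
      Poly_Mapping.single (point_simplex (u i)) 1 - Poly_Mapping.single (point_simplex (u (i - 1))) 1"
    "\<And>i j. 0 < i \<Longrightarrow> i < N \<Longrightarrow> j \<in> J \<Longrightarrow> winding_cochain (\<psi> j) (m i) = 0"
    by metis

  \<comment> \<open>The descent inside \<open>C i\<close> crosses the thin slab of \<open>i\<close> downwards and no thin slab of a turn at the
    same height or above.\<close>
  have "\<exists>c. c \<in> real_chain_set 1 (top_of_set Y) \<and>
      real_chain_boundary 1 c = Poly_Mapping.single (point_simplex (w i)) 1 - Poly_Mapping.single (point_simplex (u i)) 1 \<and>
      winding_cochain (\<psi> i) c = - 1 \<and> (\<forall>j\<in>J. i \<noteq> j \<and> k i \<le> k j \<longrightarrow> winding_cochain (\<psi> j) c = 0)"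
    if i: "i \<in> J" for i
  proof -
    have iN: "i \<le> N" "i < N" using JN[OF i] by auto
    have ui: "u i \<in> C i" "w i \<in> C i" using u[of i] JN[OF i] w(1)[OF i] by auto
    obtain c where c: "c \<in> real_chain_set 1 (top_of_set Y)"
      "real_chain_boundary 1 c = Poly_Mapping.single (point_simplex (w i)) 1 - Poly_Mapping.single (point_simplex (u i)) 1"
      and lift: "\<And>\<psi> l. continuous_on (C i) l \<Longrightarrow> (\<And>y. y \<in> C i \<Longrightarrow> \<psi> y = cis (2 * pi * l y)) \<Longrightarrow>
       winding_cochain \<psi> c = l (w i) - l (u i)"
      using path_component_chain[OF path_component_slab_component[OF C[OF iN(1)] ui] CY[OF iN(1)]] by auto
    have "winding_cochain (\<psi> i) c = F i (g (w i)) - F i (g (u i))"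
      using iN by (intro lift continuous_on_compose2[OF contF continuous_on_subset[OF continuous CY]])
        (auto simp: \<psi>_def)
    moreover have "of_int (k i) * \<delta> < g (u i)"
      using height(1)[of "u i" "Suc i"] u[OF iN(2)] JN[OF i] by auto
    ultimately have "winding_cochain (\<psi> i) c = - 1"
      using F1 F0 gap_u iN w(2)[OF i] by simp
    moreover have "winding_cochain (\<psi> j) c = 0" if j: "j \<in> J" "i \<noteq> j" "k i \<le> k j" for j
    proof -
      obtain l where l: "continuous_on (C i) l" "\<And>y. y \<in> C i \<Longrightarrow> \<psi> j y = cis (2 * pi * l y)"
        "\<And>y. y \<in> C i \<Longrightarrow> (of_int (k j) * \<delta> < g y \<longrightarrow> of_int (k j) * \<delta> + \<eta> \<le> g y) \<Longrightarrow> l y = 0"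
        using lift_other[OF iN(1) j(1,2)] by meson
      have "of_int (k i) * \<delta> \<le> of_int (k j) * \<delta>"
        using j(3) \<open>\<delta> > 0\<close> by (intro mult_right_mono) auto
      then have "l (w i) = 0" "l (u i) = 0"
        using l(3) ui gap_u[of j i] iN w(2)[OF i] JN(1)[OF j(1)] by auto
      then show ?thesis using lift[OF l(1,2)] by simp
    qed
    ultimately show ?thesis using c by blast
  qed
  then obtain a where a: "\<And>i. i \<in> J \<Longrightarrow> a i \<in> real_chain_set 1 (top_of_set Y)"
    "\<And>i. i \<in> J \<Longrightarrow> real_chain_boundary 1 (a i) =
      Poly_Mapping.single (point_simplex (w i)) 1 - Poly_Mapping.single (point_simplex (u i)) 1"
    "\<And>i. i \<in> J \<Longrightarrow> winding_cochain (\<psi> i) (a i) = - 1"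
    "\<And>i j. i \<in> J \<Longrightarrow> j \<in> J \<Longrightarrow> i \<noteq> j \<Longrightarrow> k i \<le> k j \<Longrightarrow> winding_cochain (\<psi> j) (a i) = 0"
    by metis

  \<comment> \<open>Further down, a thin slab can only be entered and left from below.\<close>
  have "\<exists>c. c \<in> real_chain_set 1 (top_of_set Y) \<and>
      real_chain_boundary 1 c = Poly_Mapping.single (point_simplex (\<mu> i)) 1 - Poly_Mapping.single (point_simplex (w i)) 1 \<and>
      (\<forall>j\<in>J. k i \<le> k j \<longrightarrow> winding_cochain (\<psi> j) c = 0)"
    if i: "i \<in> J" for i
  proof -
    have "low i \<subseteq> Y" by (auto simp: low_def)
    then obtain c where c: "c \<in> real_chain_set 1 (top_of_set Y)"
      "real_chain_boundary 1 c = Poly_Mapping.single (point_simplex (\<mu> i)) 1 - Poly_Mapping.single (point_simplex (w i)) 1"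
      and lift: "\<And>\<psi> l. continuous_on (low i) l \<Longrightarrow> (\<And>y. y \<in> low i \<Longrightarrow> \<psi> y = cis (2 * pi * l y)) \<Longrightarrow>
       winding_cochain \<psi> c = l (\<mu> i) - l (w i)"
      using path_component_chain[OF \<mu>(2)[OF i]] by metis
    have "winding_cochain (\<psi> j) c = 0" if j: "j \<in> J" "k i \<le> k j" for j
    proof -
      let ?l = "\<lambda>y. if y \<in> C j then F j (g y) else 0"
      have le: "of_int (k i) * \<delta> \<le> of_int (k j) * \<delta>"
        using j(2) \<open>\<delta> > 0\<close> by (intro mult_right_mono) auto
      have "continuous_on (low i) ?l"
      proof (rule restrict[OF JN(1)[OF j(1)] contF])
        fix y assume "y \<in> low i" "(of_int (k j) + 1) * \<delta> \<le> g y"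
        then show "\<forall>x > of_int (k j) * \<delta> + \<eta>. F j x = 0"
          using le \<eta>(2) by (simp add: low_def algebra_simps)
      qed (auto simp: F0 low_def)
      then have "winding_cochain (\<psi> j) c = ?l (\<mu> i) - ?l (w i)"
        by (rule lift) (simp add: \<psi>_def)
      then show ?thesis using F0 \<mu>(3)[OF i] w(2)[OF i] le by simp
    qed
    then show ?thesis using c by blast
  qed
  then obtain b where b: "\<And>i. i \<in> J \<Longrightarrow> b i \<in> real_chain_set 1 (top_of_set Y)"
    "\<And>i. i \<in> J \<Longrightarrow> real_chain_boundary 1 (b i) =
      Poly_Mapping.single (point_simplex (\<mu> i)) 1 - Poly_Mapping.single (point_simplex (w i)) 1"
    "\<And>i j. i \<in> J \<Longrightarrow> j \<in> J \<Longrightarrow> k i \<le> k j \<Longrightarrow> winding_cochain (\<psi> j) (b i) = 0"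
    by metis

  define Q where "Q j = (\<Sum>i\<in>{0<..j}. m i) + a j + b j" for j
  have lin: "linear (winding_cochain (\<psi> j))" for j by (rule linear_winding_cochain)
  have lin_bd: "linear (real_chain_boundary 1)" by (rule linear_real_chain_boundary) simp
  have Q_chain: "Q j \<in> real_chain_set 1 (top_of_set Y)" if "j \<in> J" for j
    unfolding Q_def using m(1) a(1) b(1) JN[OF that] that
    by (intro real_chain_set_add real_chain_set_sum) auto
  have Q_bd: "real_chain_boundary 1 (Q j) =
      Poly_Mapping.single (point_simplex (\<mu> j)) 1 - Poly_Mapping.single (point_simplex (u 0)) 1" if j: "j \<in> J" for j
  proof -
    have "(\<Sum>i\<in>{0<..n}. real_chain_boundary 1 (m i)) =
        Poly_Mapping.single (point_simplex (u n)) 1 - Poly_Mapping.single (point_simplex (u 0)) 1" if "n < N" for n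
      using that
    proof (induction n)
      case (Suc n)
      have "{0<..Suc n} = insert (Suc n) {0<..n}" by auto
      then show ?case using Suc m(2)[of "Suc n"] by simp
    qed simp
    then show ?thesis
      using a(2)[OF j] b(2)[OF j] JN[OF j]
      by (simp add: Q_def linear_add[OF lin_bd] linear_sum[OF lin_bd] del: One_nat_def)
  qed
  have Q_diag: "winding_cochain (\<psi> j) (Q j) = - 1" if "j \<in> J" for j
    using m(3) a(3) b(3) that JN[OF that] by (simp add: Q_def linear_add[OF lin] linear_sum[OF lin])
  have Q_tri: "winding_cochain (\<psi> j) (Q i) = 0" if "i \<in> J" "j \<in> J" "i \<noteq> j" "k i \<le> k j" for i j
    using m(3) a(4) b(3) that JN[OF that(1)] by (simp add: Q_def linear_add[OF lin] linear_sum[OF lin])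

  \<comment> \<open>\<open>r x\<close> is a lowest turn whose descent ends at the local minimum \<open>x\<close>.\<close>
  have "\<exists>r. r \<in> J \<and> \<mu> r = x \<and> (\<forall>i\<in>J. \<mu> i = x \<longrightarrow> k r \<le> k i)" if "x \<in> \<mu> ` J" for x
  proof -
    let ?A = "{i \<in> J. \<mu> i = x}"
    have "finite ?A" "?A \<noteq> {}" using that finJ by auto
    then show ?thesis using arg_min_if_finite[of ?A k] by (intro exI[of _ "arg_min_on k ?A"]) fastforce
  qed
  then obtain r where r: "\<And>x. x \<in> \<mu> ` J \<Longrightarrow> r x \<in> J" "\<And>x. x \<in> \<mu> ` J \<Longrightarrow> \<mu> (r x) = x"
    "\<And>x i. x \<in> \<mu> ` J \<Longrightarrow> i \<in> J \<Longrightarrow> \<mu> i = x \<Longrightarrow> k (r x) \<le> k i" by metis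
  define J' where "J' = J - r ` \<mu> ` J"
  have "enat (card J') \<le> quotient_dim (real_cycles 1 (top_of_set Y)) (real_boundaries 1 (top_of_set Y))"
  proof (rule card_le_quotient_dim[where c = "\<lambda>j. Q j - Q (r (\<mu> j))" and \<Phi> = "\<lambda>j. winding_cochain (\<psi> j)"
        and level = k])
    show "finite J'" using finJ by (simp add: J'_def)
    fix j assume "j \<in> J'"
    then have j: "j \<in> J" "j \<notin> r ` \<mu> ` J" by (auto simp: J'_def)
    have rj: "r (\<mu> j) \<in> J" "\<mu> (r (\<mu> j)) = \<mu> j" "k (r (\<mu> j)) \<le> k j" using r j(1) by auto
    have "real_chain_boundary 1 (Q j - Q (r (\<mu> j))) = 0"
      by (simp only: linear_diff[OF lin_bd] Q_bd[OF j(1)] Q_bd[OF rj(1)] rj(2) diff_self)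
    then show "Q j - Q (r (\<mu> j)) \<in> real_cycles 1 (top_of_set Y)"
      using Q_chain[OF j(1)] Q_chain[OF rj(1)] by (simp add: real_cycles_def real_chain_set_diff)
    show "winding_cochain (\<psi> j) v = 0" if "v \<in> real_boundaries 1 (top_of_set Y)" for v
      using winding_cochain_boundary[OF cont_\<psi>[OF j(1)] norm_\<psi> that] .
    have "r (\<mu> j) \<noteq> j" using j by force
    then show "winding_cochain (\<psi> j) (Q j - Q (r (\<mu> j))) \<noteq> 0"
      using Q_diag[OF j(1)] Q_tri[OF rj(1) j(1) _ rj(3)] by (simp add: linear_diff[OF lin])
    fix i assume "i \<in> J'" "i \<noteq> j" "k i \<le> k j"
    then have i: "i \<in> J" "i \<noteq> j" "k i \<le> k j" by (auto simp: J'_def)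
    have ri: "r (\<mu> i) \<in> J" "k (r (\<mu> i)) \<le> k j" "r (\<mu> i) \<noteq> j"
      using r(1)[of "\<mu> i"] r(3)[of "\<mu> i" i] i j by force+
    show "winding_cochain (\<psi> j) (Q i - Q (r (\<mu> i))) = 0"
      using Q_tri[OF i(1) j(1) i(2,3)] Q_tri[OF ri(1) j(1) ri(3,2)] by (simp add: linear_diff[OF lin])
  qed (rule lin)
  then have b1: "enat (card J') \<le> betti_number 1 (top_of_set Y)" by (simp add: betti_number_def)
  have "card J \<le> card J' + card (r ` \<mu> ` J)"
    using finJ card_Un_le[of J' "r ` \<mu> ` J"] card_mono[of "J' \<union> r ` \<mu> ` J" J]
    by (fastforce simp: J'_def)
  also have "card (r ` \<mu> ` J) \<le> card (\<mu> ` J)" using finJ by (intro card_image_le) simp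
  also have "card (\<mu> ` J) \<le> card (local_minima Y g)" using \<mu>(1) fin by (intro card_mono) auto
  finally have "enat (card J) \<le> enat (card J') + enat (card (local_minima Y g))" by simp
  then show ?thesis
    unfolding J_def[symmetric] using b1 by (meson add_right_mono order_trans)
qed

end

section \<open>Walks through slab components\<close>

text \<open>
  Let \<open>\<sigma> i = \<plusminus> 1\<close> be the direction of step \<open>i\<close> and \<open>d i\<close> the error of the height at time \<open>i\<close>. The length
  of the zigzag is the sum of \<open>\<sigma> i\<close> times the height differences, and summation by parts leaves only the
  errors at the two ends and at the turns. Since upper and lower turns alternate, there are at most
  twice as many turns as lower turns plus one; the term \<open>- \<sigma> n\<close> in the induction keeps track of the
  kind of turn that comes next.
\<close>
lemma zigzag_length_le:
  fixes k :: "nat \<Rightarrow> int" and F :: "nat \<Rightarrow> real" and \<delta> e :: real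
  assumes "\<delta> > 0" "e \<ge> 0"
    and step: "\<And>i. i < N \<Longrightarrow> \<bar>k (Suc i) - k i\<bar> = 1"
    and near: "\<And>i. i \<le> N \<Longrightarrow> \<bar>of_int (k i) * \<delta> - F i\<bar> \<le> e"
  shows "N * \<delta> \<le> (\<Sum>i<N. \<bar>F (Suc i) - F i\<bar>) +
    e * (4 * card {j. 0 < j \<and> j < N \<and> k (j - 1) = k j + 1 \<and> k (Suc j) = k j + 1} + 4)"
proof (cases N)
  case 0
  then show ?thesis using \<open>e \<ge> 0\<close> by simp
next
  case (Suc n)
  define turn where "turn j \<longleftrightarrow> 0 < j \<and> k (j - 1) = k j + 1 \<and> k (Suc j) = k j + 1" for j
  define D where "D n = card {j. j < n \<and> turn j}" for n
  have D_Suc: "D (Suc n) = D n + (if turn n then 1 else 0)" for n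
  proof -
    have "{j. j < Suc n \<and> turn j} = (if turn n then insert n {j. j < n \<and> turn j} else {j. j < n \<and> turn j})"
      by (auto simp: less_Suc_eq)
    then show ?thesis by (simp add: D_def)
  qed
  define d where "d i = of_int (k i) * \<delta> - F i" for i
  define \<sigma> where "\<sigma> i = real_of_int (k (Suc i) - k i)" for i
  have d: "\<bar>d i\<bar> \<le> e" if "i \<le> N" for i using near[OF that] by (simp add: d_def)
  have \<sigma>: "\<sigma> i = 1 \<or> \<sigma> i = -1" if "i < N" for i using step[OF that] by (auto simp: \<sigma>_def abs_if split: if_splits)
  have one: "\<delta> \<le> \<bar>F (Suc i) - F i\<bar> + \<sigma> i * (d (Suc i) - d i)" if "i < N" for i
  proof -
    have "d (Suc i) - d i = \<sigma> i * \<delta> - (F (Suc i) - F i)"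
      by (simp add: d_def \<sigma>_def algebra_simps)
    then show ?thesis using \<sigma>[OF that] by (auto simp: abs_if)
  qed
  have "Suc n * \<delta> \<le> (\<Sum>i<Suc n. \<bar>F (Suc i) - F i\<bar>) + \<sigma> n * d (Suc n) + e * (4 * D (Suc n) + 2 - \<sigma> n)"
    if "Suc n \<le> N" for n
    using that
  proof (induction n)
    case 0
    have "{j. j < Suc 0 \<and> turn j} = {}" by (auto simp: turn_def)
    then have "D (Suc 0) = 0" by (simp add: D_def)
    then show ?case
      using one[of 0] d[of 0] d[of 1] \<sigma>[of 0] 0 \<open>e \<ge> 0\<close> by (auto simp: abs_if split: if_splits)
  next
    case (Suc n)
    have IH: "Suc n * \<delta> \<le> (\<Sum>i<Suc n. \<bar>F (Suc i) - F i\<bar>) + \<sigma> n * d (Suc n) + e * (4 * D (Suc n) + 2 - \<sigma> n)"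
      using Suc by simp
    have t: "turn (Suc n) \<longleftrightarrow> \<sigma> n = -1 \<and> \<sigma> (Suc n) = 1"
      by (auto simp: turn_def \<sigma>_def)
    have "\<sigma> n * d (Suc n) + e * (4 * D (Suc n) + 2 - \<sigma> n) + \<sigma> (Suc n) * (d (Suc (Suc n)) - d (Suc n))
        \<le> \<sigma> (Suc n) * d (Suc (Suc n)) + e * (4 * D (Suc (Suc n)) + 2 - \<sigma> (Suc n))"
      unfolding D_Suc[of "Suc n"] t
      using \<sigma>[of n] \<sigma>[of "Suc n"] d[of "Suc n"] Suc.prems by (auto simp: algebra_simps)
    then show ?case using IH one[of "Suc n"] Suc.prems by (simp add: algebra_simps)
  qed
  from this[of n] have "N * \<delta> \<le> (\<Sum>i<N. \<bar>F (Suc i) - F i\<bar>) + (\<sigma> n * d N - e * \<sigma> n) + e * (4 * D N + 2)"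
    using Suc by (simp add: algebra_simps)
  moreover have "\<sigma> n * d N - e * \<sigma> n \<le> e * 2"
    using \<sigma>[of n] d[of N] Suc \<open>e \<ge> 0\<close> by auto
  moreover have "{j. 0 < j \<and> j < N \<and> k (j - 1) = k j + 1 \<and> k (Suc j) = k j + 1} = {j. j < N \<and> turn j}"
    by (auto simp: turn_def)
  ultimately show ?thesis by (simp add: D_def algebra_simps)
qed

lemma sum_le_curve_length:
  assumes "\<And>i j. i \<le> j \<Longrightarrow> j \<le> N \<Longrightarrow> T i \<le> T j" "0 \<le> T 0" "T N \<le> 1"
  shows "ereal (\<Sum>i<N. dist (\<gamma> (T i)) (\<gamma> (T (Suc i)))) \<le> curve_length \<gamma>"
  unfolding curve_length_def
proof (rule SUP_upper2)
  let ?ts = "map T [0..<Suc N]"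
  have "T i \<in> {0..1}" if "i \<le> N" for i
    using assms(1)[of 0 i] assms(1)[of i N] assms(2,3) that by auto
  then show "?ts \<in> {ts. sorted ts \<and> set ts \<subseteq> {0..1}}"
    using assms(1) by (auto simp: sorted_iff_nth_mono less_Suc_eq_le simp del: upt_Suc)
  show "ereal (\<Sum>i<N. dist (\<gamma> (T i)) (\<gamma> (T (Suc i)))) \<le>
      ereal (\<Sum>i<length ?ts - 1. dist (\<gamma> (?ts ! i)) (\<gamma> (?ts ! Suc i)))"
    by (simp del: upt_Suc)
qed

lemma connected_chain_Union:
  assumes "a \<le> b" "\<And>i. a \<le> i \<Longrightarrow> i \<le> b \<Longrightarrow> connected (C i)"
    and "\<And>i. a \<le> i \<Longrightarrow> i < b \<Longrightarrow> C i \<inter> C (Suc i) \<noteq> {}"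
  shows "connected (\<Union>i\<in>{a..b::nat}. C i)"
  using assms
proof (induction b)
  case (Suc b)
  show ?case
  proof (cases "a = Suc b")
    case False
    then have "(\<Union>i\<in>{a..Suc b}. C i) = (\<Union>i\<in>{a..b}. C i) \<union> C (Suc b)"
      using Suc.prems(1) by (simp add: atLeastAtMostSuc_conv Un_commute)
    moreover have "(\<Union>i\<in>{a..b}. C i) \<inter> C (Suc b) \<noteq> {}"
      using Suc.prems(1) Suc.prems(3)[of b] False by fastforce
    ultimately show ?thesis
      using Suc False by (auto intro!: connected_Un)
  qed (use Suc in simp)
qed simp

context height_space
begin

definition vertex :: "real \<Rightarrow> 'b \<Rightarrow> int \<times> 'b set" where
  "vertex \<delta> y = (let k = \<lfloor>g y / \<delta>\<rfloor> in (k, path_component_set (slab \<delta> k) y))"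

text \<open>
  A walk visits pairs of a vertex \<open>(k, C)\<close> and a time \<open>s\<close>, where \<open>G s\<close> is the height at time \<open>s\<close> of
  the path that the walk approximates.
\<close>
definition admissible :: "real \<Rightarrow> real \<Rightarrow> (real \<Rightarrow> real) \<Rightarrow> (int \<times> 'b set) \<times> real \<Rightarrow> bool" where
  "admissible \<delta> e G = (\<lambda>((k, C), s). slab_component \<delta> k C \<and> \<bar>of_int k * \<delta> - G s\<bar> \<le> e)"

definition adjacent :: "int \<times> 'b set \<Rightarrow> int \<times> 'b set \<Rightarrow> bool" where
  "adjacent v w \<longleftrightarrow> \<bar>fst w - fst v\<bar> = 1 \<and> snd v \<inter> snd w \<noteq> {}"

definition walk_step :: "real \<Rightarrow> real \<Rightarrow> (real \<Rightarrow> real) \<Rightarrow> (int \<times> 'b set) \<times> real \<Rightarrow> (int \<times> 'b set) \<times> real \<Rightarrow> bool" where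
  "walk_step \<delta> e G x y \<longleftrightarrow> admissible \<delta> e G x \<and> admissible \<delta> e G y \<and> snd x \<le> snd y \<and>
     (fst x = fst y \<or> adjacent (fst x) (fst y))"

lemma vertex_bounds:
  assumes "\<delta> > 0"
  shows "of_int (fst (vertex \<delta> y)) * \<delta> \<le> g y" "g y < (of_int (fst (vertex \<delta> y)) + 1) * \<delta>"
proof -
  have "of_int (fst (vertex \<delta> y)) \<le> g y / \<delta>" "g y / \<delta> < of_int (fst (vertex \<delta> y)) + 1"
    by (simp_all add: vertex_def Let_def)
  then show "of_int (fst (vertex \<delta> y)) * \<delta> \<le> g y" "g y < (of_int (fst (vertex \<delta> y)) + 1) * \<delta>"
    using assms by (simp_all add: field_simps)
qed

lemma vertex_slab:
  assumes "\<delta> > 0" "y \<in> Y"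
  shows "y \<in> slab \<delta> (fst (vertex \<delta> y))" "slab_component \<delta> (fst (vertex \<delta> y)) (snd (vertex \<delta> y))"
    "y \<in> snd (vertex \<delta> y)"
proof -
  show *: "y \<in> slab \<delta> (fst (vertex \<delta> y))"
    using vertex_bounds[OF assms(1), of y] assms by (simp add: slab_def algebra_simps)
  have "snd (vertex \<delta> y) = path_component_set (slab \<delta> (fst (vertex \<delta> y))) y"
    by (simp add: vertex_def Let_def)
  then show "slab_component \<delta> (fst (vertex \<delta> y)) (snd (vertex \<delta> y))" "y \<in> snd (vertex \<delta> y)"
    using * by (auto simp: slab_component_def path_component_refl)
qed

lemma vertex_eqI:
  assumes "slab_component \<delta> k C" "y \<in> C" "fst (vertex \<delta> y) = k"
  shows "vertex \<delta> y = (k, C)"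
  using slab_component_eq[OF assms(1,2)] assms(3) by (auto simp: vertex_def Let_def)

lemma admissible_vertex:
  assumes "\<delta> > 0" "y \<in> Y" "\<bar>g y - G s\<bar> \<le> e"
  shows "admissible \<delta> (e + \<delta>) G (vertex \<delta> y, s)"
  using vertex_slab(2)[OF assms(1,2)] vertex_bounds[OF assms(1), of y] assms
  by (auto simp: admissible_def algebra_simps split: prod.splits)

text \<open>
  The vertex of a point is locally constant along a path up to a move to the slab below, so the
  vertices along a path are connected by steps. Time does not advance, which makes the relation
  symmetric.
\<close>
lemma walk_along_path:
  assumes \<delta>: "\<delta> > 0" and pq: "path_component {y \<in> Y. \<bar>g y - G s\<bar> \<le> e} p q"
  shows "(walk_step \<delta> (e + \<delta>) G)\<^sup>*\<^sup>* (vertex \<delta> p, s) (vertex \<delta> q, s)"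
proof -
  obtain \<gamma> where \<gamma>: "path \<gamma>" "path_image \<gamma> \<subseteq> {y \<in> Y. \<bar>g y - G s\<bar> \<le> e}" "\<gamma> 0 = p" "\<gamma> 1 = q"
    using pq unfolding path_component_def pathstart_def pathfinish_def by blast
  then have \<gamma>Y: "\<gamma> t \<in> Y" "\<bar>g (\<gamma> t) - G s\<bar> \<le> e" if "t \<in> {0..1}" for t
  proof -
    have "\<gamma> t \<in> path_image \<gamma>" using that by (simp add: path_image_def)
    then show "\<gamma> t \<in> Y" "\<bar>g (\<gamma> t) - G s\<bar> \<le> e" using \<gamma>(2) by auto
  qed
  let ?W = "\<lambda>t t'. (walk_step \<delta> (e + \<delta>) G)\<^sup>*\<^sup>* (vertex \<delta> (\<gamma> t), s) (vertex \<delta> (\<gamma> t'), s)"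
  have "?W 0 1 \<and> ?W 1 0"
  proof (rule connected_equivalence_relation[where S = "{0..1::real}" and R = "\<lambda>t t'. ?W t t' \<and> ?W t' t"])
    fix t :: real assume t: "t \<in> {0..1}"
    define k C where "k = fst (vertex \<delta> (\<gamma> t))" and "C = snd (vertex \<delta> (\<gamma> t))"
    have C: "slab_component \<delta> k C" "\<gamma> t \<in> C"
      using vertex_slab[OF \<delta> \<gamma>Y(1)[OF t]] by (simp_all add: k_def C_def)
    have "openin (top_of_set {0..1}) ({0..1} \<inter> \<gamma> -` C)"
      using \<gamma>(1) \<gamma>Y openin_slab_component(1)[OF C(1)] unfolding path_def
      by (intro continuous_openin_preimage) auto
    moreover have "?W t t' \<and> ?W t' t" if t': "t' \<in> {0..1} \<inter> \<gamma> -` C" for t'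
    proof -
      have t'01: "t' \<in> {0..1}" and C': "\<gamma> t' \<in> C" using t' by auto
      then have "\<gamma> t' \<in> slab \<delta> k" using slab_component_subset[OF C(1)] by blast
      then have "(of_int k - 1) * \<delta> < g (\<gamma> t')" "g (\<gamma> t') < (of_int k + 1) * \<delta>"
        by (auto simp: slab_def)
      then have "(of_int k - 1) * \<delta> < (of_int (fst (vertex \<delta> (\<gamma> t'))) + 1) * \<delta>"
          "of_int (fst (vertex \<delta> (\<gamma> t'))) * \<delta> < (of_int k + 1) * \<delta>"
        using vertex_bounds[OF \<delta>, of "\<gamma> t'"] by linarith+
      then have "fst (vertex \<delta> (\<gamma> t')) = k \<or> fst (vertex \<delta> (\<gamma> t')) = k - 1"
        using \<delta> by (simp add: mult_less_cancel_right) linarith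
      then have "vertex \<delta> (\<gamma> t') = vertex \<delta> (\<gamma> t) \<or>
          adjacent (vertex \<delta> (\<gamma> t')) (vertex \<delta> (\<gamma> t)) \<and> adjacent (vertex \<delta> (\<gamma> t)) (vertex \<delta> (\<gamma> t'))"
        using vertex_eqI[OF C(1) C'] C' vertex_slab(3)[OF \<delta> \<gamma>Y(1)[OF t'01]]
        unfolding adjacent_def k_def C_def by auto
      moreover have "admissible \<delta> (e + \<delta>) G (vertex \<delta> (\<gamma> t), s)" "admissible \<delta> (e + \<delta>) G (vertex \<delta> (\<gamma> t'), s)"
        using admissible_vertex[where G = G and s = s, OF \<delta> \<gamma>Y(1)[OF t] \<gamma>Y(2)[OF t]]
          admissible_vertex[where G = G and s = s, OF \<delta> \<gamma>Y(1)[OF t'01] \<gamma>Y(2)[OF t'01]] by auto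
      ultimately show ?thesis by (auto simp: walk_step_def intro!: r_into_rtranclp)
    qed
    ultimately show "\<exists>T. openin (top_of_set {0..1}) T \<and> t \<in> T \<and> (\<forall>x\<in>T. ?W t x \<and> ?W x t)"
      using t C(2) by (intro exI[of _ "{0..1} \<inter> \<gamma> -` C"]) auto
  qed (auto intro: rtranclp_trans)
  then show ?thesis using \<gamma>(3,4) by simp
qed

text \<open>Unlike in the relation \<open>walk_step\<close>, consecutive vertices are different here.\<close>
definition walk_seq :: "real \<Rightarrow> real \<Rightarrow> (real \<Rightarrow> real) \<Rightarrow> nat \<Rightarrow> (nat \<Rightarrow> int \<times> 'b set) \<Rightarrow> (nat \<Rightarrow> real) \<Rightarrow> bool" where
  "walk_seq \<delta> e G N V T \<longleftrightarrow> (\<forall>i\<le>N. admissible \<delta> e G (V i, T i)) \<and>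
     (\<forall>i<N. adjacent (V i) (V (Suc i)) \<and> T i \<le> T (Suc i))"

text \<open>
  A step that stays at a vertex only postpones the time at which the vertex is visited, and times may
  be postponed as long as they remain ordered.
\<close>
lemma walk_seq_of_rtranclp:
  assumes "(walk_step \<delta> e G)\<^sup>*\<^sup>* x y" "admissible \<delta> e G x"
  shows "\<exists>N V T. walk_seq \<delta> e G N V T \<and> V 0 = fst x \<and> V N = fst y \<and> snd x \<le> T 0 \<and> T N \<le> snd y"
  using assms
proof (induction rule: rtranclp_induct)
  case base
  then show ?case
    by (intro exI[of _ 0] exI[of _ "\<lambda>_. fst x"] exI[of _ "\<lambda>_. snd x"]) (simp add: walk_seq_def)
next
  case (step y z)
  then obtain N V T where N: "walk_seq \<delta> e G N V T" "V 0 = fst x" "V N = fst y" "snd x \<le> T 0" "T N \<le> snd y"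
    by blast
  have z: "admissible \<delta> e G z" "snd y \<le> snd z" "fst y = fst z \<or> adjacent (fst y) (fst z)"
    using step(2) by (auto simp: walk_step_def)
  show ?case
  proof (cases "fst y = fst z")
    case True
    define T' where "T' = T(N := snd z)"
    have "walk_seq \<delta> e G N V T'"
      using N z True unfolding walk_seq_def T'_def
      by (auto simp: less_Suc_eq_le intro: order_trans)
    moreover have "snd x \<le> T' 0" "T' N \<le> snd z" using N(4,5) z(2) by (auto simp: T'_def)
    ultimately show ?thesis
      using N(2,3) True by auto
  next
    case False
    define V' T' where "V' = V(Suc N := fst z)" and "T' = T(Suc N := snd z)"
    have "walk_seq \<delta> e G (Suc N) V' T'"
      using N z False unfolding walk_seq_def V'_def T'_def by (auto simp: le_Suc_eq less_Suc_eq)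
    moreover have "V' 0 = fst x" "V' (Suc N) = fst z" "snd x \<le> T' 0" "T' (Suc N) \<le> snd z"
      using N by (simp_all add: V'_def T'_def)
    ultimately show ?thesis by blast
  qed
qed

lemma walk_seq_mono: "walk_seq \<delta> e G N V T \<Longrightarrow> i \<le> j \<Longrightarrow> j \<le> N \<Longrightarrow> T i \<le> T j"
proof (induction j)
  case (Suc j)
  then show ?case by (cases "i = Suc j") (auto simp: walk_seq_def intro: order_trans)
qed simp

text \<open>
  Loop erasure: a shortest walk is simple, since the part between two visits of a vertex can be cut
  out without disturbing the order of the times.
\<close>
lemma simple_walk_exists:
  assumes "walk_seq \<delta> e G N V T" "V 0 = v" "V N = v'" "a \<le> T 0" "T N \<le> b"
  obtains N V T where "walk_seq \<delta> e G N V T" "V 0 = v" "V N = v'" "a \<le> T 0" "T N \<le> b" "inj_on V {..N}"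
proof -
  define P where "P N \<longleftrightarrow> (\<exists>V T. walk_seq \<delta> e G N V T \<and> V 0 = v \<and> V N = v' \<and> a \<le> T 0 \<and> T N \<le> b)" for N
  have "P N" using assms by (auto simp: P_def)
  then have "P (LEAST N. P N)" by (rule LeastI)
  then obtain N where PN: "P N" and least: "\<And>n. n < N \<Longrightarrow> \<not> P n"
    using not_less_Least by blast
  obtain V T where N: "walk_seq \<delta> e G N V T" "V 0 = v" "V N = v'" "a \<le> T 0" "T N \<le> b"
    using PN by (auto simp: P_def)
  have "False" if ij: "i < j" "j \<le> N" "V i = V j" for i j
  proof -
    define V' where "V' n = (if n < i then V n else V (n + (j - i)))" for n
    define T' where "T' n = (if n < i then T n else T (n + (j - i)))" for n
    have "walk_seq \<delta> e G (N - (j - i)) V' T'"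
      unfolding walk_seq_def
    proof (intro conjI allI impI)
      fix n assume n: "n \<le> N - (j - i)"
      show "admissible \<delta> e G (V' n, T' n)"
        using N(1) n ij by (auto simp: walk_seq_def V'_def T'_def)
    next
      fix n assume n: "n < N - (j - i)"
      consider "Suc n < i" | "Suc n = i" | "i \<le> n" by linarith
      then show "adjacent (V' n) (V' (Suc n))"
      proof cases
        case 2
        then have "V' (Suc n) = V (Suc n)" using ij by (simp add: V'_def)
        moreover have "adjacent (V n) (V (Suc n))" using N(1) n by (simp add: walk_seq_def)
        ultimately show ?thesis using 2 by (simp add: V'_def)
      qed (use N(1) n ij in \<open>auto simp: walk_seq_def V'_def\<close>)
      show "T' n \<le> T' (Suc n)"
        unfolding T'_def using walk_seq_mono[OF N(1)] n ij by auto
    qed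
    moreover have "V' 0 = v" "a \<le> T' 0"
      using N(2,4) ij walk_seq_mono[OF N(1), of 0 j] by (auto simp: V'_def T'_def)
    moreover have "V' (N - (j - i)) = v'" "T' (N - (j - i)) \<le> b"
      using N(3,5) ij by (auto simp: V'_def T'_def)
    ultimately have "P (N - (j - i))" by (auto simp: P_def)
    moreover have "N - (j - i) < N" using ij by linarith
    ultimately show False using least by blast
  qed
  then have "inj_on V {..N}" by (metis atMost_iff inj_onI linorder_neqE_nat)
  then show ?thesis using N that by blast
qed

lemma walk_level_diff:
  assumes "walk_seq \<delta> e G N V T" "i \<le> j" "j \<le> N"
  shows "\<bar>fst (V j) - fst (V i)\<bar> \<le> int (j - i)"
  using assms(2,3)
proof (induction j)
  case (Suc j)
  show ?case
  proof (cases "i = Suc j")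
    case False
    then have "\<bar>fst (V j) - fst (V i)\<bar> \<le> int (j - i)" "\<bar>fst (V (Suc j)) - fst (V j)\<bar> = 1" "int (Suc j - i) = int (j - i) + 1"
      using Suc assms(1) by (auto simp: walk_seq_def adjacent_def)
    then show ?thesis by linarith
  qed simp
qed simp

text \<open>
  Time \<open>t\<close> in \<open>[0, 1]\<close> is sent to a point of the vertex number \<open>t * N\<close>, rounded down. The vertices between two
  times form a connected set, and each step changes the level by one.
\<close>
lemma approximate_path_of_walk:
  assumes "\<delta> > 0" and V: "walk_seq \<delta> e G N V T" and y: "y \<in> snd (V 0)" "y' \<in> snd (V N)"
  shows "\<exists>w. w 0 = y \<and> w 1 = y' \<and>
    (\<forall>s t. 0 \<le> s \<and> s \<le> t \<and> t \<le> 1 \<longrightarrow> (\<exists>K. connected K \<and> K \<subseteq> Y \<and> w s \<in> K \<and> w t \<in> K \<and>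
       (\<forall>p\<in>K. \<forall>q\<in>K. \<bar>g p - g q\<bar> \<le> N * \<delta> * (t - s) + 3 * \<delta>)))"
proof -
  define idx where "idx t = nat \<lfloor>t * N\<rfloor>" for t :: real
  have comp: "slab_component \<delta> (fst (V i)) (snd (V i))" if "i \<le> N" for i
    using V that by (auto simp: walk_seq_def admissible_def split: prod.splits)
  define w where "w t = (if t = 0 then y else if t = 1 then y' else (SOME z. z \<in> snd (V (idx t))))" for t :: real
  have idx: "idx t \<le> N" if "0 \<le> t" "t \<le> 1" for t
  proof -
    have "t * N \<le> N" using that mult_right_mono[of t 1 "real N"] by simp
    then have "\<lfloor>t * N\<rfloor> \<le> int N" by (simp add: floor_le_iff)
    then show ?thesis by (simp add: idx_def)
  qed
  have w: "w t \<in> snd (V (idx t))" if t01: "0 \<le> t" "t \<le> 1" for t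
  proof -
    obtain z where "z \<in> slab \<delta> (fst (V (idx t)))" "snd (V (idx t)) = path_component_set (slab \<delta> (fst (V (idx t)))) z"
      using comp[OF idx[OF t01]] by (auto simp: slab_component_def)
    then have "z \<in> snd (V (idx t))" by (simp add: path_component_refl)
    then have "(SOME z. z \<in> snd (V (idx t))) \<in> snd (V (idx t))" by (rule someI)
    then show ?thesis using y by (auto simp: w_def idx_def)
  qed
  show ?thesis
  proof (intro exI[of _ w] conjI allI impI; (elim conjE)?)
    show "w 0 = y" "w 1 = y'" by (simp_all add: w_def)
    fix s t :: real assume st: "0 \<le> s" "s \<le> t" "t \<le> 1"
    define K where "K = (\<Union>i\<in>{idx s..idx t}. snd (V i))"
    have st': "idx s \<le> idx t" unfolding idx_def using st by (intro nat_mono floor_mono mult_right_mono) auto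
    have tN: "idx t \<le> N" using idx st by simp
    have "connected (snd (V i))" if "i \<le> N" for i
      using path_component_slab_component[OF comp[OF that]]
      by (simp add: path_connected_component path_connected_imp_connected)
    moreover have "snd (V i) \<inter> snd (V (Suc i)) \<noteq> {}" if "i < N" for i
      using V that by (auto simp: walk_seq_def adjacent_def)
    ultimately have "connected K"
      unfolding K_def using st' tN by (intro connected_chain_Union) auto
    moreover have "K \<subseteq> Y"
    proof -
      have sub: "snd (V i) \<subseteq> Y" if "i \<le> N" for i
        using slab_component_subset[OF comp[OF that]] by (auto simp: slab_def)
      show ?thesis unfolding K_def by (rule UN_least, rule sub) (use tN in simp)
    qed
    moreover have "w s \<in> K" "w t \<in> K"
      using w[of s] w[of t] st st' by (auto simp: K_def)
    moreover have "\<bar>g p - g q\<bar> \<le> N * \<delta> * (t - s) + 3 * \<delta>" if pq: "p \<in> K" "q \<in> K" for p q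
    proof -
      obtain i j where ij: "i \<in> {idx s..idx t}" "j \<in> {idx s..idx t}" "p \<in> snd (V i)" "q \<in> snd (V j)"
        using pq by (auto simp: K_def)
      have "\<bar>fst (V i) - fst (V j)\<bar> \<le> int (idx t - idx s)"
        using walk_level_diff[OF V, of i j] walk_level_diff[OF V, of j i] ij tN by (cases "i \<le> j") auto
      then have lev: "\<bar>real_of_int (fst (V i)) - of_int (fst (V j))\<bar> \<le> real (idx t - idx s)"
        by linarith
      have "real (idx t) \<le> t * N" "s * N < real (idx s) + 1"
        using st by (auto simp: idx_def)
      then have "real (idx t - idx s) \<le> (t - s) * N + 1"
        using st' by (simp add: of_nat_diff algebra_simps)
      then have "\<bar>real_of_int (fst (V i)) - of_int (fst (V j))\<bar> * \<delta> \<le> ((t - s) * N + 1) * \<delta>"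
        using lev \<open>\<delta> > 0\<close> by (intro mult_right_mono) auto
      then have lev': "\<bar>of_int (fst (V i)) * \<delta> - of_int (fst (V j)) * \<delta>\<bar> \<le> N * \<delta> * (t - s) + \<delta>"
      proof -
        have "\<bar>of_int (fst (V i)) * \<delta> - of_int (fst (V j)) * \<delta>\<bar>
            = \<bar>real_of_int (fst (V i)) - of_int (fst (V j))\<bar> * \<delta>"
          using \<open>\<delta> > 0\<close> by (simp add: abs_mult flip: left_diff_distrib)
        moreover have "((t - s) * N + 1) * \<delta> = N * \<delta> * (t - s) + \<delta>" by (simp add: algebra_simps)
        ultimately show ?thesis
          using \<open>\<bar>real_of_int (fst (V i)) - of_int (fst (V j))\<bar> * \<delta> \<le> ((t - s) * N + 1) * \<delta>\<close> by linarith
      qed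
      have near: "\<bar>g z - of_int (fst (V n)) * \<delta>\<bar> < \<delta>" if "n \<le> N" "z \<in> snd (V n)" for z n
        using slab_component_subset[OF comp[OF that(1)]] that(2) by (auto simp: slab_def algebra_simps)
      have "\<bar>g p - of_int (fst (V i)) * \<delta>\<bar> < \<delta>" "\<bar>g q - of_int (fst (V j)) * \<delta>\<bar> < \<delta>"
        using near ij tN by simp_all
      then show ?thesis using lev' by linarith
    qed
    ultimately show "\<exists>K. connected K \<and> K \<subseteq> Y \<and> w s \<in> K \<and> w t \<in> K \<and>
       (\<forall>p\<in>K. \<forall>q\<in>K. \<bar>g p - g q\<bar> \<le> N * \<delta> * (t - s) + 3 * \<delta>)" by blast
  qed
qed

end

section \<open>Reeb graphs and isometries\<close>

lemma curve_length_cong: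
  assumes "\<And>t. t \<in> {0..1} \<Longrightarrow> \<gamma> t = \<gamma>' t"
  shows "curve_length \<gamma> = curve_length \<gamma>'"
  unfolding curve_length_def
proof (rule SUP_cong[OF refl])
  fix ts :: "real list" assume ts: "ts \<in> {ts. sorted ts \<and> set ts \<subseteq> {0..1}}"
  have "\<gamma> (ts ! i) = \<gamma>' (ts ! i)" if "i < length ts" for i
    using assms ts nth_mem[OF that] by blast
  then show "ereal (\<Sum>i<length ts - 1. dist (\<gamma> (ts ! i)) (\<gamma> (ts ! Suc i))) =
      ereal (\<Sum>i<length ts - 1. dist (\<gamma>' (ts ! i)) (\<gamma>' (ts ! Suc i)))"
    by (auto intro!: sum.cong)
qed

lemma image_reeb_class_subset:
  assumes "continuous_on X \<phi>" "\<phi> ` X \<subseteq> Y" "\<And>x. x \<in> X \<Longrightarrow> g (\<phi> x) = f x" "x \<in> X"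
  shows "\<phi> ` reeb_class X f x \<subseteq> reeb_class Y g (\<phi> x)"
  unfolding reeb_class_def[of Y]
proof (rule connected_component_maximal)
  show "\<phi> x \<in> \<phi> ` reeb_class X f x" using assms(4) mem_reeb_class by auto
  show "connected (\<phi> ` reeb_class X f x)"
    using reeb_class_subset[of X f x]
    by (intro connected_continuous_image continuous_on_subset[OF assms(1)]) (auto simp: reeb_class_def)
  show "\<phi> ` reeb_class X f x \<subseteq> {y \<in> Y. g y = g (\<phi> x)}"
    using reeb_class_subset[of X f x] assms by auto
qed

lemma reeb_dist_homeomorphism_le:
  fixes X :: "'a::metric_space set" and Y :: "'b::metric_space set"
  assumes X: "geodesic_space X" "1-lipschitz_on X f" and Y: "geodesic_space Y" "1-lipschitz_on Y g"
    and \<phi>: "continuous_on X \<phi>" "\<phi> ` X \<subseteq> Y" and \<psi>: "continuous_on Y \<psi>" "\<psi> ` Y \<subseteq> X"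
    and inv: "\<And>x. x \<in> X \<Longrightarrow> \<psi> (\<phi> x) = x" "\<And>y. y \<in> Y \<Longrightarrow> \<phi> (\<psi> y) = y"
    and fg: "\<And>x. x \<in> X \<Longrightarrow> g (\<phi> x) = f x" and xx: "x \<in> X" "x' \<in> X"
  shows "reeb_dist Y g (reeb_class Y g (\<phi> x)) (reeb_class Y g (\<phi> x')) \<le>
    reeb_dist X f (reeb_class X f x) (reeb_class X f x')"
proof -
  have image: "\<phi> ` reeb_class X f p = reeb_class Y g (\<phi> p)" if p: "p \<in> X" for p
  proof
    show "\<phi> ` reeb_class X f p \<subseteq> reeb_class Y g (\<phi> p)"
      using \<phi> fg p by (rule image_reeb_class_subset)
    have "f (\<psi> y) = g y" if "y \<in> Y" for y using fg[of "\<psi> y"] \<psi>(2) inv(2)[OF that] that by auto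
    then have "\<psi> ` reeb_class Y g (\<phi> p) \<subseteq> reeb_class X f (\<psi> (\<phi> p))"
      using \<psi> \<phi>(2) p by (intro image_reeb_class_subset) auto
    then have "\<phi> ` \<psi> ` reeb_class Y g (\<phi> p) \<subseteq> \<phi> ` reeb_class X f p"
      using inv(1)[OF p] by auto
    moreover have "\<phi> ` \<psi> ` reeb_class Y g (\<phi> p) = reeb_class Y g (\<phi> p)"
      using inv(2) reeb_class_subset[of Y g "\<phi> p"] by (force simp: image_iff)
    ultimately show "reeb_class Y g (\<phi> p) \<subseteq> \<phi> ` reeb_class X f p" by simp
  qed
  have \<phi>Y: "\<phi> p \<in> Y" if "p \<in> X" for p using \<phi>(2) that by auto
  have "continuous_map (top_of_set X) (reeb_topology Y g) (reeb_class Y g \<circ> \<phi>)"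
    using \<phi> by (intro continuous_map_compose[OF _ quotient_imp_continuous_map[OF quotient_map_reeb_class]])
      (auto simp: continuous_map_in_subtopology)
  then have "continuous_map (top_of_set X) (reeb_topology Y g) ((`) \<phi> \<circ> reeb_class X f)"
    by (rule continuous_map_eq) (simp add: image)
  then have cont: "continuous_map (reeb_topology X f) (reeb_topology Y g) ((`) \<phi>)"
    by (rule continuous_compose_quotient_map[OF quotient_map_reeb_class])
  have "ereal (reeb_dist Y g (reeb_class Y g (\<phi> x)) (reeb_class Y g (\<phi> x'))) \<le>
    ereal (reeb_dist X f (reeb_class X f x) (reeb_class X f x'))"
  proof (subst (1 2) reeb_dist_finite)
    show "(INF \<beta> \<in> {\<beta>. pathin (reeb_topology Y g) \<beta> \<and> \<beta> 0 = reeb_class Y g (\<phi> x) \<and> \<beta> 1 = reeb_class Y g (\<phi> x')}.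
          curve_length (reeb_fun g \<circ> \<beta>))
      \<le> (INF \<beta> \<in> {\<beta>. pathin (reeb_topology X f) \<beta> \<and> \<beta> 0 = reeb_class X f x \<and> \<beta> 1 = reeb_class X f x'}.
          curve_length (reeb_fun f \<circ> \<beta>))"
    proof (rule INF_mono)
      fix \<beta> assume \<beta>: "\<beta> \<in> {\<beta>. pathin (reeb_topology X f) \<beta> \<and> \<beta> 0 = reeb_class X f x \<and> \<beta> 1 = reeb_class X f x'}"
      then have "pathin (reeb_topology Y g) ((`) \<phi> \<circ> \<beta>)"
        using cont pathin_compose by blast
      moreover have "curve_length (reeb_fun g \<circ> ((`) \<phi> \<circ> \<beta>)) = curve_length (reeb_fun f \<circ> \<beta>)"
      proof (rule curve_length_cong)
        fix t :: real assume "t \<in> {0..1}"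
        then have "\<beta> t \<in> reeb_graph X f"
          using \<beta> by (auto simp: pathin_def continuous_map_def Pi_iff)
        then obtain p where "p \<in> X" "\<beta> t = reeb_class X f p" by (auto simp: reeb_graph_def)
        then show "(reeb_fun g \<circ> ((`) \<phi> \<circ> \<beta>)) t = (reeb_fun f \<circ> \<beta>) t"
          using fg \<phi>Y by (simp add: image reeb_fun_reeb_class)
      qed
      ultimately show "\<exists>\<alpha>\<in>{\<beta>. pathin (reeb_topology Y g) \<beta> \<and> \<beta> 0 = reeb_class Y g (\<phi> x) \<and> \<beta> 1 = reeb_class Y g (\<phi> x')}.
          curve_length (reeb_fun g \<circ> \<alpha>) \<le> curve_length (reeb_fun f \<circ> \<beta>)"
        using \<beta> xx by (intro bexI[of _ "(`) \<phi> \<circ> \<beta>"]) (auto simp: image)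
    qed
  qed (use X Y xx \<phi>Y in \<open>auto simp: reeb_graph_def\<close>)
  then show ?thesis by simp
qed

lemma distortion_fun_bounds:
  assumes "distortion_fun dA f dB g R \<le> ereal r" "(p, y) \<in> R"
  shows "(q, z) \<in> R \<Longrightarrow> \<bar>dA p q - dB y z\<bar> \<le> r" "\<bar>f p - g y\<bar> \<le> r"
proof -
  have "(SUP (x, y)\<in>R. ereal \<bar>f x - g y\<bar>) \<le> ereal r" "distortion dA dB R \<le> ereal r"
    using assms(1) by (auto simp: distortion_fun_def)
  then show "\<bar>f p - g y\<bar> \<le> r" "(q, z) \<in> R \<Longrightarrow> \<bar>dA p q - dB y z\<bar> \<le> r"
    using assms(2) unfolding distortion_def by (fastforce simp: SUP_le_iff)+
qed

lemma zero_of_small: "(\<And>e. e > 0 \<Longrightarrow> \<bar>a\<bar> \<le> 3 * e) \<Longrightarrow> a = (0::real)"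
proof (rule ccontr)
  assume *: "\<And>e. e > 0 \<Longrightarrow> \<bar>a\<bar> \<le> 3 * e" and "a \<noteq> 0"
  then show False using *[of "\<bar>a\<bar> / 6"] by simp
qed

text \<open>
  Correspondences with distortion tending to zero contain the graphs of almost isometries in both
  directions. A cluster point of these pairs of maps consists of two isometries. The maps have to
  converge together, so that the limits are inverse to each other; therefore each pair is encoded as a
  single map \<open>W n\<close> from \<open>X \<times> Y\<close> to \<open>Y \<times> X\<close>.
\<close>
lemma isometry_of_GH_dist_fun_zero:
  fixes X :: "'a::metric_space set" and Y :: "'b::metric_space set"
  assumes X: "compact X" "X \<noteq> {}" and Y: "compact Y" "Y \<noteq> {}"
    and lip: "1-lipschitz_on Y g"
    and zero: "GH_dist_fun X dist f Y dist g = 0"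
  obtains \<phi> \<psi> where "\<phi> ` X \<subseteq> Y" "\<psi> ` Y \<subseteq> X"
    "\<And>x. x \<in> X \<Longrightarrow> \<psi> (\<phi> x) = x" "\<And>y. y \<in> Y \<Longrightarrow> \<phi> (\<psi> y) = y"
    "\<And>x x'. x \<in> X \<Longrightarrow> x' \<in> X \<Longrightarrow> dist (\<phi> x) (\<phi> x') = dist x x'"
    "\<And>x. x \<in> X \<Longrightarrow> g (\<phi> x) = f x"
proof -
  define e where "e n = inverse (real (Suc n))" for n
  have "(INF R \<in> {R. correspondence X Y R}. distortion_fun dist f dist g R) = 0"
    using zero unfolding GH_dist_fun_def by (cases "INF R \<in> {R. correspondence X Y R}. distortion_fun dist f dist g R") auto
  then have "(INF R \<in> {R. correspondence X Y R}. distortion_fun dist f dist g R) < ereal (e n)" for n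
    by (simp add: e_def)
  then have "\<exists>R. correspondence X Y R \<and> distortion_fun dist f dist g R \<le> ereal (e n)" for n
    unfolding INF_less_iff by (meson less_imp_le mem_Collect_eq)
  then obtain R where R: "\<And>n. correspondence X Y (R n)" "\<And>n. distortion_fun dist f dist g (R n) \<le> ereal (e n)"
    by metis
  have dR: "\<bar>dist p q - dist y z\<bar> \<le> e n" if "(p, y) \<in> R n" "(q, z) \<in> R n" for n p q y z
    using distortion_fun_bounds(1)[OF R(2) that] .
  have hR: "\<bar>f p - g y\<bar> \<le> e n" if "(p, y) \<in> R n" for n p y
    using distortion_fun_bounds(2)[OF R(2) that] .
  have mem: "p \<in> X \<and> y \<in> Y" if "(p, y) \<in> R n" for n p y
    using R(1)[of n] that by (auto simp: correspondence_def)
  define P where "P n x = (SOME y. (x, y) \<in> R n)" for n x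
  define Q where "Q n y = (SOME x. (x, y) \<in> R n)" for n y
  have "\<exists>y. (x, y) \<in> R n" if "x \<in> X" for n x using R(1)[of n] that by (force simp: correspondence_def)
  then have P: "(x, P n x) \<in> R n" if "x \<in> X" for n x
    unfolding P_def using that by (intro someI_ex[of "\<lambda>y. (x, y) \<in> R n"])
  have "\<exists>x. (x, y) \<in> R n" if "y \<in> Y" for n y using R(1)[of n] that by (force simp: correspondence_def)
  then have Q: "(Q n y, y) \<in> R n" if "y \<in> Y" for n y
    unfolding Q_def using that by (intro someI_ex[of "\<lambda>x. (x, y) \<in> R n"])
  obtain x0 y0 where x0: "x0 \<in> X" and y0: "y0 \<in> Y" using X Y by blast
  define W where "W n = (\<lambda>(x, y). (if x \<in> X then P n x else y0, if y \<in> Y then Q n y else x0))" for n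
  have "compact (Y \<times> X)" using X Y by (intro compact_Times)
  moreover have "W n t \<in> Y \<times> X" for n t
    using mem[OF P] mem[OF Q] x0 y0 by (auto simp: W_def split: prod.splits)
  ultimately obtain w where w: "\<And>t. w t \<in> Y \<times> X" and
    clust: "\<And>T \<epsilon> n0. finite T \<Longrightarrow> \<epsilon> > 0 \<Longrightarrow> \<exists>n\<ge>n0. \<forall>t\<in>T. dist (W n t) (w t) < \<epsilon>"
    using compact_pointwise_cluster[of "Y \<times> X" W] by metis
  define \<phi> where "\<phi> x = fst (w (x, y0))" for x
  define \<psi> where "\<psi> y = snd (w (x0, y))" for y
  have \<phi>Y: "\<phi> x \<in> Y" and \<psi>X: "\<psi> y \<in> X" for x y
    using w[of "(x, y0)"] w[of "(x0, y)"] by (auto simp: \<phi>_def \<psi>_def mem_Times_iff)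
  have near: "\<exists>n. e n \<le> \<epsilon> \<and> (\<forall>x\<in>A. dist (P n x) (\<phi> x) \<le> \<epsilon>) \<and> (\<forall>y\<in>B. dist (Q n y) (\<psi> y) \<le> \<epsilon>)"
    if AB: "finite A" "A \<subseteq> X" "finite B" "B \<subseteq> Y" "\<epsilon> > 0" for A B \<epsilon>
  proof -
    obtain n0 where n0: "inverse (real (Suc n0)) < \<epsilon>" using reals_Archimedean AB(5) by blast
    obtain n where n: "n \<ge> n0" "\<forall>t\<in>(\<lambda>x. (x, y0)) ` A \<union> (\<lambda>y. (x0, y)) ` B. dist (W n t) (w t) < \<epsilon>"
      using clust[of "(\<lambda>x. (x, y0)) ` A \<union> (\<lambda>y. (x0, y)) ` B" \<epsilon> n0] AB by blast
    have "e n \<le> inverse (real (Suc n0))" unfolding e_def using n(1) by (intro le_imp_inverse_le) auto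
    then have "e n \<le> \<epsilon>" using n0 by linarith
    moreover have "dist (P n x) (\<phi> x) \<le> \<epsilon>" if "x \<in> A" for x
    proof -
      have "dist (fst (W n (x, y0))) (fst (w (x, y0))) < \<epsilon>"
        using dist_fst_le[of "W n (x, y0)" "w (x, y0)"] by (rule order_le_less_trans) (use n(2) that in blast)
      then show ?thesis using that AB(2) by (auto simp: W_def \<phi>_def)
    qed
    moreover have "dist (Q n y) (\<psi> y) \<le> \<epsilon>" if "y \<in> B" for y
    proof -
      have "dist (snd (W n (x0, y))) (snd (w (x0, y))) < \<epsilon>"
        using dist_snd_le[of "W n (x0, y)" "w (x0, y)"] by (rule order_le_less_trans) (use n(2) that in blast)
      then show ?thesis using that AB(4) by (auto simp: W_def \<psi>_def)
    qed
    ultimately show ?thesis by blast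
  qed
  show ?thesis
  proof (rule that)
    show "\<phi> ` X \<subseteq> Y" "\<psi> ` Y \<subseteq> X" using \<phi>Y \<psi>X by auto
    show "\<psi> (\<phi> x) = x" if x: "x \<in> X" for x
    proof -
      have "dist (\<psi> (\<phi> x)) x = 0"
      proof (rule zero_of_small)
        fix \<epsilon> :: real assume "\<epsilon> > 0"
        then obtain n where n: "e n \<le> \<epsilon>" "dist (P n x) (\<phi> x) \<le> \<epsilon>" "dist (Q n (\<phi> x)) (\<psi> (\<phi> x)) \<le> \<epsilon>"
          using near[of "{x}" "{\<phi> x}" \<epsilon>] x \<phi>Y by auto
        have "\<bar>dist (Q n (\<phi> x)) x - dist (\<phi> x) (P n x)\<bar> \<le> e n"
          using dR[OF Q[OF \<phi>Y] P[OF x]] .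
        then have "dist (Q n (\<phi> x)) x \<le> 2 * \<epsilon>" using n by (simp add: dist_commute)
        moreover have "dist (\<psi> (\<phi> x)) x \<le> dist (Q n (\<phi> x)) (\<psi> (\<phi> x)) + dist (Q n (\<phi> x)) x"
          by (rule dist_triangle3)
        ultimately show "\<bar>dist (\<psi> (\<phi> x)) x\<bar> \<le> 3 * \<epsilon>" using n(3) by simp
      qed
      then show ?thesis by simp
    qed
    show "\<phi> (\<psi> y) = y" if y: "y \<in> Y" for y
    proof -
      have "dist (\<phi> (\<psi> y)) y = 0"
      proof (rule zero_of_small)
        fix \<epsilon> :: real assume "\<epsilon> > 0"
        then obtain n where n: "e n \<le> \<epsilon>" "dist (P n (\<psi> y)) (\<phi> (\<psi> y)) \<le> \<epsilon>" "dist (Q n y) (\<psi> y) \<le> \<epsilon>"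
          using near[of "{\<psi> y}" "{y}" \<epsilon>] y \<psi>X by auto
        have "\<bar>dist (\<psi> y) (Q n y) - dist (P n (\<psi> y)) y\<bar> \<le> e n"
          using dR[OF P[OF \<psi>X] Q[OF y]] .
        then have "dist (P n (\<psi> y)) y \<le> 2 * \<epsilon>" using n by (simp add: dist_commute)
        moreover have "dist (\<phi> (\<psi> y)) y \<le> dist (P n (\<psi> y)) (\<phi> (\<psi> y)) + dist (P n (\<psi> y)) y"
          by (rule dist_triangle3)
        ultimately show "\<bar>dist (\<phi> (\<psi> y)) y\<bar> \<le> 3 * \<epsilon>" using n(2) by simp
      qed
      then show ?thesis by simp
    qed
    show "dist (\<phi> x) (\<phi> x') = dist x x'" if x: "x \<in> X" "x' \<in> X" for x x'
    proof -
      have "dist (\<phi> x) (\<phi> x') - dist x x' = 0"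
      proof (rule zero_of_small)
        fix \<epsilon> :: real assume "\<epsilon> > 0"
        then obtain n where n: "e n \<le> \<epsilon>" "dist (P n x) (\<phi> x) \<le> \<epsilon>" "dist (P n x') (\<phi> x') \<le> \<epsilon>"
          using near[of "{x, x'}" "{}" \<epsilon>] x by auto
        have "\<bar>dist x x' - dist (P n x) (P n x')\<bar> \<le> e n" using dR[OF P P] x by blast
        moreover have "\<bar>dist (P n x) (P n x') - dist (\<phi> x) (\<phi> x')\<bar> \<le> dist (P n x) (\<phi> x) + dist (P n x') (\<phi> x')"
          using dist_triangle2[of "P n x" "P n x'" "\<phi> x'"] dist_triangle[of "P n x" "\<phi> x'" "\<phi> x"]
            dist_triangle2[of "\<phi> x" "\<phi> x'" "P n x'"] dist_triangle[of "\<phi> x" "P n x'" "P n x"]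
          by (simp add: dist_commute)
        ultimately show "\<bar>dist (\<phi> x) (\<phi> x') - dist x x'\<bar> \<le> 3 * \<epsilon>" using n by linarith
      qed
      then show ?thesis by simp
    qed
    show "g (\<phi> x) = f x" if x: "x \<in> X" for x
    proof -
      have "g (\<phi> x) - f x = 0"
      proof (rule zero_of_small)
        fix \<epsilon> :: real assume "\<epsilon> > 0"
        then obtain n where n: "e n \<le> \<epsilon>" "dist (P n x) (\<phi> x) \<le> \<epsilon>"
          using near[of "{x}" "{}" \<epsilon>] x by auto
        have "\<bar>f x - g (P n x)\<bar> \<le> e n" using hR[OF P[OF x]] .
        moreover have "\<bar>g (P n x) - g (\<phi> x)\<bar> \<le> dist (P n x) (\<phi> x)"
          using lipschitz_onD[OF lip, of "P n x" "\<phi> x"] mem[OF P[OF x]] \<phi>Y by (simp add: dist_real_def)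
        ultimately show "\<bar>g (\<phi> x) - f x\<bar> \<le> 3 * \<epsilon>" using n by linarith
      qed
      then show ?thesis by simp
    qed
  qed
qed

section \<open>Transport of paths along a correspondence\<close>

locale height_correspondence =
  source: height_space X f + target: height_space Y g
  for X :: "'a::metric_space set" and f and Y :: "'b::metric_space set" and g +
  fixes R :: "('a \<times> 'b) set" and r :: real
  assumes corr: "correspondence X Y R"
    and dist_close: "\<And>p y q z. (p, y) \<in> R \<Longrightarrow> (q, z) \<in> R \<Longrightarrow> \<bar>dist p q - dist y z\<bar> \<le> r"
    and height_close: "\<And>p y. (p, y) \<in> R \<Longrightarrow> \<bar>f p - g y\<bar> \<le> r"
begin

lemma corr_mem: "(p, y) \<in> R \<Longrightarrow> p \<in> X" "(p, y) \<in> R \<Longrightarrow> y \<in> Y"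
  using corr by (auto simp: correspondence_def)

lemma corr_total: "p \<in> X \<Longrightarrow> \<exists>y. (p, y) \<in> R"
  using corr by (force simp: correspondence_def)

text \<open>
  Corresponding points \<open>y\<close> and \<open>z\<close> are joined by a geodesic of length at most \<open>r + \<eta>\<close>. Changing from time
  \<open>a\<close> to time \<open>b\<close> at its midpoint keeps the height on the geodesic within \<open>(r + \<eta>) / 2\<close> of the height of
  the nearer end point, which is the origin of the factor \<open>3 / 2\<close>.
\<close>
lemma walk_jump:
  assumes \<delta>: "\<delta> > 0" and py: "(p, y) \<in> R" and qz: "(q, z) \<in> R" and pq: "dist p q \<le> \<eta>"
    and fp: "\<bar>f p - G a\<bar> \<le> \<eta>" and fq: "\<bar>f q - G b\<bar> \<le> \<eta>" and ab: "a \<le> b"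
  shows "(target.walk_step \<delta> (3 / 2 * (r + \<eta>) + \<delta>) G)\<^sup>*\<^sup>* (target.vertex \<delta> y, a) (target.vertex \<delta> z, b)"
proof -
  have yz: "y \<in> Y" "z \<in> Y" using corr_mem py qz by auto
  have dyz: "dist y z \<le> r + \<eta>" using dist_close[OF py qz] pq by linarith
  obtain m where m: "m \<in> Y" "dist y m = dist y z / 2" "dist m z = dist y z / 2"
    using geodesic_midpoint[OF target.geodesic yz] by blast
  have half: "path_component {u \<in> Y. \<bar>g u - G s\<bar> \<le> 3 / 2 * (r + \<eta>)} v m"
    if v: "v \<in> Y" "dist v m = dist y z / 2" "\<bar>g v - G s\<bar> \<le> r + \<eta>" for v s
  proof -
    obtain \<gamma> where \<gamma>: "path \<gamma>" "path_image \<gamma> \<subseteq> Y \<inter> cball v (dist v m)" "\<gamma> 0 = v" "\<gamma> 1 = m"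
      using geodesic_path_in_cball[OF target.geodesic v(1) m(1)] by blast
    have "\<bar>g u - G s\<bar> \<le> 3 / 2 * (r + \<eta>)" if "u \<in> Y" "dist v u \<le> dist v m" for u
    proof -
      have "\<bar>g v - g u\<bar> \<le> (r + \<eta>) / 2"
      proof -
        have "\<bar>g v - g u\<bar> \<le> dist v u" by (rule target.height_diff_le[OF v(1) that(1)])
        also have "\<dots> \<le> dist y z / 2" using that(2) v(2) by simp
        also have "\<dots> \<le> (r + \<eta>) / 2" using dyz by simp
        finally show ?thesis .
      qed
      then have "\<bar>g v - g u\<bar> + \<bar>g v - G s\<bar> \<le> 3 / 2 * (r + \<eta>)" using v(3) by argo
      moreover have "\<bar>g u - G s\<bar> \<le> \<bar>g v - g u\<bar> + \<bar>g v - G s\<bar>" by arith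
      ultimately show ?thesis by (rule order_trans[rotated])
    qed
    moreover have "u \<in> Y \<and> dist v u \<le> dist v m" if "u \<in> path_image \<gamma>" for u
      using \<gamma>(2) that by (metis IntE mem_cball subsetD)
    ultimately have "path_image \<gamma> \<subseteq> {u \<in> Y. \<bar>g u - G s\<bar> \<le> 3 / 2 * (r + \<eta>)}" by blast
    then show ?thesis
      using \<gamma> unfolding path_component_def pathstart_def pathfinish_def by blast
  qed
  have "\<bar>g y - G a\<bar> \<le> r + \<eta>" "\<bar>g z - G b\<bar> \<le> r + \<eta>"
    using height_close[OF py] height_close[OF qz] fp fq by linarith+
  with half[of y a] half[of z b] yz m(2,3)
  have c: "path_component {u \<in> Y. \<bar>g u - G a\<bar> \<le> 3 / 2 * (r + \<eta>)} y m"
    "path_component {u \<in> Y. \<bar>g u - G b\<bar> \<le> 3 / 2 * (r + \<eta>)} m z"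
    by (auto simp: dist_commute path_component_sym)
  have "\<bar>g m - G a\<bar> \<le> 3 / 2 * (r + \<eta>)" "\<bar>g m - G b\<bar> \<le> 3 / 2 * (r + \<eta>)"
    using path_component_mem[OF c(1)] path_component_mem[OF c(2)] by auto
  then have "target.walk_step \<delta> (3 / 2 * (r + \<eta>) + \<delta>) G (target.vertex \<delta> m, a) (target.vertex \<delta> m, b)"
    using target.admissible_vertex[where G = G, OF \<delta> m(1)] ab by (simp add: target.walk_step_def)
  with target.walk_along_path[where G = G and s = a, OF \<delta> c(1)]
    target.walk_along_path[where G = G and s = b, OF \<delta> c(2)]
  show ?thesis by (meson rtranclp.rtrancl_into_rtrancl rtranclp_trans)
qed

text \<open>
  Subdivide \<open>[0, 1]\<close> so finely that all classes on a subinterval are close to a single class \<open>\<beta> t\<close>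
  (semicontinuity): jump from \<open>\<beta> a\<close> into \<open>\<beta> t\<close>, move inside this connected set by small jumps at
  constant height and time, and jump to \<open>\<beta> b\<close>.
\<close>
lemma walk_of_reeb_path:
  assumes \<delta>: "\<delta> > 0" and \<eta>: "\<eta> > 0" and \<beta>: "pathin (reeb_topology X f) \<beta>"
    and xy: "(x, y) \<in> R" "(x', y') \<in> R" and ends: "\<beta> 0 = reeb_class X f x" "\<beta> 1 = reeb_class X f x'"
  shows "(target.walk_step \<delta> (3 / 2 * (r + \<eta>) + \<delta>) (reeb_fun f \<circ> \<beta>))\<^sup>*\<^sup>*
    (target.vertex \<delta> y, 0) (target.vertex \<delta> y', 1)"
proof -
  let ?G = "reeb_fun f \<circ> \<beta>"
  let ?W = "(target.walk_step \<delta> (3 / 2 * (r + \<eta>) + \<delta>) ?G)\<^sup>*\<^sup>*"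
  let ?v = "target.vertex \<delta>"
  have cls: "\<exists>p\<in>X. \<beta> t = reeb_class X f p" if "0 \<le> t" "t \<le> 1" for t
  proof -
    have "\<beta> t \<in> topspace (reeb_topology X f)"
      using \<beta> that unfolding pathin_def continuous_map_def by (auto simp: Pi_iff)
    then show ?thesis by (auto simp: reeb_graph_def)
  qed
  have in_cls: "p \<in> X \<and> f p = ?G t" if t: "0 \<le> t" "t \<le> 1" and p: "p \<in> \<beta> t" for p t
  proof -
    obtain q where q: "q \<in> X" "\<beta> t = reeb_class X f q" using cls[OF t] by blast
    then show ?thesis using p reeb_class_subset[of X f q] by (auto simp: reeb_fun_reeb_class)
  qed
  define P where "P a b \<longleftrightarrow> (0 \<le> a \<longrightarrow> a \<le> b \<longrightarrow> b \<le> 1 \<longrightarrow>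
    (\<forall>p\<in>\<beta> a. \<forall>q\<in>\<beta> b. \<forall>y z. (p, y) \<in> R \<longrightarrow> (q, z) \<in> R \<longrightarrow> ?W (?v y, a) (?v z, b)))" for a b
  have "P 0 1"
  proof (rule Bolzano)
    fix a b c assume abc: "P a b" "P b c" "a \<le> b" "b \<le> c"
    show "P a c"
      unfolding P_def
    proof (intro impI ballI allI)
      fix p q y z assume a: "0 \<le> a" "a \<le> c" "c \<le> 1" "p \<in> \<beta> a" "q \<in> \<beta> c" "(p, y) \<in> R" "(q, z) \<in> R"
      obtain o' where o': "o' \<in> \<beta> b" using cls[of b] abc a mem_reeb_class by fastforce
      then obtain u where u: "(o', u) \<in> R" using in_cls[of b o'] corr_total abc a by auto
      have "?W (?v y, a) (?v u, b)" using abc(1,3,4) a o' u by (auto simp: P_def)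
      moreover have "?W (?v u, b) (?v z, c)" using abc(2,3,4) a o' u by (auto simp: P_def)
      ultimately show "?W (?v y, a) (?v z, c)" by (rule rtranclp_trans)
    qed
  next
    fix t :: real assume t: "0 \<le> t" "t \<le> 1"
    define U where "U = (\<Union>p\<in>\<beta> t. ball p \<eta>)"
    have "openin (reeb_topology X f) {P \<in> reeb_graph X f. P \<subseteq> U}"
      by (rule reeb_class_upper_semicontinuous[OF source.compact source.continuous]) (auto simp: U_def)
    then have "openin (top_of_set {0..1}) {s \<in> {0..1}. \<beta> s \<in> {P \<in> reeb_graph X f. P \<subseteq> U}}"
      using \<beta> unfolding pathin_def continuous_map_def by auto
    moreover have "t \<in> {s \<in> {0..1}. \<beta> s \<in> {P \<in> reeb_graph X f. P \<subseteq> U}}"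
      using t cls[OF t] \<eta> by (auto simp: U_def reeb_graph_def)
    ultimately obtain d where d: "d > 0" "ball t d \<inter> {0..1} \<subseteq> {s \<in> {0..1}. \<beta> s \<in> {P \<in> reeb_graph X f. P \<subseteq> U}}"
      unfolding openin_contains_ball by blast
    have near: "\<exists>p'\<in>\<beta> t. dist p' p < \<eta>" if "0 \<le> s" "s \<le> 1" "\<bar>s - t\<bar> < d" "p \<in> \<beta> s" for s p
    proof -
      have "s \<in> ball t d \<inter> {0..1}" using that by (auto simp: dist_real_def)
      then show ?thesis using d(2) that(4) by (force simp: U_def)
    qed
    have within: "?W (?v y, t) (?v z, t)" if "p \<in> \<beta> t" "q \<in> \<beta> t" "(p, y) \<in> R" "(q, z) \<in> R" for p q y z
    proof -
      let ?C = "\<lambda>p q. \<forall>y z. (p, y) \<in> R \<longrightarrow> (q, z) \<in> R \<longrightarrow> ?W (?v y, t) (?v z, t)"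
      have "?C p q \<and> ?C q p"
      proof (rule connected_equivalence_relation[where S = "\<beta> t" and R = "\<lambda>p q. ?C p q \<and> ?C q p"])
        show "connected (\<beta> t)" using cls[OF t] by (auto simp: reeb_class_def)
        show "?C p1 p3 \<and> ?C p3 p1" if "?C p1 p2 \<and> ?C p2 p1" "?C p2 p3 \<and> ?C p3 p2" and p2: "p2 \<in> \<beta> t" for p1 p2 p3
        proof -
          obtain u where "(p2, u) \<in> R" using in_cls[OF t p2] corr_total by blast
          then show ?thesis using that(1,2) by (meson rtranclp_trans)
        qed
        fix p1 assume p1: "p1 \<in> \<beta> t"
        have "?C p1 p2 \<and> ?C p2 p1" if "p2 \<in> \<beta> t \<inter> ball p1 \<eta>" for p2
        proof -
          have "\<bar>f p1 - ?G t\<bar> \<le> \<eta>" "\<bar>f p2 - ?G t\<bar> \<le> \<eta>" "dist p1 p2 \<le> \<eta>" "dist p2 p1 \<le> \<eta>"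
            using in_cls[OF t, of p1] in_cls[OF t, of p2] p1 that \<eta> by (auto simp: dist_commute)
          then show ?thesis
            using walk_jump[OF \<delta>, of p1 _ p2 _ \<eta> ?G t t] walk_jump[OF \<delta>, of p2 _ p1 _ \<eta> ?G t t] by blast
        qed
        then show "\<exists>T. openin (top_of_set (\<beta> t)) T \<and> p1 \<in> T \<and> (\<forall>x\<in>T. ?C p1 x \<and> ?C x p1)"
          using p1 \<eta> by (intro exI[of _ "\<beta> t \<inter> ball p1 \<eta>"]) auto
      qed (use that in auto)
      then show ?thesis using that by blast
    qed
    have "P a b" if ab: "a \<le> t" "t \<le> b" "b - a < d" for a b
      unfolding P_def
    proof (intro impI ballI allI)
      fix p q y z assume a: "0 \<le> a" "a \<le> b" "b \<le> 1" "p \<in> \<beta> a" "q \<in> \<beta> b" "(p, y) \<in> R" "(q, z) \<in> R"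
      obtain p' where p': "p' \<in> \<beta> t" "dist p' p < \<eta>" using near[of a p] a ab by auto
      obtain q' where q': "q' \<in> \<beta> t" "dist q' q < \<eta>" using near[of b q] a ab by auto
      obtain y1 z1 where yz: "(p', y1) \<in> R" "(q', z1) \<in> R"
        using in_cls[OF t p'(1)] in_cls[OF t q'(1)] corr_total by blast
      have "f p = ?G a" "f q = ?G b" "f p' = ?G t" "f q' = ?G t"
        using in_cls[of a p] in_cls[of b q] in_cls[OF t p'(1)] in_cls[OF t q'(1)] a ab by auto
      then have h: "\<bar>f p - ?G a\<bar> \<le> \<eta>" "\<bar>f q - ?G b\<bar> \<le> \<eta>" "\<bar>f p' - ?G t\<bar> \<le> \<eta>" "\<bar>f q' - ?G t\<bar> \<le> \<eta>"
        using \<eta> by auto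
      have dd: "dist p p' \<le> \<eta>" "dist q' q \<le> \<eta>" using p' q' by (auto simp: dist_commute)
      have "?W (?v y, a) (?v y1, t)"
        by (rule walk_jump[OF \<delta> a(6) yz(1) dd(1) h(1,3) ab(1)])
      moreover have "?W (?v z1, t) (?v z, b)"
        by (rule walk_jump[OF \<delta> yz(2) a(7) dd(2) h(4,2) ab(2)])
      ultimately show "?W (?v y, a) (?v z, b)"
        using within[OF p'(1) q'(1) yz] by (meson rtranclp_trans)
    qed
    then show "\<exists>d>0. \<forall>a b. a \<le> t \<and> t \<le> b \<and> b - a < d \<longrightarrow> P a b" using d(1) by blast
  qed simp
  moreover have "x \<in> \<beta> 0" "x' \<in> \<beta> 1"
    using corr_mem(1)[OF xy(1)] corr_mem(1)[OF xy(2)] ends by (simp_all add: mem_reeb_class)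
  ultimately show ?thesis
    using xy unfolding P_def by (simp only: order_refl zero_le_one)
qed

lemma reeb_dist_nonneg:
  assumes "P \<in> reeb_graph X f" "Q \<in> reeb_graph X f"
  shows "0 \<le> reeb_dist X f P Q"
proof -
  have "0 \<le> ereal (reeb_dist X f P Q)"
    unfolding reeb_dist_finite[OF source.geodesic source.lipschitz assms]
    by (intro INF_greatest) (auto simp: curve_length_def intro!: SUP_upper2 [of "[]"])
  then show ?thesis by simp
qed

text \<open>
  The comparison of the two Reeb metrics. The image of an almost shortest path is a walk; after loop
  erasure it has at most \<open>B\<close> lower turns, so the number of its steps times the width \<open>\<delta>\<close> exceeds the length of
  the path by at most \<open>(4 B + 4) * e\<close>, where \<open>e\<close> is close to \<open>3 / 2 * r\<close>.
\<close>
lemma reeb_dist_le: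
  assumes fin: "finite (local_minima Y g)"
    and B: "betti_number 1 (top_of_set Y) + enat (card (local_minima Y g)) \<le> enat B"
    and xy: "(x, y) \<in> R" "(x', y') \<in> R"
  shows "reeb_dist Y g (reeb_class Y g y) (reeb_class Y g y')
    \<le> reeb_dist X f (reeb_class X f x) (reeb_class X f x') + 6 * (real B + 1) * r"
proof (rule reeb_dist_le_of_approximate_paths[OF target.compact target.geodesic target.lipschitz])
  let ?d = "reeb_dist X f (reeb_class X f x) (reeb_class X f x')"
  have mem: "x \<in> X" "x' \<in> X" "y \<in> Y" "y' \<in> Y" using xy corr_mem by auto
  then have cls: "reeb_class X f x \<in> reeb_graph X f" "reeb_class X f x' \<in> reeb_graph X f"
    by (auto simp: reeb_graph_def)
  show "y \<in> Y" "y' \<in> Y" using mem by auto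
  have r: "r \<ge> 0" using height_close[OF xy(1)] by linarith
  show "0 \<le> ?d + 6 * (real B + 1) * r"
    using reeb_dist_nonneg[OF cls] r by simp
  fix \<epsilon> :: real assume "\<epsilon> > 0"
  \<comment> \<open>One parameter \<open>\<delta>\<close> serves as slab width and as jump size; its value makes all error terms that do
    not involve \<open>r\<close> add up to \<open>\<epsilon>\<close>.\<close>
  define \<delta> where "\<delta> = \<epsilon> / (2 * (10 * (real B + 1) + 3))"
  have \<delta>: "\<delta> > 0" "\<epsilon> / 2 + 10 * (real B + 1) * \<delta> + 3 * \<delta> = \<epsilon>"
  proof -
    show "\<delta> > 0" using \<open>\<epsilon> > 0\<close> by (simp add: \<delta>_def)
    have "(10 * (real B + 1) + 3) * \<delta> = \<epsilon> / 2" by (simp add: \<delta>_def field_simps)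
    then show "\<epsilon> / 2 + 10 * (real B + 1) * \<delta> + 3 * \<delta> = \<epsilon>" by (simp add: algebra_simps)
  qed
  have "(INF \<beta> \<in> {\<beta>. pathin (reeb_topology X f) \<beta> \<and> \<beta> 0 = reeb_class X f x \<and> \<beta> 1 = reeb_class X f x'}.
       curve_length (reeb_fun f \<circ> \<beta>)) < ereal (?d + \<epsilon> / 2)"
    using \<open>\<epsilon> > 0\<close> unfolding reeb_dist_finite[OF source.geodesic source.lipschitz cls, symmetric] by simp
  then obtain \<beta> where \<beta>: "pathin (reeb_topology X f) \<beta>" "\<beta> 0 = reeb_class X f x" "\<beta> 1 = reeb_class X f x'"
    "curve_length (reeb_fun f \<circ> \<beta>) < ereal (?d + \<epsilon> / 2)"
    unfolding INF_less_iff by blast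
  define G where "G = reeb_fun f \<circ> \<beta>"
  define e where "e = 3 / 2 * (r + \<delta>) + \<delta>"
  have e: "e \<ge> 0" using r \<delta>(1) by (simp add: e_def)
  have "(target.walk_step \<delta> e G)\<^sup>*\<^sup>* (target.vertex \<delta> y, 0) (target.vertex \<delta> y', 1)"
    unfolding G_def e_def using walk_of_reeb_path[OF \<delta>(1) \<delta>(1) \<beta>(1) xy \<beta>(2,3)] .
  moreover have "target.admissible \<delta> e G (target.vertex \<delta> y, 0)"
    unfolding e_def
  proof (rule target.admissible_vertex[OF \<delta>(1) mem(3)])
    have "G 0 = f x" by (simp add: G_def \<beta>(2) reeb_fun_reeb_class mem)
    then have "\<bar>g y - G 0\<bar> \<le> r" using height_close[OF xy(1)] by (simp add: abs_minus_commute)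
    then show "\<bar>g y - G 0\<bar> \<le> 3 / 2 * (r + \<delta>)" using \<delta>(1) r by argo
  qed
  ultimately obtain N V T where "target.walk_seq \<delta> e G N V T" "V 0 = target.vertex \<delta> y"
    "V N = target.vertex \<delta> y'" "0 \<le> T 0" "T N \<le> 1"
    using target.walk_seq_of_rtranclp by (metis fst_conv snd_conv)
  then obtain N V T where W: "target.walk_seq \<delta> e G N V T" "V 0 = target.vertex \<delta> y"
    "V N = target.vertex \<delta> y'" "0 \<le> T 0" "T N \<le> 1" "inj_on V {..N}"
    by (rule target.simple_walk_exists)
  define k where "k i = fst (V i)" for i
  let ?J = "{j. 0 < j \<and> j < N \<and> k (j - 1) = k j + 1 \<and> k (Suc j) = k j + 1}"
  have adm: "target.slab_component \<delta> (k i) (snd (V i))" "\<bar>of_int (k i) * \<delta> - G (T i)\<bar> \<le> e" if "i \<le> N" for i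
  proof -
    have "target.admissible \<delta> e G (V i, T i)" using W(1) that by (simp add: target.walk_seq_def)
    then show "target.slab_component \<delta> (k i) (snd (V i))" "\<bar>of_int (k i) * \<delta> - G (T i)\<bar> \<le> e"
      by (cases "V i"; simp add: target.admissible_def k_def)+
  qed
  have adj: "\<bar>k (Suc i) - k i\<bar> = 1" "snd (V i) \<inter> snd (V (Suc i)) \<noteq> {}" if "i < N" for i
    using W(1) that by (auto simp: target.walk_seq_def target.adjacent_def k_def)
  have "enat (card ?J) \<le> betti_number 1 (top_of_set Y) + enat (card (local_minima Y g))"
  proof (rule target.card_lower_turns_le[where C = "\<lambda>i. snd (V i)", OF \<delta>(1) adm(1) adj(2,1) _ fin])
    fix i j assume "i \<le> N" "j \<le> N" "k i = k j" "snd (V i) = snd (V j)"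
    then have "V i = V j" by (simp add: k_def prod_eq_iff)
    then show "i = j" using inj_onD[OF W(6)] \<open>i \<le> N\<close> \<open>j \<le> N\<close> by simp
  qed
  from order_trans[OF this B] have "card ?J \<le> B" by (simp only: enat_ord_simps)
  then have J: "e * (4 * card ?J + 4) \<le> e * (4 * real B + 4)"
    using e by (intro mult_left_mono) auto
  have "ereal (\<Sum>i<N. \<bar>G (T (Suc i)) - G (T i)\<bar>) \<le> curve_length G"
    using sum_le_curve_length[OF target.walk_seq_mono[OF W(1)] W(4,5), of G]
    by (simp add: dist_real_def abs_minus_commute)
  also have "\<dots> < ereal (?d + \<epsilon> / 2)" using \<beta>(4) by (simp add: G_def)
  finally have "(\<Sum>i<N. \<bar>G (T (Suc i)) - G (T i)\<bar>) \<le> ?d + \<epsilon> / 2" by simp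
  then have len: "N * \<delta> \<le> ?d + \<epsilon> / 2 + e * (4 * real B + 4)"
  proof -
    have "N * \<delta> \<le> (\<Sum>i<N. \<bar>G (T (Suc i)) - G (T i)\<bar>) + e * (4 * card ?J + 4)"
      by (rule zigzag_length_le[where F = "\<lambda>i. G (T i)", OF \<delta>(1) e]) (use adj(1) adm(2) in auto)
    then show ?thesis
      using J \<open>(\<Sum>i<N. \<bar>G (T (Suc i)) - G (T i)\<bar>) \<le> ?d + \<epsilon> / 2\<close> by linarith
  qed
  have "e * (4 * real B + 4) = 6 * (real B + 1) * r + 10 * (real B + 1) * \<delta>"
    by (simp add: e_def algebra_simps)
  then have len': "N * \<delta> \<le> ?d + 6 * (real B + 1) * r + (\<epsilon> - 3 * \<delta>)"
    using len \<delta>(2) by linarith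
  have yV: "y \<in> snd (V 0)" "y' \<in> snd (V N)"
    using W(2,3) target.vertex_slab(3)[OF \<delta>(1)] mem by simp_all
  from target.approximate_path_of_walk[OF \<delta>(1) W(1) yV]
  obtain w where w: "w 0 = y \<and> w 1 = y' \<and>
    (\<forall>s t. 0 \<le> s \<and> s \<le> t \<and> t \<le> 1 \<longrightarrow> (\<exists>K. connected K \<and> K \<subseteq> Y \<and> w s \<in> K \<and> w t \<in> K \<and>
       (\<forall>p\<in>K. \<forall>q\<in>K. \<bar>g p - g q\<bar> \<le> N * \<delta> * (t - s) + 3 * \<delta>)))" ..
  have bound: "N * \<delta> * (t - s) + 3 * \<delta> \<le> (?d + 6 * (real B + 1) * r) * (t - s) + \<epsilon>"
    if "0 \<le> s" "s \<le> t" "t \<le> 1" for s t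
  proof -
    have "N * \<delta> * (t - s) \<le> (?d + 6 * (real B + 1) * r + (\<epsilon> - 3 * \<delta>)) * (t - s)"
      using len' that by (intro mult_right_mono) auto
    moreover have "(\<epsilon> - 3 * \<delta>) * (t - s) \<le> (\<epsilon> - 3 * \<delta>) * 1"
    proof (rule mult_left_mono)
      have "0 \<le> 10 * (real B + 1) * \<delta>" using \<delta>(1) by simp
      then show "0 \<le> \<epsilon> - 3 * \<delta>" using \<delta>(2) \<open>\<epsilon> > 0\<close> by linarith
    qed (use that in auto)
    ultimately show ?thesis by (simp add: algebra_simps)
  qed
  show "\<exists>w. w 0 = y \<and> w 1 = y' \<and> (\<forall>s t. 0 \<le> s \<and> s \<le> t \<and> t \<le> 1 \<longrightarrow>
      (\<exists>K. connected K \<and> K \<subseteq> Y \<and> w s \<in> K \<and> w t \<in> K \<and>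
       (\<forall>p\<in>K. \<forall>q\<in>K. \<bar>g p - g q\<bar> \<le> (?d + 6 * (real B + 1) * r) * (t - s) + \<epsilon>)))"
    using w bound by (intro exI[of _ w]) (meson order_trans)
qed

end

section \<open>Stability of Reeb metric graphs\<close>

lemma distortion_fun_nonneg:
  assumes "R \<noteq> {}"
  shows "0 \<le> distortion_fun dA f dB g R"
proof -
  obtain x y where "(x, y) \<in> R" using assms by auto
  then have "ereal \<bar>f x - g y\<bar> \<le> (SUP (x, y)\<in>R. ereal \<bar>f x - g y\<bar>)"
    by (intro SUP_upper2[of "(x, y)"]) auto
  then have "0 \<le> (SUP (x, y)\<in>R. ereal \<bar>f x - g y\<bar>)"
    by (rule order_trans[rotated]) simp
  then show ?thesis by (simp add: distortion_fun_def le_max_iff_disj)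
qed

lemma GH_dist_fun_nonneg:
  assumes "A \<noteq> {}"
  shows "0 \<le> GH_dist_fun A dA f B dB g"
proof -
  have "0 \<le> (INF R \<in> {R. correspondence A B R}. distortion_fun dA f dB g R)"
    using assms by (intro INF_greatest distortion_fun_nonneg) (auto simp: correspondence_def)
  then show ?thesis unfolding GH_dist_fun_def by simp
qed

lemma GH_dist_reeb_le_distortion:
  assumes R: "correspondence X Y R"
    and le: "\<And>x y x' y'. (x, y) \<in> R \<Longrightarrow> (x', y') \<in> R \<Longrightarrow>
      \<bar>reeb_dist X f (reeb_class X f x) (reeb_class X f x') -
       reeb_dist Y g (reeb_class Y g y) (reeb_class Y g y')\<bar> \<le> c"
  shows "GH_dist (reeb_graph X f) (reeb_dist X f) (reeb_graph Y g) (reeb_dist Y g) \<le> ereal c / 2"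
proof -
  define S where "S = map_prod (reeb_class X f) (reeb_class Y g) ` R"
  have "fst ` S = reeb_class X f ` fst ` R" "snd ` S = reeb_class Y g ` snd ` R"
    by (simp_all add: S_def image_image)
  then have fs: "fst ` S = reeb_graph X f" "snd ` S = reeb_graph Y g"
    using R by (simp_all add: correspondence_def reeb_graph_def)
  then have "correspondence (reeb_graph X f) (reeb_graph Y g) S"
    unfolding correspondence_def using subset_fst_snd[of S] by simp
  moreover have "distortion (reeb_dist X f) (reeb_dist Y g) S \<le> ereal c"
  proof -
    have bound: "\<bar>reeb_dist X f P P' - reeb_dist Y g Q Q'\<bar> \<le> c" if PQ: "(P, Q) \<in> S" "(P', Q') \<in> S" for P Q P' Q'
    proof -
      obtain x y where xy: "(x, y) \<in> R" "P = reeb_class X f x" "Q = reeb_class Y g y"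
        using PQ(1) unfolding S_def by auto
      obtain x' y' where xy': "(x', y') \<in> R" "P' = reeb_class X f x'" "Q' = reeb_class Y g y'"
        using PQ(2) unfolding S_def by auto
      show ?thesis unfolding xy(2,3) xy'(2,3) by (rule le[OF xy(1) xy'(1)])
    qed
    have *: "ereal \<bar>reeb_dist X f (fst i) (fst j) - reeb_dist Y g (snd i) (snd j)\<bar> \<le> ereal c"
      if "i \<in> S" "j \<in> S" for i j
      using bound[of "fst i" "snd i" "fst j" "snd j"] that by simp
    show ?thesis
      unfolding distortion_def case_prod_unfold by (rule SUP_least, rule SUP_least, rule *)
  qed
  ultimately show ?thesis
    unfolding GH_dist_def by (intro ereal_divide_right_mono INF_lower2[of S]) auto
qed

lemma num_local_minima_pos:
  assumes "height_space Y g" "Y \<noteq> {}" "finite (local_minima Y g)"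
  shows "1 \<le> card (local_minima Y g)"
proof -
  obtain y where y: "y \<in> Y" using assms(2) by blast
  obtain \<mu> where "\<mu> \<in> local_minima Y g"
    by (rule height_space.local_minimum_below[OF assms(1) y less_add_one])
  then have "local_minima Y g \<noteq> {}" by blast
  then show ?thesis using assms(3) by (simp add: Suc_le_eq card_gt_0_iff)
qed

lemma GH_dist_reeb_le_of_distortion_fun:
  fixes X :: "'a::metric_space set" and Y :: "'b::metric_space set"
  assumes X: "height_space X f" and Y: "height_space Y g"
    and finX: "finite (local_minima X f)" and finY: "finite (local_minima Y g)"
    and BX: "betti_number 1 (top_of_set X) + enat (card (local_minima X f)) \<le> enat B"
    and BY: "betti_number 1 (top_of_set Y) + enat (card (local_minima Y g)) \<le> enat B"
    and R: "correspondence X Y R" "distortion_fun dist f dist g R \<le> ereal r"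
  shows "GH_dist (reeb_graph X f) (reeb_dist X f) (reeb_graph Y g) (reeb_dist Y g)
    \<le> ereal (6 * (real B + 1) * r) / 2"
proof (rule GH_dist_reeb_le_distortion[OF R(1)])
  interpret X: height_space X f by (rule X)
  interpret Y: height_space Y g by (rule Y)
  interpret XY: height_correspondence X f Y g R r
    by unfold_locales (use R distortion_fun_bounds[OF R(2)] in blast)+
  interpret YX: height_correspondence Y g X f "R\<inverse>" r
  proof unfold_locales
    show "correspondence Y X (R\<inverse>)"
      using R(1) unfolding correspondence_def by (auto simp: image_iff converse_unfold) (metis fst_conv snd_conv)+
    show "\<bar>dist p q - dist y z\<bar> \<le> r" if "(p, y) \<in> R\<inverse>" "(q, z) \<in> R\<inverse>" for p q y z
      using XY.dist_close[of y p z q] that by (simp add: abs_minus_commute)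
    show "\<bar>g p - f y\<bar> \<le> r" if "(p, y) \<in> R\<inverse>" for p y
      using XY.height_close[of y p] that by (simp add: abs_minus_commute)
  qed
  fix x y x' y' assume "(x, y) \<in> R" "(x', y') \<in> R"
  then show "\<bar>reeb_dist X f (reeb_class X f x) (reeb_class X f x') -
       reeb_dist Y g (reeb_class Y g y) (reeb_class Y g y')\<bar> \<le> 6 * (real B + 1) * r"
    using XY.reeb_dist_le[OF finY BY, of x y x' y'] YX.reeb_dist_le[OF finX BX, of y x y' x'] by auto
qed

theorem theorem5:
  fixes X :: "'a::metric_space set" and Y :: "'b::metric_space set"
    and f :: "'a \<Rightarrow> real" and g :: "'b \<Rightarrow> real"
  assumes "X \<noteq> {}" and "compact X" and "geodesic_space X"
    and "Y \<noteq> {}" and "compact Y" and "geodesic_space Y"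
    and "1-lipschitz_on X f" and "1-lipschitz_on Y g"
  shows "GH_dist (reeb_graph X f) (reeb_dist X f) (reeb_graph Y g) (reeb_dist Y g)
    \<le> (8 * ereal_of_enat (betti_number 1 (top_of_set X))
       + 8 * ereal_of_enat (betti_number 1 (top_of_set Y))
       + 8 * ereal_of_enat (num_local_minima X f)
       + 8 * ereal_of_enat (num_local_minima Y g) - 4)
      * GH_dist_fun X dist f Y dist g"
    (is "?GH \<le> ?C * ?D")
proof -
  have X: "height_space X f" and Y: "height_space Y g"
    using assms by (simp_all add: height_space_def)
  have D0: "0 \<le> ?D" by (rule GH_dist_fun_nonneg[OF assms(1)])
  show ?thesis
  proof (cases "betti_number 1 (top_of_set X) = \<infinity> \<or> betti_number 1 (top_of_set Y) = \<infinity> \<or>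
      infinite (local_minima X f) \<or> infinite (local_minima Y g)")
    case True
    then have C: "?C = \<infinity>"
      unfolding num_local_minima_def
      by (cases "betti_number 1 (top_of_set X)"; cases "betti_number 1 (top_of_set Y)") auto
    \<comment> \<open>If \<open>?D = 0\<close>, the right-hand side is \<open>\<infinity> * 0 = 0\<close>.\<close>
    show ?thesis
    proof (cases "?D = 0")
      case False
      then have top: "?C * ?D = \<infinity>" unfolding C using D0 by (cases ?D) auto
      show ?thesis unfolding top by simp
    next
      case True
      obtain \<phi> \<psi> where iso: "\<phi> ` X \<subseteq> Y" "\<psi> ` Y \<subseteq> X"
        "\<And>x. x \<in> X \<Longrightarrow> \<psi> (\<phi> x) = x" "\<And>y. y \<in> Y \<Longrightarrow> \<phi> (\<psi> y) = y"
        "\<And>x x'. x \<in> X \<Longrightarrow> x' \<in> X \<Longrightarrow> dist (\<phi> x) (\<phi> x') = dist x x'"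
        "\<And>x. x \<in> X \<Longrightarrow> g (\<phi> x) = f x"
        by (rule isometry_of_GH_dist_fun_zero[OF assms(2,1,5,4,8) True]) (blast intro: that)
      have contX: "continuous_on X \<phi>"
        unfolding continuous_on_iff using iso(5) by metis
      have "dist (\<psi> y) (\<psi> y') = dist y y'" if "y \<in> Y" "y' \<in> Y" for y y'
      proof -
        have "\<psi> y \<in> X" "\<psi> y' \<in> X" using iso(2) that by blast+
        from iso(5)[OF this] show ?thesis by (simp add: iso(4) that)
      qed
      then have contY: "continuous_on Y \<psi>"
        unfolding continuous_on_iff by metis
      have fg: "f (\<psi> y) = g y" if "y \<in> Y" for y
      proof -
        have "\<psi> y \<in> X" using iso(2) that by blast
        from iso(6)[OF this] show ?thesis by (simp add: iso(4) that)
      qed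
      have eq: "reeb_dist Y g (reeb_class Y g (\<phi> x)) (reeb_class Y g (\<phi> x')) =
          reeb_dist X f (reeb_class X f x) (reeb_class X f x')" if x: "x \<in> X" "x' \<in> X" for x x'
      proof (rule antisym)
        show "reeb_dist Y g (reeb_class Y g (\<phi> x)) (reeb_class Y g (\<phi> x'))
            \<le> reeb_dist X f (reeb_class X f x) (reeb_class X f x')"
          by (rule reeb_dist_homeomorphism_le[OF assms(3,7,6,8) contX iso(1) contY iso(2,3,4,6) x])
        have "\<phi> x \<in> Y" "\<phi> x' \<in> Y" using iso(1) x by auto
        from reeb_dist_homeomorphism_le[OF assms(6,8,3,7) contY iso(2) contX iso(1,4,3) fg this]
        show "reeb_dist X f (reeb_class X f x) (reeb_class X f x')
            \<le> reeb_dist Y g (reeb_class Y g (\<phi> x)) (reeb_class Y g (\<phi> x'))"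
          by (simp add: iso(3) x)
      qed
      have "correspondence X Y ((\<lambda>x. (x, \<phi> x)) ` X)"
        using iso(1,2,4) unfolding correspondence_def by (force simp: image_image)
      then have "?GH \<le> ereal 0 / 2"
        by (rule GH_dist_reeb_le_distortion) (auto simp: eq)
      then show ?thesis unfolding True by (simp flip: zero_ereal_def)
    qed
  next
    case False
    then obtain bX bY where b: "betti_number 1 (top_of_set X) = enat bX" "betti_number 1 (top_of_set Y) = enat bY"
      by auto
    define mX mY where "mX = card (local_minima X f)" and "mY = card (local_minima Y g)"
    have fin: "finite (local_minima X f)" "finite (local_minima Y g)" using False by auto
    have m: "1 \<le> mX" "1 \<le> mY"
      using num_local_minima_pos[OF X assms(1) fin(1)] num_local_minima_pos[OF Y assms(4) fin(2)]
      by (simp_all add: mX_def mY_def)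
    define B where "B = max (bX + mX) (bY + mY)"
    define c where "c = 8 * real bX + 8 * real bY + 8 * real mX + 8 * real mY - 4"
    have C: "?C = ereal c"
      using fin by (simp add: b num_local_minima_def mX_def mY_def c_def del: One_nat_def)
    \<comment> \<open>With \<open>b\<close> and \<open>m\<close> for the Betti numbers and the numbers of local minima, \<open>B\<close> is \<open>b + m\<close> for one of
      the spaces, and the other space has \<open>m \<ge> 1\<close>, so \<open>c \<ge> 8 B + 4 \<ge> 6 B + 6\<close>.\<close>
    have c: "6 * (real B + 1) \<le> c" "c > 0" using m by (auto simp: B_def c_def max_def)
    have "?GH * 2 / ereal c \<le> (INF R \<in> {R. correspondence X Y R}. distortion_fun dist f dist g R)"
    proof (rule INF_greatest)
      fix R assume "R \<in> {R. correspondence X Y R}"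
      then have R: "correspondence X Y R" "R \<noteq> {}" using assms(1) by (auto simp: correspondence_def)
      show "?GH * 2 / ereal c \<le> distortion_fun dist f dist g R"
      proof (cases "distortion_fun dist f dist g R")
        case (real r)
        have "r \<ge> 0" using distortion_fun_nonneg[OF R(2), of dist f dist g] real by simp
        have "?GH \<le> ereal (6 * (real B + 1) * r) / 2"
          by (rule GH_dist_reeb_le_of_distortion_fun[OF X Y fin _ _ R(1)])
             (simp_all add: b real B_def del: One_nat_def flip: mX_def mY_def)
        also have "\<dots> \<le> ereal (c * r) / 2"
          using c(1) \<open>r \<ge> 0\<close> by (intro ereal_divide_right_mono) (auto intro: mult_right_mono)
        finally have "?GH \<le> ereal (c * r / 2)" by simp
        then show ?thesis
          unfolding real using c(2) by (cases ?GH) (auto simp: field_simps)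
      qed (use distortion_fun_nonneg[OF R(2), of dist f dist g] in auto)
    qed
    then have "?GH * 2 / ereal c / 2 \<le> ?D"
      unfolding GH_dist_fun_def by (rule ereal_divide_right_mono) simp
    then show ?thesis
      unfolding C using c(2) D0 by (cases ?D; cases ?GH) (auto simp: field_simps)
  qed
qed

end
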